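(* Let $d\ge 1$ and let $X_1,\dots,X_n$ be i.i.d. points taking values in $\mathbb{R}^d$, sampled from a common density function $f\colon\mathbb{R}^d\to\mathbb{R}$ that is continuous almost everywhere with respect to the Lebesgue measure. Consider the finite augmented metric space $(M=\{X_1,\dots,X_n\},d_M,f)$, where $d_M$ is the metric induced by the Euclidean metric of $\mathbb{R}^d$ and $f$ is restricted to $M$, and let $S$ be its density-Rips persistent set. Let $\mathfrak{I}_n$ be the random variable that counts the number of summands isomorphic to interval modules in the decomposition of $\mathcal{L}S$ into indecomposable summands, and let $\mathfrak{S}_n$ be the random variable that counts the total number of summands in the same decomposition. Then $$\liminf_{n\to\infty}\mathrm{E}\left[\frac{\mathfrak{I}_n}{\mathfrak{S}_n}\right]\ \ge\ c(d),$$ where $c(d)$ is the constant, depending only on $d$, defined in the context, which satisfies $c(1)=\frac13$, $c(2)\approx 0.31$, and $c(d)\downarrow\frac14$ as $d\to\infty$.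
   Context: The constant is $c(d):=b(d)/2$, where $b(d)$ is the volume of a unit ball in $\mathbb{R}^d$ divided by the volume of the union of two unit balls in $\mathbb{R}^d$ whose centers are at distance $1$. Let $P$ be a finite poset, viewed as a category. A persistent set over $P$ is a functor $S\colon P\to\mathsf{Set}$ to finite sets; a persistence module over $P$ is a functor $P\to\mathsf{Vec}$ to finite-dimensional vector spaces over a fixed field $K$. Morphisms are natural transformations. The linearization functor $\mathcal{L}$ from persistent sets to persistence modules is postcomposition with the functor taking a finite set to the free $K$-vector space on it. Direct sums of persistence modules are taken pointwise; a persistence module $F$ is indecomposable if $F\cong F_1\oplus F_2$ implies $F_1=0$ or $F_2=0$. Decompositions into nonzero indecomposables are unique up to permutation and isomorphism of the summands (Krull-Schmidt). Let $I\subseteq P$ be a non-empty connected subposet such that $i\le l\le j$ with $i,j\in I$, $l\in P$ implies $l\in I$. The interval module supported on $I$ is the persistence module with value $K$ at $p\in I$ and $0$ at $p\notin I$, whose internal maps $p\to q$ are the identity if $p,q\in I$ and zero otherwise. "Intervals" in a decomposition are indecomposable summands isomorphic to interval modules, counted with multiplicity. An augmented metric space is a triple $(M,d,f)$ with $(M,d)$ a finite metric space and $f\colon M\to\mathbb{R}$ a function. For $\sigma\in\mathbb{R}$ put $M_\sigma:=\{x\in M: f(x)\le\sigma\}$. For a finite metric space $N$ and $\varepsilon\ge 0$, $\mathcal{G}_\varepsilon(N)$ is the undirected graph with vertex set $N$ and an edge between $x,y$ whenever $d(x,y)\le\varepsilon$. Put $P:=D\times T\subset\mathbb{R}_{\ge0}\times\mathbb{R}$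 with $D:=\{d(x,y):x,y\in M\}$ and $T:=\{f(x):x\in M\}$, ordered by $(\varepsilon,\sigma)\le(\varepsilon',\sigma')$ iff $\varepsilon\le\varepsilon'$ and $\sigma\le\sigma'$. The density-Rips persistent set of $(M,d,f)$ is the functor $S\colon P\to\mathsf{Set}$ sending $(\varepsilon,\sigma)$ to the set of connected components of $\mathcal{G}_\varepsilon(M_\sigma)$, with maps induced by the inclusions of graphs. *)

theory Defs
  imports "HOL-Probability.Probability" "HOL-Library.Function_Algebras"
begin

text \<open>
  The poset is a subset \<open>P\<close> of an ordered type.  Only the values \<open>Ob F p\<close> for \<open>p \<in> P\<close> and the
  maps \<open>Mor F p q\<close>, restricted to \<open>Ob F p\<close>, for \<open>p \<le> q\<close> in \<open>P\<close>, are meaningful.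
\<close>

record ('p, 'x) diagram =
  Ob :: "'p \<Rightarrow> 'x set"
  Mor :: "'p \<Rightarrow> 'p \<Rightarrow> 'x \<Rightarrow> 'x"

definition functor_on :: "'p::order set \<Rightarrow> ('p, 'x) diagram \<Rightarrow> bool" where
  "functor_on P F \<longleftrightarrow>
     (\<forall>p\<in>P. \<forall>q\<in>P. p \<le> q \<longrightarrow> Mor F p q ` Ob F p \<subseteq> Ob F q) \<and>
     (\<forall>p\<in>P. \<forall>x\<in>Ob F p. Mor F p p x = x) \<and>
     (\<forall>p\<in>P. \<forall>q\<in>P. \<forall>r\<in>P. p \<le> q \<longrightarrow> q \<le> r \<longrightarrow>
        (\<forall>x\<in>Ob F p. Mor F p r x = Mor F q r (Mor F p q x)))"

definition persistent_set :: "'p::order set \<Rightarrow> ('p, 'x) diagram \<Rightarrow> bool" where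
  "persistent_set P S \<longleftrightarrow> functor_on P S \<and> (\<forall>p\<in>P. finite (Ob S p))"

text \<open>
  The vector spaces of a persistence module are finite-dimensional subspaces of one ambient vector
  space, given by a type \<open>'v\<close> and a scalar multiplication \<open>s\<close> (with scalars in a field type \<open>'k\<close>).
\<close>

definition linear_between ::
  "('k \<Rightarrow> 'v::plus \<Rightarrow> 'v) \<Rightarrow> ('k \<Rightarrow> 'w::plus \<Rightarrow> 'w) \<Rightarrow> 'v set \<Rightarrow> 'w set \<Rightarrow> ('v \<Rightarrow> 'w) \<Rightarrow> bool" where
  "linear_between s t V W h \<longleftrightarrow>
     (\<forall>x\<in>V. h x \<in> W) \<and>
     (\<forall>x\<in>V. \<forall>y\<in>V. h (x + y) = h x + h y) \<and>
     (\<forall>c. \<forall>x\<in>V. h (s c x) = t c (h x))"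

definition persistence_module ::
  "('k::field \<Rightarrow> 'v::ab_group_add \<Rightarrow> 'v) \<Rightarrow> 'p::order set \<Rightarrow> ('p, 'v) diagram \<Rightarrow> bool" where
  "persistence_module s P F \<longleftrightarrow>
     vector_space s \<and> functor_on P F \<and>
     (\<forall>p\<in>P. \<exists>B. finite B \<and> Ob F p = module.span s B) \<and>
     (\<forall>p\<in>P. \<forall>q\<in>P. p \<le> q \<longrightarrow> linear_between s s (Ob F p) (Ob F q) (Mor F p q))"

definition module_iso ::
  "('k::field \<Rightarrow> 'v::ab_group_add \<Rightarrow> 'v) \<Rightarrow> ('k \<Rightarrow> 'w::ab_group_add \<Rightarrow> 'w) \<Rightarrow>
     'p::order set \<Rightarrow> ('p, 'v) diagram \<Rightarrow> ('p, 'w) diagram \<Rightarrow> bool" where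
  "module_iso s t P F G \<longleftrightarrow>
     (\<exists>\<eta>. (\<forall>p\<in>P. linear_between s t (Ob F p) (Ob G p) (\<eta> p) \<and> bij_betw (\<eta> p) (Ob F p) (Ob G p)) \<and>
          (\<forall>p\<in>P. \<forall>q\<in>P. p \<le> q \<longrightarrow> (\<forall>x\<in>Ob F p. \<eta> q (Mor F p q x) = Mor G p q (\<eta> p x))))"

definition zero_module :: "'p set \<Rightarrow> ('p, 'v::zero) diagram \<Rightarrow> bool" where
  "zero_module P F \<longleftrightarrow> (\<forall>p\<in>P. Ob F p = {0})"

definition pointwise :: "('k \<Rightarrow> 'v \<Rightarrow> 'v) \<Rightarrow> 'k \<Rightarrow> ('i \<Rightarrow> 'v) \<Rightarrow> ('i \<Rightarrow> 'v)" where
  "pointwise s c g = (\<lambda>i. s c (g i))"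

text \<open>
  An element of the direct sum of the modules in a list is a sequence whose \<open>i\<close>-th entry lies in the
  \<open>i\<close>-th module of the list, padded with \<open>0\<close> beyond the length of the list; the scalar
  multiplication is \<^term>\<open>pointwise s\<close>.
\<close>

definition direct_sum :: "('p, 'v::zero) diagram list \<Rightarrow> ('p, nat \<Rightarrow> 'v) diagram" where
  "direct_sum Fs =
     \<lparr>Ob = (\<lambda>p. {g. \<forall>i. if i < length Fs then g i \<in> Ob (Fs ! i) p else g i = 0}),
      Mor = (\<lambda>p q g i. if i < length Fs then Mor (Fs ! i) p q (g i) else 0)\<rparr>"

text \<open>
  The candidates \<open>F\<^sub>1\<close>, \<open>F\<^sub>2\<close> range over all modules in the ambient space of \<open>F\<close>.  This is no
  restriction: if \<open>F\<close> is isomorphic to \<open>F\<^sub>1 \<oplus> F\<^sub>2\<close> with \<open>F\<^sub>1\<close>, \<open>F\<^sub>2\<close> anywhere, then the isomorphism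
  identifies \<open>F\<^sub>1\<close>, \<open>F\<^sub>2\<close> with submodules of \<open>F\<close>.  The same remark applies to \<open>decomposes_into\<close>.
\<close>

definition indecomposable ::
  "('k::field \<Rightarrow> 'v::ab_group_add \<Rightarrow> 'v) \<Rightarrow> 'p::order set \<Rightarrow> ('p, 'v) diagram \<Rightarrow> bool" where
  "indecomposable s P F \<longleftrightarrow>
     (\<forall>F\<^sub>1 F\<^sub>2. persistence_module s P F\<^sub>1 \<longrightarrow> persistence_module s P F\<^sub>2 \<longrightarrow>
        module_iso s (pointwise s) P F (direct_sum [F\<^sub>1, F\<^sub>2]) \<longrightarrow>
        zero_module P F\<^sub>1 \<or> zero_module P F\<^sub>2)"

definition decomposes_into ::
  "('k::field \<Rightarrow> 'v::ab_group_add \<Rightarrow> 'v) \<Rightarrow> 'p::order set \<Rightarrow>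
     ('p, 'v) diagram \<Rightarrow> ('p, 'v) diagram list \<Rightarrow> bool" where
  "decomposes_into s P F Fs \<longleftrightarrow>
     (\<forall>G\<in>set Fs. persistence_module s P G \<and> \<not> zero_module P G \<and> indecomposable s P G) \<and>
     module_iso s (pointwise s) P F (direct_sum Fs)"

text \<open>
  By the Krull-Schmidt theorem the choice of the decomposition affects the summands only up to order
  and isomorphism, hence it does not affect the two numbers below.
\<close>

definition decomposition ::
  "('k::field \<Rightarrow> 'v::ab_group_add \<Rightarrow> 'v) \<Rightarrow> 'p::order set \<Rightarrow>
     ('p, 'v) diagram \<Rightarrow> ('p, 'v) diagram list" where
  "decomposition s P F = (SOME Fs. decomposes_into s P F Fs)"

definition poset_connected :: "'p::order set \<Rightarrow> bool" where
  "poset_connected I \<longleftrightarrow>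
     (\<forall>i\<in>I. \<forall>j\<in>I. (i, j) \<in> {(a, b). a \<in> I \<and> b \<in> I \<and> (a \<le> b \<or> b \<le> a)}\<^sup>*)"

definition poset_interval :: "'p::order set \<Rightarrow> 'p set \<Rightarrow> bool" where
  "poset_interval P I \<longleftrightarrow>
     I \<subseteq> P \<and> I \<noteq> {} \<and> poset_connected I \<and>
     (\<forall>i\<in>I. \<forall>j\<in>I. \<forall>l\<in>P. i \<le> l \<longrightarrow> l \<le> j \<longrightarrow> l \<in> I)"

definition interval_module :: "'p set \<Rightarrow> ('p, 'k::field) diagram" where
  "interval_module I =
     \<lparr>Ob = (\<lambda>p. if p \<in> I then UNIV else {0}),
      Mor = (\<lambda>p q x. if p \<in> I \<and> q \<in> I then x else 0)\<rparr>"

definition is_interval_module ::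
  "('k::field \<Rightarrow> 'v::ab_group_add \<Rightarrow> 'v) \<Rightarrow> 'p::order set \<Rightarrow> ('p, 'v) diagram \<Rightarrow> bool" where
  "is_interval_module s P F \<longleftrightarrow>
     (\<exists>I. poset_interval P I \<and> module_iso s (*) P F (interval_module I))"

definition num_summands ::
  "('k::field \<Rightarrow> 'v::ab_group_add \<Rightarrow> 'v) \<Rightarrow> 'p::order set \<Rightarrow> ('p, 'v) diagram \<Rightarrow> nat" where
  "num_summands s P F = length (decomposition s P F)"

definition num_intervals ::
  "('k::field \<Rightarrow> 'v::ab_group_add \<Rightarrow> 'v) \<Rightarrow> 'p::order set \<Rightarrow> ('p, 'v) diagram \<Rightarrow> nat" where
  "num_intervals s P F = length (filter (is_interval_module s P) (decomposition s P F))"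

text \<open>
  The free vector space on a finite set \<open>A\<close> consists of the functions \<open>g\<close> that vanish outside \<open>A\<close>,
  where \<open>g\<close> stands for \<open>\<Sum>x\<in>A. g x \<cdot> x\<close>; the scalar multiplication is \<open>pointwise (*)\<close>.
\<close>

definition linearization :: "('p, 'x) diagram \<Rightarrow> ('p, 'x \<Rightarrow> 'k::field) diagram" where
  "linearization S =
     \<lparr>Ob = (\<lambda>p. {g. \<forall>x. x \<notin> Ob S p \<longrightarrow> g x = 0}),
      Mor = (\<lambda>p q g y. \<Sum>x\<in>{x \<in> Ob S p. Mor S p q x = y}. g x)\<rparr>"

definition sublevel :: "'a set \<Rightarrow> ('a \<Rightarrow> real) \<Rightarrow> real \<Rightarrow> 'a set" where
  "sublevel M f \<sigma> = {x \<in> M. f x \<le> \<sigma>}"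

definition rips_edges :: "'a set \<Rightarrow> ('a \<Rightarrow> 'a \<Rightarrow> real) \<Rightarrow> real \<Rightarrow> ('a \<times> 'a) set" where
  "rips_edges N d \<epsilon> = {(x, y). x \<in> N \<and> y \<in> N \<and> d x y \<le> \<epsilon>}"

definition rips_connected :: "'a set \<Rightarrow> ('a \<Rightarrow> 'a \<Rightarrow> real) \<Rightarrow> real \<Rightarrow> ('a \<times> 'a) set" where
  "rips_connected N d \<epsilon> = (rips_edges N d \<epsilon>)\<^sup>* \<inter> N \<times> N"

definition density_rips_poset ::
  "'a set \<Rightarrow> ('a \<Rightarrow> 'a \<Rightarrow> real) \<Rightarrow> ('a \<Rightarrow> real) \<Rightarrow> (real \<times> real) set" where
  "density_rips_poset M d f = {d x y | x y. x \<in> M \<and> y \<in> M} \<times> f ` M"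

text \<open>
  The map induced by the inclusion of graphs sends a component \<open>C\<close> to the component of the larger
  graph that contains \<open>C\<close>, which is the image of \<open>C\<close> under the larger equivalence relation.
\<close>

definition density_rips ::
  "'a set \<Rightarrow> ('a \<Rightarrow> 'a \<Rightarrow> real) \<Rightarrow> ('a \<Rightarrow> real) \<Rightarrow> (real \<times> real, 'a set) diagram" where
  "density_rips M d f =
     \<lparr>Ob = (\<lambda>(\<epsilon>, \<sigma>). sublevel M f \<sigma> // rips_connected (sublevel M f \<sigma>) d \<epsilon>),
      Mor = (\<lambda>_ (\<epsilon>, \<sigma>) C. rips_connected (sublevel M f \<sigma>) d \<epsilon> `` C)\<rparr>"

text \<open>
  Here \<open>\<real>\<^sup>d\<close> is the product of \<open>d\<close> copies of the real line, with coordinates indexed by \<open>{..<d}\<close>, so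
  that \<open>d\<close> is an ordinary natural number and can tend to infinity.  The centre of a ball only matters
  through its first \<open>d\<close> coordinates.
\<close>

definition lebesgue_Rd :: "nat \<Rightarrow> (nat \<Rightarrow> real) measure" where
  "lebesgue_Rd d = (\<Pi>\<^sub>M i\<in>{..<d}. lborel)"

definition unit_ball_Rd :: "nat \<Rightarrow> (nat \<Rightarrow> real) \<Rightarrow> (nat \<Rightarrow> real) set" where
  "unit_ball_Rd d a = {x \<in> space (lebesgue_Rd d). L2_set (\<lambda>i. x i - a i) {..<d} \<le> 1}"

definition b_const :: "nat \<Rightarrow> real" where
  "b_const d =
     measure (lebesgue_Rd d) (unit_ball_Rd d (\<lambda>_. 0)) /
     measure (lebesgue_Rd d) (unit_ball_Rd d (\<lambda>_. 0) \<union> unit_ball_Rd d (\<lambda>i. if i = 0 then 1 else 0))"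

definition c_const :: "nat \<Rightarrow> real" where
  "c_const d = b_const d / 2"

lemma vector_space_pointwise: "vector_space s \<Longrightarrow> vector_space (pointwise s)"
  unfolding vector_space_def pointwise_def by (auto simp: fun_eq_iff)

lemma equiv_rips_connected:
  assumes "Metric_space M d" "N \<subseteq> M"
  shows "equiv N (rips_connected N d \<epsilon>)"
proof (rule equivI)
  show "rips_connected N d \<epsilon> \<subseteq> N \<times> N" by (auto simp: rips_connected_def)
  show "refl_on N (rips_connected N d \<epsilon>)" by (auto simp: rips_connected_def refl_on_def)
  have "sym (rips_edges N d \<epsilon>)"
    using assms(1) by (auto simp: sym_def rips_edges_def Metric_space.commute)
  then have "sym ((rips_edges N d \<epsilon>)\<^sup>*)" by (rule sym_rtrancl)
  then show "sym (rips_connected N d \<epsilon>)"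
    unfolding rips_connected_def sym_def by blast
  show "trans (rips_connected N d \<epsilon>)"
    unfolding rips_connected_def by (auto simp: trans_def)
qed

lemma rips_connected_mono:
  assumes "N \<subseteq> N'" "\<epsilon> \<le> \<epsilon>'"
  shows "rips_connected N d \<epsilon> \<subseteq> rips_connected N' d \<epsilon>'"
proof -
  have "rips_edges N d \<epsilon> \<subseteq> rips_edges N' d \<epsilon>'" using assms by (auto simp: rips_edges_def)
  then show ?thesis using assms rtrancl_mono unfolding rips_connected_def by blast
qed

lemma Image_class:
  assumes "equiv A r" "equiv B r'" "r \<subseteq> r'" "x \<in> A"
  shows "r' `` (r `` {x}) = r' `` {x}"
proof -
  have "(x, x) \<in> r" using assms by (auto simp: equiv_def refl_on_def)
  moreover have "trans r'" using assms by (auto simp: equiv_def)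
  ultimately show ?thesis using assms(3) by (auto dest: transD)
qed

lemma persistent_set_density_rips:
  assumes "finite M" "Metric_space M d"
  shows "persistent_set (density_rips_poset M d f) (density_rips M d f)"
proof -
  have sub: "sublevel M f \<sigma> \<subseteq> M" for \<sigma> by (auto simp: sublevel_def)
  have mono: "sublevel M f \<sigma> \<subseteq> sublevel M f \<sigma>'" if "\<sigma> \<le> \<sigma>'" for \<sigma> \<sigma>'
    using that by (auto simp: sublevel_def)
  define R where "R = (\<lambda>\<epsilon> \<sigma>. rips_connected (sublevel M f \<sigma>) d \<epsilon>)"
  have eq: "equiv (sublevel M f \<sigma>) (R \<epsilon> \<sigma>)" for \<epsilon> \<sigma>
    unfolding R_def using equiv_rips_connected assms sub by blast
  have Rm: "R \<epsilon> \<sigma> \<subseteq> R \<epsilon>' \<sigma>'" if "\<epsilon> \<le> \<epsilon>'" "\<sigma> \<le> \<sigma>'" for \<epsilon> \<epsilon>' \<sigma> \<sigma>'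
    unfolding R_def using rips_connected_mono mono that by blast
  have im: "R \<epsilon>' \<sigma>' `` (R \<epsilon> \<sigma> `` {x}) = R \<epsilon>' \<sigma>' `` {x}"
    if "\<epsilon> \<le> \<epsilon>'" "\<sigma> \<le> \<sigma>'" "x \<in> sublevel M f \<sigma>" for \<epsilon> \<epsilon>' \<sigma> \<sigma>' x
    using Image_class[OF eq eq Rm] that by blast
  have Ob: "Ob (density_rips M d f) (\<epsilon>, \<sigma>) = sublevel M f \<sigma> // R \<epsilon> \<sigma>" for \<epsilon> \<sigma>
    by (simp add: density_rips_def R_def)
  have Mor: "Mor (density_rips M d f) p (\<epsilon>, \<sigma>) C = R \<epsilon> \<sigma> `` C" for p \<epsilon> \<sigma> C
    by (simp add: density_rips_def R_def)
  have fin: "finite (Ob (density_rips M d f) p)" for p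
  proof (cases p)
    case (Pair \<epsilon> \<sigma>)
    have "finite (sublevel M f \<sigma>)" using assms(1) sub finite_subset by blast
    then show ?thesis unfolding Pair Ob using eq[of \<sigma> \<epsilon>]
      by (auto intro!: finite_quotient simp: equiv_def)
  qed
  show ?thesis
    unfolding persistent_set_def functor_on_def
  proof (intro conjI ballI impI fin)
    fix p q :: "real \<times> real" assume pq: "p \<le> q"
    obtain e s e' s' where [simp]: "p = (e, s)" "q = (e', s')" by (cases p, cases q)
    have le: "e \<le> e'" "s \<le> s'" using pq by auto
    show "Mor (density_rips M d f) p q ` Ob (density_rips M d f) p \<subseteq> Ob (density_rips M d f) q"
      using le mono[of s s'] by (auto simp: Ob Mor im intro!: quotientI elim!: quotientE)
  next
    fix p C assume "C \<in> Ob (density_rips M d f) p"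
    moreover obtain e s where [simp]: "p = (e, s)" by (cases p)
    ultimately obtain x where "x \<in> sublevel M f s" "C = R e s `` {x}" by (auto simp: Ob quotient_def)
    then show "Mor (density_rips M d f) p p C = C"
      by (simp add: Mor im)
  next
    fix p q r :: "real \<times> real" and C
    assume "p \<le> q" "q \<le> r" and C: "C \<in> Ob (density_rips M d f) p"
    moreover obtain e s e' s' e'' s'' where [simp]: "p = (e, s)" "q = (e', s')" "r = (e'', s'')"
      by (cases p, cases q, cases r)
    ultimately have le: "e \<le> e'" "s \<le> s'" "e' \<le> e''" "s' \<le> s''" by auto
    obtain x where x: "x \<in> sublevel M f s" "C = R e s `` {x}" using C by (auto simp: Ob quotient_def)
    moreover have "x \<in> sublevel M f s'" using x(1) le mono by blast
    ultimately show "Mor (density_rips M d f) p r C =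
        Mor (density_rips M d f) q r (Mor (density_rips M d f) p q C)"
      using le by (simp add: Mor im)
  qed
qed

lemma vector_space_mult: "vector_space ((*) :: 'k::field \<Rightarrow> _)"
  by unfold_locales (auto simp: algebra_simps)

lemma persistence_module_linearization:
  assumes S: "persistent_set P S"
  shows "persistence_module (pointwise (*)) P (linearization S :: ('p::order, 'x \<Rightarrow> 'k::field) diagram)"
proof -
  let ?s = "pointwise (*) :: 'k \<Rightarrow> ('x \<Rightarrow> 'k) \<Rightarrow> _"
  let ?L = "linearization S :: ('p, 'x \<Rightarrow> 'k) diagram"
  interpret vector_space ?s by (intro vector_space_pointwise vector_space_mult)
  have fin: "finite (Ob S p)" if "p \<in> P" for p using S that by (auto simp: persistent_set_def)
  have map: "Mor S p q x \<in> Ob S q" if "p \<in> P" "q \<in> P" "p \<le> q" "x \<in> Ob S p" for p q x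
    using S that unfolding persistent_set_def functor_on_def by blast
  have mid: "Mor S p p x = x" if "p \<in> P" "x \<in> Ob S p" for p x
    using S that unfolding persistent_set_def functor_on_def by blast
  have mcomp: "Mor S p r x = Mor S q r (Mor S p q x)"
    if "p \<in> P" "q \<in> P" "r \<in> P" "p \<le> q" "q \<le> r" "x \<in> Ob S p" for p q r x
    using S that unfolding persistent_set_def functor_on_def by blast
  have into: "Mor ?L p q g \<in> Ob ?L q" if "p \<in> P" "q \<in> P" "p \<le> q" for p q g
  proof -
    have "{x \<in> Ob S p. Mor S p q x = y} = {}" if "y \<notin> Ob S q" for y
      using map \<open>p \<in> P\<close> \<open>q \<in> P\<close> \<open>p \<le> q\<close> that by blast
    then show ?thesis by (auto simp: linearization_def simp del: Collect_empty_eq)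
  qed
  show ?thesis unfolding persistence_module_def
  proof (intro conjI ballI impI)
    show "vector_space ?s" ..
    show "functor_on P ?L" unfolding functor_on_def
    proof (intro conjI ballI impI)
      show "Mor ?L p q ` Ob ?L p \<subseteq> Ob ?L q" if "p \<in> P" "q \<in> P" "p \<le> q" for p q
        using into that by blast
    next
      fix p g assume p: "p \<in> P" and g: "g \<in> Ob ?L p"
      have "{x \<in> Ob S p. Mor S p p x = y} = (if y \<in> Ob S p then {y} else {})" for y
        using mid[OF p] by auto
      then show "Mor ?L p p g = g" using g by (auto simp: linearization_def fun_eq_iff)
    next
      fix p q r g assume *: "p \<in> P" "q \<in> P" "r \<in> P" "p \<le> q" "q \<le> r"
      show "Mor ?L p r g = Mor ?L q r (Mor ?L p q g)"
      proof
        fix z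
        have "(\<Sum>y\<in>{y \<in> Ob S q. Mor S q r y = z}. \<Sum>x\<in>{x \<in> Ob S p. Mor S p q x = y}. g x) =
          (\<Sum>x\<in>(\<Union>y\<in>{y \<in> Ob S q. Mor S q r y = z}. {x \<in> Ob S p. Mor S p q x = y}). g x)"
          by (rule sum.UNION_disjoint[symmetric]) (auto simp: fin *)
        also have "(\<Union>y\<in>{y \<in> Ob S q. Mor S q r y = z}. {x \<in> Ob S p. Mor S p q x = y}) =
          {x \<in> Ob S p. Mor S p r x = z}"
          using * map[of p q] mcomp[of p q r] by auto
        finally show "Mor ?L p r g z = Mor ?L q r (Mor ?L p q g) z"
          by (simp add: linearization_def)
      qed
    qed
  next
    fix p assume p: "p \<in> P"
    define e where "e = (\<lambda>(x::'x) y. if x = y then 1 else 0 :: 'k)"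
    have "Ob ?L p = span (e ` Ob S p)"
    proof
      show "span (e ` Ob S p) \<subseteq> Ob ?L p"
        by (rule span_minimal)
          (auto simp: e_def linearization_def subspace_def pointwise_def)
      show "Ob ?L p \<subseteq> span (e ` Ob S p)"
      proof
        fix g assume g: "g \<in> Ob ?L p"
        have sumap: "(\<Sum>x\<in>A. h x) y = (\<Sum>x\<in>A. h x y)" for A y and h :: "'x \<Rightarrow> 'x \<Rightarrow> 'k"
          by (induction A rule: infinite_finite_induct) auto
        have "g = (\<Sum>x\<in>Ob S p. ?s (g x) (e x))"
          using g fin[OF p] by (auto simp: fun_eq_iff sumap pointwise_def e_def linearization_def
              if_distrib[of "\<lambda>x. _ * x"] cong: if_cong)
        also have "\<dots> \<in> span (e ` Ob S p)"
          by (intro span_sum span_scale span_base) auto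
        finally show "g \<in> span (e ` Ob S p)" .
      qed
    qed
    then show "\<exists>B. finite B \<and> Ob ?L p = span B" using fin[OF p] by blast
  next
    fix p q assume "p \<in> P" "q \<in> P" "p \<le> q"
    then show "linear_between ?s ?s (Ob ?L p) (Ob ?L q) (Mor ?L p q)"
      unfolding linear_between_def using into
      by (auto simp: linearization_def pointwise_def fun_eq_iff sum.distrib sum_distrib_left)
  qed
qed

lemma persistence_module_interval_module:
  assumes "poset_interval P I"
  shows "persistence_module (*) P (interval_module I :: ('p::order, 'k::field) diagram)"
proof -
  have 1: "vector_space_over_itself.span {1} = (UNIV :: 'k set)" by (auto simp: vector_space_over_itself.span_singleton)
  have c: "l \<in> I" if "i \<in> I" "j \<in> I" "l \<in> P" "i \<le> l" "l \<le> j" for i j l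
    using assms that unfolding poset_interval_def by blast
  have "\<exists>B. finite B \<and> Ob (interval_module I :: ('p, 'k) diagram) p = vector_space_over_itself.span B" for p
  proof (cases "p \<in> I")
    case True then show ?thesis using 1 by (intro exI[of _ "{1}"]) (simp add: interval_module_def)
  next
    case False then show ?thesis by (intro exI[of _ "{}"]) (simp add: interval_module_def)
  qed
  then show ?thesis using vector_space_mult
    unfolding persistence_module_def
    by (auto simp: functor_on_def linear_between_def interval_module_def dest: c)
qed

lemma persistence_module_direct_sum:
  fixes s :: "'k::field \<Rightarrow> 'v::ab_group_add \<Rightarrow> 'v"
  assumes "vector_space s" "\<And>F. F \<in> set Fs \<Longrightarrow> persistence_module s P F"
  shows "persistence_module (pointwise s) P (direct_sum Fs)"
proof -
  interpret V: vector_space s by fact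
  interpret W: vector_space "pointwise s :: _ \<Rightarrow> (nat \<Rightarrow> _) \<Rightarrow> _" by (intro vector_space_pointwise assms)
  have F: "persistence_module s P (Fs ! i)" if "i < length Fs" for i using assms that by auto
  have f1: "functor_on P (Fs ! i)" if "i < length Fs" for i using F[OF that] unfolding persistence_module_def by blast
  have f2: "linear_between s s (Ob (Fs ! i) p) (Ob (Fs ! i) q) (Mor (Fs ! i) p q)" if "i < length Fs" "p \<in> P" "q \<in> P" "p \<le> q" for i p q using F that unfolding persistence_module_def by blast
  have f3: "\<exists>B. finite B \<and> Ob (Fs ! i) p = V.span B" if "i < length Fs" "p \<in> P" for i p
    using F that unfolding persistence_module_def by blast
  show ?thesis unfolding persistence_module_def
  proof (intro conjI ballI impI)
    show "vector_space (pointwise s)" by (intro vector_space_pointwise assms)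
    show "functor_on P (direct_sum Fs)"
    proof -
      have 1: "Mor (Fs ! i) p q x \<in> Ob (Fs ! i) q"
        if "i < length Fs" "p \<in> P" "q \<in> P" "p \<le> q" "x \<in> Ob (Fs ! i) p" for i p q x
        using f1[OF that(1)] that unfolding functor_on_def by blast
      have 2: "Mor (Fs ! i) p p x = x"
        if "i < length Fs" "p \<in> P" "x \<in> Ob (Fs ! i) p" for i p x
        using f1[OF that(1)] that unfolding functor_on_def by blast
      have 3: "Mor (Fs ! i) p r x = Mor (Fs ! i) q r (Mor (Fs ! i) p q x)"
        if "i < length Fs" "p \<in> P" "q \<in> P" "r \<in> P" "p \<le> q" "q \<le> r" "x \<in> Ob (Fs ! i) p" for i p q r x
        using f1[OF that(1)] that unfolding functor_on_def by blast
      show ?thesis unfolding functor_on_def direct_sum_def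
        by (intro conjI ballI impI) (auto simp: fun_eq_iff 1 2 intro: 3)
    qed
  next
    fix p q assume pq: "p \<in> P" "q \<in> P" "p \<le> q"
    show "linear_between (pointwise s) (pointwise s) (Ob (direct_sum Fs) p) (Ob (direct_sum Fs) q)
            (Mor (direct_sum Fs) p q)"
      using f2[OF _ pq] unfolding linear_between_def direct_sum_def by (auto simp: fun_eq_iff pointwise_def)
  next
    fix p assume p: "p \<in> P"
    obtain B where B: "\<And>i. i < length Fs \<Longrightarrow> finite (B i) \<and> Ob (Fs ! i) p = V.span (B i)"
    proof -
      have "\<forall>i. \<exists>B. i < length Fs \<longrightarrow> finite B \<and> Ob (Fs ! i) p = V.span B" using f3 p by blast
      from choice[OF this] show ?thesis using that by blast
    qed
    define inj where "inj = (\<lambda>(i::nat) v (j::nat). if j = i then v else (0::'v))"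
    define C where "C = (\<Union>i<length Fs. inj i ` B i)"
    have "finite C" using B by (auto simp: C_def)
    moreover have "Ob (direct_sum Fs) p = W.span C"
    proof
      show "W.span C \<subseteq> Ob (direct_sum Fs) p"
        apply (rule W.span_minimal)
         apply (auto simp: C_def inj_def direct_sum_def B V.span_base V.span_zero)[1]
        apply (auto simp: W.subspace_def direct_sum_def B V.span_zero V.span_add V.span_scale pointwise_def)
        done
      have inj: "inj i v \<in> W.span C" if i: "i < length Fs" and v: "v \<in> V.span (B i)" for i v
        using v
      proof (induction rule: V.span_induct_alt)
        case base show ?case using W.span_zero by (simp add: inj_def zero_fun_def if_distrib cong: if_cong)
      next
        case (step c x y)
        have "inj i (s c x + y) = pointwise s c (inj i x) + inj i y" by (auto simp: inj_def pointwise_def fun_eq_iff)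
        moreover have "inj i x \<in> C" using step i by (auto simp: C_def)
        ultimately show ?case using step by (metis W.span_add W.span_scale W.span_base)
      qed
      show "Ob (direct_sum Fs) p \<subseteq> W.span C"
      proof
        fix g assume g: "g \<in> Ob (direct_sum Fs) p"
        have sumap: "(\<Sum>x\<in>A. h x) y = (\<Sum>x\<in>A. h x y)" for A y and h :: "nat \<Rightarrow> nat \<Rightarrow> 'v"
          by (induction A rule: infinite_finite_induct) auto
        have geq: "g = (\<Sum>i<length Fs. inj i (g i))"
          using g by (auto simp: fun_eq_iff sumap inj_def direct_sum_def)
        have gi: "g i \<in> V.span (B i)" if "i < length Fs" for i
          using g B[OF that] that by (auto simp: direct_sum_def split: if_splits)
        from gi have sp: "(\<Sum>i<length Fs. inj i (g i)) \<in> W.span C" by (intro W.span_sum inj) auto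
        show "g \<in> W.span C" by (subst geq) (rule sp)
      qed
    qed
    ultimately show "\<exists>B. finite B \<and> Ob (direct_sum Fs) p = W.span B" by blast
  qed
qed

end

theory Submission
  imports Defs
begin

text \<open>
  Call two sample points mutual nearest neighbours if every other sample point is farther from both
  of them than they are from each other.  Let \<open>{x, y}\<close> be such a pair with \<open>f y \<le> f x\<close>.  As long as
  \<open>\<epsilon>\<close> is smaller than the distance of the pair, \<open>x\<close> is an isolated vertex, and from then on \<open>x\<close> and
  \<open>y\<close> lie in one component.  Hence the vectors \<open>[x] - [y]\<close> span a submodule of the linearized
  persistent set that is an interval module: its support is the part of the poset that is above
  \<open>(0, f x)\<close> and has \<open>\<epsilon>\<close> below the distance of the pair.  The elements whose coefficient at the
  isolated vertex \<open>x\<close> vanishes form a complement.  Different pairs are disjoint, so all these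
  interval modules split off together (\<open>num_intervals_ge_card\<close>).

  In the other direction, the structure maps from \<open>(0, \<sigma>)\<close> to \<open>(\<epsilon>, \<sigma>)\<close> are onto and those from
  \<open>(0, \<sigma>)\<close> to \<open>(0, max f)\<close> are injective, and both properties pass to direct summands.  So every nonzero
  summand is nonzero at \<open>(0, max f)\<close>, where the whole module has dimension at most \<open>n\<close>, and there
  are at most \<open>n\<close> summands (\<open>num_summands_le_card\<close>).  The expected proportion of intervals is
  therefore at least the expected number of mutual pairs divided by \<open>n\<close>, which is
  \<open>(n - 1) / 2\<close> times the probability that two given points are mutual nearest neighbours.

  That probability is the integral of \<open>f(x) f(y) (1 - \<mu>(U))\<^sup>n\<^sup>-\<^sup>2\<close>, where \<open>\<mu>\<close> is the law of a sample
  point and \<open>U\<close> is the union of the two balls around \<open>x\<close> and \<open>y\<close> whose radius is their distance.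
  Put \<open>y = x + n\<^sup>-\<^sup>1\<^sup>/\<^sup>d u\<close>.  If \<open>f\<close> is continuous at \<open>x\<close>, the rescaled integrand
  is asymptotically at least \<open>f(x)\<^sup>2 exp (- f(x) |u|\<^sup>d V)\<close>, where \<open>V\<close> is the volume of the union of two
  unit balls at distance \<open>1\<close>.  Integrated over \<open>u\<close> and \<open>x\<close> this gives the volume of the unit
  ball divided by \<open>V\<close>, and Fatou's lemma yields the bound (\<open>liminf_mutual_prob\<close>).

  Two facts make the expectation meaningful.  By the Krull-Schmidt theorem (\<open>krull_schmidt\<close>, based on
  Fitting's lemma) the counts do not depend on the decomposition, so they are invariant under
  isomorphism.  Moreover they are determined by finitely many comparisons between distances and
  between values of \<open>f\<close> (\<open>num_relabel\<close>), so the proportion of intervals is a simple random variable.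

  The analytic properties of the constant come from slicing the balls by hyperplanes orthogonal to
  the line through the centres, which expresses it through the volumes of two parts of a half-ball.
\<close>

section \<open>Persistence modules and their maps\<close>

definition module_map ::
  "('k::field \<Rightarrow> 'v::ab_group_add \<Rightarrow> 'v) \<Rightarrow> ('k \<Rightarrow> 'w::ab_group_add \<Rightarrow> 'w) \<Rightarrow>
     'p::order set \<Rightarrow> ('p, 'v) diagram \<Rightarrow> ('p, 'w) diagram \<Rightarrow> ('p \<Rightarrow> 'v \<Rightarrow> 'w) \<Rightarrow> bool" where
  "module_map s t P F G \<eta> \<longleftrightarrow>
     (\<forall>p\<in>P. linear_between s t (Ob F p) (Ob G p) (\<eta> p)) \<and>
     (\<forall>p\<in>P. \<forall>q\<in>P. p \<le> q \<longrightarrow> (\<forall>x\<in>Ob F p. \<eta> q (Mor F p q x) = Mor G p q (\<eta> p x)))"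

lemma module_iso_iff:
  "module_iso s t P F G \<longleftrightarrow>
    (\<exists>\<eta>. module_map s t P F G \<eta> \<and> (\<forall>p\<in>P. bij_betw (\<eta> p) (Ob F p) (Ob G p)))"
  unfolding module_iso_def module_map_def ball_conj_distrib by (simp add: conj_ac)

lemma module_mapD:
  assumes "module_map s t P F G \<eta>" "p \<in> P"
  shows "x \<in> Ob F p \<Longrightarrow> \<eta> p x \<in> Ob G p"
    and "x \<in> Ob F p \<Longrightarrow> y \<in> Ob F p \<Longrightarrow> \<eta> p (x + y) = \<eta> p x + \<eta> p y"
    and "x \<in> Ob F p \<Longrightarrow> \<eta> p (s c x) = t c (\<eta> p x)"
    and "q \<in> P \<Longrightarrow> p \<le> q \<Longrightarrow> x \<in> Ob F p \<Longrightarrow> \<eta> q (Mor F p q x) = Mor G p q (\<eta> p x)"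
  using assms unfolding module_map_def linear_between_def by auto

lemma module_mapI:
  assumes "\<And>p x. p \<in> P \<Longrightarrow> x \<in> Ob F p \<Longrightarrow> \<eta> p x \<in> Ob G p"
    and "\<And>p x y. p \<in> P \<Longrightarrow> x \<in> Ob F p \<Longrightarrow> y \<in> Ob F p \<Longrightarrow> \<eta> p (x + y) = \<eta> p x + \<eta> p y"
    and "\<And>p c x. p \<in> P \<Longrightarrow> x \<in> Ob F p \<Longrightarrow> \<eta> p (s c x) = t c (\<eta> p x)"
    and "\<And>p q x. p \<in> P \<Longrightarrow> q \<in> P \<Longrightarrow> p \<le> q \<Longrightarrow> x \<in> Ob F p \<Longrightarrow>
      \<eta> q (Mor F p q x) = Mor G p q (\<eta> p x)"
  shows "module_map s t P F G \<eta>"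
  using assms unfolding module_map_def linear_between_def by auto

lemma pm_vs: "persistence_module s P F \<Longrightarrow> vector_space s"
  by (simp add: persistence_module_def)

lemma pm_fin: "persistence_module s P F \<Longrightarrow> p \<in> P \<Longrightarrow> \<exists>B. finite B \<and> Ob F p = module.span s B"
  by (simp add: persistence_module_def)

lemma vs_module: "vector_space s \<Longrightarrow> module s"
  by (simp add: module_iff_vector_space)

lemma pm_subspace: "persistence_module s P F \<Longrightarrow> p \<in> P \<Longrightarrow> module.subspace s (Ob F p)"
  using pm_fin pm_vs vs_module module.subspace_span by metis

lemma pm_closed:
  assumes "persistence_module s P F" "p \<in> P"
  shows "0 \<in> Ob F p"
    and "x \<in> Ob F p \<Longrightarrow> y \<in> Ob F p \<Longrightarrow> x + y \<in> Ob F p"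
    and "x \<in> Ob F p \<Longrightarrow> s c x \<in> Ob F p"
    and "x \<in> Ob F p \<Longrightarrow> y \<in> Ob F p \<Longrightarrow> x - y \<in> Ob F p"
  using pm_subspace[OF assms] vs_module[OF pm_vs[OF assms(1)]]
  by (auto simp: module.subspace_0 module.subspace_add module.subspace_scale module.subspace_diff)

lemma pm_sum:
  assumes "persistence_module s P F" "p \<in> P" "\<And>i. i \<in> I \<Longrightarrow> f i \<in> Ob F p"
  shows "(\<Sum>i\<in>I. f i) \<in> Ob F p"
  using assms(3) by (induction I rule: infinite_finite_induct) (auto simp: pm_closed[OF assms(1,2)])

lemma pm_Mor_map:
  assumes "persistence_module s P F" "p \<in> P" "q \<in> P" "p \<le> q"
  shows "x \<in> Ob F p \<Longrightarrow> Mor F p q x \<in> Ob F q"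
    and "x \<in> Ob F p \<Longrightarrow> y \<in> Ob F p \<Longrightarrow> Mor F p q (x + y) = Mor F p q x + Mor F p q y"
    and "x \<in> Ob F p \<Longrightarrow> Mor F p q (s c x) = s c (Mor F p q x)"
  using assms unfolding persistence_module_def linear_between_def by auto

lemma pm_functor:
  assumes "persistence_module s P F"
  shows "p \<in> P \<Longrightarrow> x \<in> Ob F p \<Longrightarrow> Mor F p p x = x"
    and "p \<in> P \<Longrightarrow> q \<in> P \<Longrightarrow> r \<in> P \<Longrightarrow> p \<le> q \<Longrightarrow> q \<le> r \<Longrightarrow> x \<in> Ob F p \<Longrightarrow>
      Mor F p r x = Mor F q r (Mor F p q x)"
proof -
  have f: "functor_on P F" using assms by (simp add: persistence_module_def)
  note f' = f[unfolded functor_on_def]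
  show "p \<in> P \<Longrightarrow> x \<in> Ob F p \<Longrightarrow> Mor F p p x = x"
    using f'[THEN conjunct2, THEN conjunct1] by simp
  show "p \<in> P \<Longrightarrow> q \<in> P \<Longrightarrow> r \<in> P \<Longrightarrow> p \<le> q \<Longrightarrow> q \<le> r \<Longrightarrow> x \<in> Ob F p \<Longrightarrow>
      Mor F p r x = Mor F q r (Mor F p q x)"
    using f'[THEN conjunct2, THEN conjunct2, rule_format] .
qed

lemma linear_between_0:
  assumes "vector_space s" "vector_space t" "linear_between s t V W h" "0 \<in> V"
  shows "h 0 = 0"
proof -
  have "h (s 0 0) = t 0 (h 0)" using assms unfolding linear_between_def by blast
  then show ?thesis
    using vs_module[OF assms(1)] vs_module[OF assms(2)] by (simp add: module.scale_zero_left)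
qed

lemma pm_Mor_0:
  assumes "persistence_module s P F" "p \<in> P" "q \<in> P" "p \<le> q"
  shows "Mor F p q 0 = 0"
proof (rule linear_between_0)
  show "linear_between s s (Ob F p) (Ob F q) (Mor F p q)"
    using assms by (auto simp: persistence_module_def)
qed (use assms pm_vs pm_closed(1) in blast)+

lemma module_map_0:
  assumes "persistence_module s P F" "vector_space t" "module_map s t P F G \<eta>" "p \<in> P"
  shows "\<eta> p 0 = 0"
proof (rule linear_between_0)
  show "linear_between s t (Ob F p) (Ob G p) (\<eta> p)"
    using assms by (auto simp: module_map_def)
qed (use assms pm_vs pm_closed(1) in blast)+

lemma module_map_sum:
  assumes "persistence_module s P F" "vector_space t" "module_map s t P F G \<eta>" "p \<in> P"
    "\<And>i. i \<in> I \<Longrightarrow> f i \<in> Ob F p"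
  shows "\<eta> p (\<Sum>i\<in>I. f i) = (\<Sum>i\<in>I. \<eta> p (f i))"
  using assms(5)
proof (induction I rule: infinite_finite_induct)
  case (insert x A)
  then show ?case
    using module_mapD(2)[OF assms(3,4)] pm_sum[OF assms(1,4), of A f] by simp
qed (use module_map_0[OF assms(1-4)] in auto)

lemma module_map_diff:
  assumes "persistence_module s P F" "module_map s t P F G \<eta>" "p \<in> P" "x \<in> Ob F p" "y \<in> Ob F p"
  shows "\<eta> p (x - y) = \<eta> p x - \<eta> p y"
proof -
  have "\<eta> p (x - y + y) = \<eta> p (x - y) + \<eta> p y"
    using assms pm_closed(4) by (intro module_mapD(2)) auto
  then show ?thesis by (simp add: algebra_simps)
qed

lemma module_map_comp:
  assumes "module_map s t P F G \<eta>" "module_map t u P G H \<theta>"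
  shows "module_map s u P F H (\<lambda>p x. \<theta> p (\<eta> p x))"
  using assms unfolding module_map_def linear_between_def by simp

lemma module_map_add:
  assumes "persistence_module t P G" "persistence_module s P F"
    "module_map s t P F G \<eta>" "module_map s t P F G \<theta>"
  shows "module_map s t P F G (\<lambda>p x. \<eta> p x + \<theta> p x)"
  using pm_vs[OF assms(1), THEN vs_module, THEN module.scale_right_distrib]
  by (intro module_mapI)
    (auto simp: pm_closed[OF assms(1)] pm_Mor_map[OF assms(1)] algebra_simps
      module_mapD[OF assms(3)] module_mapD[OF assms(4)])

lemma module_map_sum_maps:
  assumes F: "persistence_module s P F" and G: "persistence_module t P G"
    and "\<And>i. i \<in> I \<Longrightarrow> module_map s t P F G (\<phi> i)"
  shows "module_map s t P F G (\<lambda>p x. \<Sum>i\<in>I. \<phi> i p x)"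
  using assms(3)
proof (induction I rule: infinite_finite_induct)
  case (insert x A)
  then show ?case using module_map_add[OF G F, of "\<phi> x" "\<lambda>p y. \<Sum>i\<in>A. \<phi> i p y"] by simp
qed (auto intro!: module_mapI simp: pm_closed[OF G] pm_Mor_0[OF G]
      module.scale_zero_right[OF vs_module[OF pm_vs[OF G]]])

lemma module_map_inverse:
  assumes F: "persistence_module s P F" and \<eta>: "module_map s t P F G \<eta>"
    and bij: "\<And>p. p \<in> P \<Longrightarrow> bij_betw (\<eta> p) (Ob F p) (Ob G p)"
  shows "module_map t s P G F (\<lambda>p. inv_into (Ob F p) (\<eta> p))"
proof -
  let ?i = "\<lambda>p. inv_into (Ob F p) (\<eta> p)"
  have i: "?i p y \<in> Ob F p \<and> \<eta> p (?i p y) = y" if "p \<in> P" "y \<in> Ob G p" for p y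
    using bij[OF that(1)] that(2)
    by (metis bij_betw_def f_inv_into_f inv_into_into)
  have l: "?i p (\<eta> p x) = x" if "p \<in> P" "x \<in> Ob F p" for p x
    using bij[OF that(1)] that(2) by (simp add: bij_betw_def)
  show ?thesis
  proof (rule module_mapI)
    fix p x y assume p: "p \<in> P" and x: "x \<in> Ob G p" and y: "y \<in> Ob G p"
    have "\<eta> p (?i p x + ?i p y) = x + y"
      using i[OF p x] i[OF p y] module_mapD(2)[OF \<eta> p] by simp
    then show "?i p (x + y) = ?i p x + ?i p y"
      using l[OF p, of "?i p x + ?i p y"] i[OF p x] i[OF p y] pm_closed(2)[OF F p] by simp
  next
    fix p c x assume p: "p \<in> P" and x: "x \<in> Ob G p"
    have "\<eta> p (s c (?i p x)) = t c x"
      using i[OF p x] module_mapD(3)[OF \<eta> p] by simp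
    then show "?i p (t c x) = s c (?i p x)"
      using l[OF p, of "s c (?i p x)"] i[OF p x] pm_closed(3)[OF F p] by simp
  next
    fix p q x assume p: "p \<in> P" and q: "q \<in> P" and pq: "p \<le> q" and x: "x \<in> Ob G p"
    have "\<eta> q (Mor F p q (?i p x)) = Mor G p q x"
      using i[OF p x] module_mapD(4)[OF \<eta> p q pq] by simp
    then show "?i q (Mor G p q x) = Mor F p q (?i p x)"
      using l[OF q, of "Mor F p q (?i p x)"] i[OF p x] pm_Mor_map(1)[OF F p q pq] by simp
  qed (use i in blast)
qed

lemma module_iso_sym:
  assumes "persistence_module s P F" "module_iso s t P F G"
  shows "module_iso t s P G F"
proof -
  obtain \<eta> where "module_map s t P F G \<eta>" "\<forall>p\<in>P. bij_betw (\<eta> p) (Ob F p) (Ob G p)"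
    using assms(2) unfolding module_iso_iff by (elim exE conjE)
  then show ?thesis unfolding module_iso_iff
    by (intro exI[of _ "\<lambda>p. inv_into (Ob F p) (\<eta> p)"] conjI ballI
        module_map_inverse[OF assms(1)] bij_betw_inv_into) simp_all
qed

lemma module_iso_trans:
  assumes "module_iso s t P F G" "module_iso t u P G H"
  shows "module_iso s u P F H"
proof -
  obtain \<eta> \<theta> where \<eta>: "module_map s t P F G \<eta>" "\<forall>p\<in>P. bij_betw (\<eta> p) (Ob F p) (Ob G p)"
    and \<theta>: "module_map t u P G H \<theta>" "\<forall>p\<in>P. bij_betw (\<theta> p) (Ob G p) (Ob H p)"
    using assms unfolding module_iso_iff by blast
  have "bij_betw (\<lambda>x. \<theta> p (\<eta> p x)) (Ob F p) (Ob H p)" if "p \<in> P" for p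
    using bij_betw_trans[OF \<eta>(2)[rule_format, OF that] \<theta>(2)[rule_format, OF that]]
    by (simp add: comp_def)
  then show ?thesis unfolding module_iso_iff
    by (intro exI[of _ "\<lambda>p x. \<theta> p (\<eta> p x)"] conjI module_map_comp[OF \<eta>(1) \<theta>(1)] ballI)
qed

lemma zero_module_iso:
  assumes "persistence_module s P F" "persistence_module t P G" "module_iso s t P F G"
    "zero_module P F"
  shows "zero_module P G"
proof -
  obtain \<eta> where e: "module_map s t P F G \<eta>" "\<forall>p\<in>P. bij_betw (\<eta> p) (Ob F p) (Ob G p)"
    using assms unfolding module_iso_iff by blast
  show ?thesis unfolding zero_module_def
  proof
    fix p assume p: "p \<in> P"
    have "Ob G p = \<eta> p ` Ob F p" using e(2) p by (simp add: bij_betw_def)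
    then show "Ob G p = {0}"
      using assms(4) p module_map_0[OF assms(1) pm_vs[OF assms(2)] e(1) p]
      by (simp add: zero_module_def)
  qed
qed

section \<open>Direct sums\<close>

definition single_entry :: "nat \<Rightarrow> 'v::zero \<Rightarrow> nat \<Rightarrow> 'v" where
  "single_entry i v = (\<lambda>k. if k = i then v else 0)"

lemma single_entry_apply: "single_entry i v k = (if k = i then v else 0)" by (simp add: single_entry_def)

lemma sum_apply: "(\<Sum>i\<in>I. h i) x = (\<Sum>i\<in>I. h i x)"
  for h :: "'i \<Rightarrow> 'x \<Rightarrow> 'v::comm_monoid_add"
  by (induction I rule: infinite_finite_induct) auto

lemma Ob_direct_sum:
  "g \<in> Ob (direct_sum Fs) p \<longleftrightarrow> (\<forall>i<length Fs. g i \<in> Ob (Fs ! i) p) \<and> (\<forall>i\<ge>length Fs. g i = 0)"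
  unfolding direct_sum_def by (auto simp: not_less)

lemma Mor_direct_sum:
  "Mor (direct_sum Fs) p q g i = (if i < length Fs then Mor (Fs ! i) p q (g i) else 0)"
  by (simp add: direct_sum_def)

lemma Ob_direct_sum_pair:
  "g \<in> Ob (direct_sum [A, B]) p \<longleftrightarrow> g 0 \<in> Ob A p \<and> g 1 \<in> Ob B p \<and> (\<forall>i\<ge>2. g i = 0)"
  unfolding Ob_direct_sum by (auto simp: less_Suc_eq numeral_2_eq_2)

lemma pair_ext:
  fixes g h :: "nat \<Rightarrow> 'v::zero"
  assumes "g 0 = h 0" "g 1 = h 1" "\<forall>i\<ge>2. g i = 0" "\<forall>i\<ge>2. h i = 0"
  shows "g = h"
proof
  fix i :: nat
  consider "i = 0" | "i = 1" | "i \<ge> 2" by linarith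
  then show "g i = h i" using assms by cases auto
qed

lemma bij_betw_preimage: "bij_betw h A B \<Longrightarrow> y \<in> B \<Longrightarrow> \<exists>x\<in>A. h x = y"
  by (auto simp: bij_betw_def)

lemma pm_direct_sum:
  assumes "vector_space s" "\<forall>F\<in>set Fs. persistence_module s P F"
  shows "persistence_module (pointwise s) P (direct_sum Fs)"
  using assms persistence_module_direct_sum by blast

lemma module_map_single_entry:
  assumes pm: "\<forall>F\<in>set Fs. persistence_module s P F" and i: "i < length Fs"
  shows "module_map s (pointwise s) P (Fs ! i) (direct_sum Fs) (\<lambda>p. single_entry i)"
proof -
  have k: "persistence_module s P (Fs ! k)" if "k < length Fs" for k using pm that by simp
  note vs = vs_module[OF pm_vs[OF k[OF i]]]
  show ?thesis
    using i by (intro module_mapI)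
      (auto simp: Ob_direct_sum Mor_direct_sum single_entry_def fun_eq_iff pointwise_def
        pm_closed[OF k] pm_Mor_0[OF k] module.scale_zero_right[OF vs])
qed

lemma module_map_proj:
  assumes "i < length Fs"
  shows "module_map (pointwise s) s P (direct_sum Fs) (Fs ! i) (\<lambda>p g. g i)"
  using assms by (intro module_mapI) (auto simp: Ob_direct_sum Mor_direct_sum pointwise_def)

lemma single_entry_in_direct_sum:
  assumes "\<forall>F\<in>set Fs. persistence_module s P F" "i < length Fs" "p \<in> P" "v \<in> Ob (Fs ! i) p"
  shows "single_entry i v \<in> Ob (direct_sum Fs) p"
  using module_mapD(1)[OF module_map_single_entry[OF assms(1,2)] assms(3)] assms(4) .

lemma direct_sum_eq_sum_single_entry:
  assumes "g \<in> Ob (direct_sum Fs) p"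
  shows "g = (\<Sum>i<length Fs. single_entry i (g i))"
  using assms by (auto simp: fun_eq_iff sum_apply single_entry_apply Ob_direct_sum not_less)

lemma direct_sum_Nil_iso:
  assumes "persistence_module s P F" "zero_module P F"
  shows "module_iso s (pointwise s) P F (direct_sum [])"
proof -
  note vs = vs_module[OF pm_vs[OF assms(1)]]
  have "Mor F p q 0 = 0" if "p \<in> P" "q \<in> P" "p \<le> q" for p q
    using pm_Mor_0 assms that by blast
  then have "module_map s (pointwise s) P F (direct_sum []) (\<lambda>p. single_entry 0)"
    using assms(2)
    by (intro module_mapI)
      (auto simp: zero_module_def Ob_direct_sum Mor_direct_sum fun_eq_iff single_entry_def pointwise_def
        module.scale_zero_right[OF vs])
  moreover have "Ob (direct_sum [] :: ('p::order, nat \<Rightarrow> 'v::ab_group_add) diagram) p = {\<lambda>_. 0}" for p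
    by (auto simp: Ob_direct_sum)
  ultimately show ?thesis
    using assms(2) unfolding module_iso_iff
    by (intro exI[of _ "\<lambda>p. single_entry 0"]) (auto simp: zero_module_def bij_betw_def single_entry_def)
qed

lemma direct_sum_singleton_iso:
  assumes "persistence_module s P F"
  shows "module_iso s (pointwise s) P F (direct_sum [F])"
proof -
  have "bij_betw (single_entry 0) (Ob F p) (Ob (direct_sum [F]) p)" for p
    by (rule bij_betw_byWitness[where f' = "\<lambda>g. g 0"])
      (auto simp: single_entry_def Ob_direct_sum fun_eq_iff)
  then show ?thesis
    using module_map_single_entry[of "[F]" s P 0] assms unfolding module_iso_iff by auto
qed

text \<open>
  This is how decompositions of two summands are assembled: on the first \<open>length As\<close> entries one
  isomorphism is applied to the first component, on the remaining ones the other isomorphism to the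
  second component, with shifted indices.
\<close>

lemma direct_sum_append_iso:
  assumes A: "persistence_module s P A" and B: "persistence_module s P B"
    and "module_iso s (pointwise s) P A (direct_sum As)"
    and "module_iso s (pointwise s) P B (direct_sum Bs)"
  shows "module_iso (pointwise s) (pointwise s) P (direct_sum [A, B]) (direct_sum (As @ Bs))"
proof -
  obtain \<alpha> \<beta> where
    \<alpha>: "module_map s (pointwise s) P A (direct_sum As) \<alpha>"
      "\<And>p. p \<in> P \<Longrightarrow> bij_betw (\<alpha> p) (Ob A p) (Ob (direct_sum As) p)" and
    \<beta>: "module_map s (pointwise s) P B (direct_sum Bs) \<beta>"
      "\<And>p. p \<in> P \<Longrightarrow> bij_betw (\<beta> p) (Ob B p) (Ob (direct_sum Bs) p)"
    using assms(3,4) unfolding module_iso_iff by blast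
  define \<eta> where "\<eta> = (\<lambda>p (g :: nat \<Rightarrow> 'b) i.
    if i < length As then \<alpha> p (g 0) i else \<beta> p (g 1) (i - length As))"
  have ob: "g \<in> Ob (direct_sum [A, B]) p \<longleftrightarrow> g 0 \<in> Ob A p \<and> g 1 \<in> Ob B p \<and> (\<forall>i\<ge>2. g i = 0)" for g p
    by (simp add: Ob_direct_sum_pair)
  have \<alpha>in: "\<alpha> p x i \<in> Ob (As ! i) p" if "p \<in> P" "x \<in> Ob A p" "i < length As" for p x i
    using module_mapD(1)[OF \<alpha>(1)] that by (auto simp: Ob_direct_sum)
  have \<alpha>0: "\<alpha> p x i = 0" if "p \<in> P" "x \<in> Ob A p" "i \<ge> length As" for p x i
    using module_mapD(1)[OF \<alpha>(1)] that by (auto simp: Ob_direct_sum)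
  have \<beta>in: "\<beta> p x i \<in> Ob (Bs ! i) p" if "p \<in> P" "x \<in> Ob B p" "i < length Bs" for p x i
    using module_mapD(1)[OF \<beta>(1)] that by (auto simp: Ob_direct_sum)
  have \<beta>0: "\<beta> p x i = 0" if "p \<in> P" "x \<in> Ob B p" "i \<ge> length Bs" for p x i
    using module_mapD(1)[OF \<beta>(1)] that by (auto simp: Ob_direct_sum)
  have map: "module_map (pointwise s) (pointwise s) P (direct_sum [A, B]) (direct_sum (As @ Bs)) \<eta>"
  proof (rule module_mapI)
    fix p q g assume *: "p \<in> P" "q \<in> P" "p \<le> q" "g \<in> Ob (direct_sum [A, B]) p"
    show "\<eta> q (Mor (direct_sum [A, B]) p q g) = Mor (direct_sum (As @ Bs)) p q (\<eta> p g)"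
      using * module_mapD(4)[OF \<alpha>(1), of p q "g 0"] module_mapD(4)[OF \<beta>(1), of p q "g 1"]
      by (auto simp: \<eta>_def Mor_direct_sum ob fun_eq_iff nth_append)
  next
    fix p g h assume *: "p \<in> P" "g \<in> Ob (direct_sum [A, B]) p" "h \<in> Ob (direct_sum [A, B]) p"
    show "\<eta> p (g + h) = \<eta> p g + \<eta> p h"
      using * module_mapD(2)[OF \<alpha>(1), of p "g 0" "h 0"] module_mapD(2)[OF \<beta>(1), of p "g 1" "h 1"]
      by (auto simp: \<eta>_def ob fun_eq_iff)
  next
    fix p g c assume *: "p \<in> P" "g \<in> Ob (direct_sum [A, B]) p"
    show "\<eta> p (pointwise s c g) = pointwise s c (\<eta> p g)"
      using * module_mapD(3)[OF \<alpha>(1), of p "g 0" c] module_mapD(3)[OF \<beta>(1), of p "g 1" c]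
      by (auto simp: \<eta>_def ob fun_eq_iff pointwise_def)
  qed (auto simp: \<eta>_def Ob_direct_sum[of _ "As @ Bs"] ob nth_append \<alpha>in \<beta>in \<beta>0)
  have "bij_betw (\<eta> p) (Ob (direct_sum [A, B]) p) (Ob (direct_sum (As @ Bs)) p)"
    if p: "p \<in> P" for p
  proof (rule bij_betw_imageI)
    show "inj_on (\<eta> p) (Ob (direct_sum [A, B]) p)"
    proof (rule inj_onI)
      fix g h assume g: "g \<in> Ob (direct_sum [A, B]) p" and h: "h \<in> Ob (direct_sum [A, B]) p"
        and eq: "\<eta> p g = \<eta> p h"
      have "\<alpha> p (g 0) i = \<alpha> p (h 0) i" for i
        using fun_cong[OF eq, of i] \<alpha>0[OF p] g h by (cases "i < length As") (auto simp: \<eta>_def ob)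
      then have "\<alpha> p (g 0) = \<alpha> p (h 0)" by blast
      then have 0: "g 0 = h 0" using \<alpha>(2)[OF p] g h by (auto simp: ob bij_betw_def inj_on_def)
      have "\<beta> p (g 1) i = \<beta> p (h 1) i" for i
        using fun_cong[OF eq, of "i + length As"] by (auto simp: \<eta>_def)
      then have "\<beta> p (g 1) = \<beta> p (h 1)" by blast
      then have 1: "g 1 = h 1" using \<beta>(2)[OF p] g h by (auto simp: ob bij_betw_def inj_on_def)
      show "g = h" using 0 1 g h by (intro pair_ext) (auto simp: ob)
    qed
    show "\<eta> p ` Ob (direct_sum [A, B]) p = Ob (direct_sum (As @ Bs)) p"
    proof
      show "\<eta> p ` Ob (direct_sum [A, B]) p \<subseteq> Ob (direct_sum (As @ Bs)) p"
        using module_mapD(1)[OF map p] by blast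
      show "Ob (direct_sum (As @ Bs)) p \<subseteq> \<eta> p ` Ob (direct_sum [A, B]) p"
      proof
        fix g assume g: "g \<in> Ob (direct_sum (As @ Bs)) p"
        have "g i \<in> Ob (As ! i) p" if "i < length As" for i
          using g that unfolding Ob_direct_sum by (auto simp: nth_append dest: spec[of _ i])
        then have "(\<lambda>i. if i < length As then g i else 0) \<in> Ob (direct_sum As) p"
          by (simp add: Ob_direct_sum)
        then obtain a where a: "a \<in> Ob A p" "(\<lambda>i. if i < length As then g i else 0) = \<alpha> p a"
          unfolding bij_betw_imp_surj_on[OF \<alpha>(2)[OF p], symmetric] by (elim imageE)
        have "g (i + length As) \<in> Ob (Bs ! i) p" if "i < length Bs" for i
          using g that unfolding Ob_direct_sum by (auto simp: nth_append dest: spec[of _ "i + length As"])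
        moreover have "g (i + length As) = 0" if "i \<ge> length Bs" for i
          using g that unfolding Ob_direct_sum by auto
        ultimately have "(\<lambda>i. g (i + length As)) \<in> Ob (direct_sum Bs) p"
          by (simp add: Ob_direct_sum)
        then obtain b where b: "b \<in> Ob B p" "(\<lambda>i. g (i + length As)) = \<beta> p b"
          unfolding bij_betw_imp_surj_on[OF \<beta>(2)[OF p], symmetric] by (elim imageE)
        have "g = \<eta> p (\<lambda>i. if i = 0 then a else if i = 1 then b else 0)"
          using a(1) b(1) by (auto simp: \<eta>_def fun_eq_iff a(2)[symmetric] b(2)[symmetric])
        moreover have "(\<lambda>i. if i = 0 then a else if i = 1 then b else 0) \<in> Ob (direct_sum [A, B]) p"
          using a b by (simp add: ob)
        ultimately show "g \<in> \<eta> p ` Ob (direct_sum [A, B]) p" by blast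
      qed
    qed
  qed
  then show ?thesis
    unfolding module_iso_iff using map by (intro exI[of _ \<eta>] conjI ballI)
qed

section \<open>Submodules\<close>

context vector_space
begin

lemma subspace_finite_span:
  assumes "finite B" "subspace U" "U \<subseteq> span B"
  shows "\<exists>C. finite C \<and> U = span C"
proof -
  obtain C where C: "C \<subseteq> U" "independent C" "U \<subseteq> span C" by (rule basis_exists)
  then have "finite C" using independent_span_bound[OF assms(1), of C] assms(3) by (meson order_trans)
  moreover have "span C \<subseteq> U" using C assms(2) by (simp add: span_minimal)
  ultimately show ?thesis using C by blast
qed

text \<open>
  The ambient space may have infinite dimension, so dimensions are compared inside a space spanned by
  a finite set: a basis of \<open>U\<close> stays independent when a vector of \<open>W - U\<close> is added.
\<close>

lemma dim_less_subspace:
  assumes "finite B" "subspace U" "subspace W" "W \<subseteq> span B" "U \<subset> W"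
  shows "dim U < dim W"
proof -
  obtain C where C: "C \<subseteq> U" "independent C" "U \<subseteq> span C" "card C = dim U"
    by (rule basis_exists)
  obtain D where D: "D \<subseteq> W" "independent D" "W \<subseteq> span D" "card D = dim W"
    by (rule basis_exists)
  have UW: "U \<subseteq> W" using assms(5) by auto
  have "D \<subseteq> span B" using D(1) assms(4) by (rule order_trans)
  then have finD: "finite D" using independent_span_bound[OF assms(1) D(2)] by simp
  obtain w where w: "w \<in> W" "w \<notin> U" using assms(5) by blast
  have spC: "span C \<subseteq> U" using C assms(2) by (simp add: span_minimal)
  then have "independent (insert w C)" using C w by (intro independent_insertI) auto
  moreover have "insert w C \<subseteq> span D" using C(1) D(3) w(1) UW by (simp add: subset_iff)
  ultimately have "finite (insert w C) \<and> card (insert w C) \<le> card D"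
    by (rule independent_span_bound[OF finD])
  moreover have "w \<notin> C" using w(2) C(1) by (auto simp: subset_iff)
  ultimately show ?thesis using C(4) D(4) by (auto simp: card_insert_if)
qed

lemma dim_le_subspace:
  assumes "finite B" "subspace U" "subspace W" "W \<subseteq> span B" "U \<subseteq> W"
  shows "dim U \<le> dim W"
  using dim_less_subspace[OF assms(1-4)] assms(5) by (cases "U = W") (simp_all add: psubset_eq less_imp_le)

text \<open>
  The dimension attains its minimum, and from then on an inclusion cannot be strict.
\<close>

lemma decreasing_subspaces_stable:
  assumes "finite B" "\<And>n::nat. subspace (U n)" "U 0 \<subseteq> span B" "\<And>n. U (Suc n) \<subseteq> U n"
  shows "\<exists>N. \<forall>n\<ge>N. U n = U N"
proof -
  have mono: "U n \<subseteq> U m" if "m \<le> n" for m n by (rule lift_Suc_antimono_le[of U, OF assms(4) that])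
  obtain N where N: "\<And>n. dim (U N) \<le> dim (U n)"
    using ex_has_least_nat[of "\<lambda>_. True" 0 "\<lambda>n. dim (U n)"] by auto
  have "U n = U N" if "N \<le> n" for n
  proof (rule ccontr)
    assume "U n \<noteq> U N"
    then have "dim (U n) < dim (U N)"
      using mono[OF that] mono[of 0 N] assms(3) by (intro dim_less_subspace[OF assms(1,2,2)]) auto
    then show False using N[of n] by simp
  qed
  then show ?thesis by blast
qed

lemma increasing_subspaces_stable:
  assumes "finite B" "\<And>n::nat. subspace (U n)" "\<And>n. U n \<subseteq> span B" "\<And>n. U n \<subseteq> U (Suc n)"
  shows "\<exists>N. \<forall>n\<ge>N. U n = U N"
proof -
  have mono: "U m \<subseteq> U n" if "m \<le> n" for m n by (rule lift_Suc_mono_le[of U, OF assms(4) that])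
  have bd: "dim (U n) \<le> dim (span B)" for n
    using assms by (intro dim_le_subspace[of B]) auto
  obtain N where N: "\<And>n. dim (U n) \<le> dim (U N)"
  proof -
    obtain N where N: "\<And>n. dim (span B) - dim (U N) \<le> dim (span B) - dim (U n)"
      using ex_has_least_nat[of "\<lambda>_. True" 0 "\<lambda>n. dim (span B) - dim (U n)"] by auto
    have "dim (U n) \<le> dim (U N)" for n using N[of n] bd[of n] bd[of N] by arith
    then show ?thesis by (rule that)
  qed
  have "U n = U N" if "N \<le> n" for n
  proof (rule ccontr)
    assume "U n \<noteq> U N"
    then have "dim (U N) < dim (U n)"
      using mono[OF that] assms(3)[of n] by (intro dim_less_subspace[OF assms(1,2,2)]) auto
    then show False using N[of n] by simp
  qed
  then show ?thesis by blast
qed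

end

definition submodule ::
  "('k::field \<Rightarrow> 'v::ab_group_add \<Rightarrow> 'v) \<Rightarrow> 'p::order set \<Rightarrow> ('p, 'v) diagram \<Rightarrow> ('p \<Rightarrow> 'v set) \<Rightarrow> bool"
  where
  "submodule s P F U \<longleftrightarrow>
     (\<forall>p\<in>P. module.subspace s (U p) \<and> U p \<subseteq> Ob F p) \<and>
     (\<forall>p\<in>P. \<forall>q\<in>P. p \<le> q \<longrightarrow> Mor F p q ` U p \<subseteq> U q)"

lemma pm_submodule:
  assumes F: "persistence_module s P F" and U: "submodule s P F U"
  shows "persistence_module s P (F\<lparr>Ob := U\<rparr>)"
proof -
  have sub: "x \<in> Ob F p" if "p \<in> P" "x \<in> U p" for p x using U that by (auto simp: submodule_def)
  have cl: "Mor F p q x \<in> U q" if "p \<in> P" "q \<in> P" "p \<le> q" "x \<in> U p" for p q x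
    using U that unfolding submodule_def by blast
  show ?thesis
    unfolding persistence_module_def
  proof (intro conjI ballI impI)
    show "vector_space s" using pm_vs F by blast
    show "functor_on P (F\<lparr>Ob := U\<rparr>)" unfolding functor_on_def
    proof (intro conjI ballI impI)
      show "Mor (F\<lparr>Ob := U\<rparr>) p q ` Ob (F\<lparr>Ob := U\<rparr>) p \<subseteq> Ob (F\<lparr>Ob := U\<rparr>) q"
        if "p \<in> P" "q \<in> P" "p \<le> q" for p q using cl that by auto
      show "Mor (F\<lparr>Ob := U\<rparr>) p p x = x" if "p \<in> P" "x \<in> Ob (F\<lparr>Ob := U\<rparr>) p" for p x
        using pm_functor(1)[OF F that(1) sub] that by simp
      show "Mor (F\<lparr>Ob := U\<rparr>) p r x = Mor (F\<lparr>Ob := U\<rparr>) q r (Mor (F\<lparr>Ob := U\<rparr>) p q x)"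
        if "p \<in> P" "q \<in> P" "r \<in> P" "p \<le> q" "q \<le> r" "x \<in> Ob (F\<lparr>Ob := U\<rparr>) p" for p q r x
        using pm_functor(2)[OF F that(1-5) sub] that by simp
    qed
  next
    fix p assume p: "p \<in> P"
    obtain B where "finite B" "Ob F p = module.span s B" using pm_fin[OF F p] by blast
    moreover have "module.subspace s (U p)" "U p \<subseteq> Ob F p" using U p by (auto simp: submodule_def)
    ultimately show "\<exists>B. finite B \<and> Ob (F\<lparr>Ob := U\<rparr>) p = module.span s B"
      using vector_space.subspace_finite_span[OF pm_vs[OF F], of B "U p"] by simp
  next
    fix p q assume *: "p \<in> P" "q \<in> P" "p \<le> q"
    then show "linear_between s s (Ob (F\<lparr>Ob := U\<rparr>) p) (Ob (F\<lparr>Ob := U\<rparr>) q) (Mor (F\<lparr>Ob := U\<rparr>) p q)"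
      unfolding linear_between_def by (simp add: cl pm_Mor_map[OF F *] sub[OF *(1)])
  qed
qed

definition internal_sum ::
  "'p set \<Rightarrow> ('p, 'v::ab_group_add) diagram \<Rightarrow> ('p \<Rightarrow> 'v set) \<Rightarrow> ('p \<Rightarrow> 'v set) \<Rightarrow> bool" where
  "internal_sum P F U W \<longleftrightarrow>
     (\<forall>p\<in>P. U p \<inter> W p \<subseteq> {0} \<and> (\<forall>x\<in>Ob F p. \<exists>u\<in>U p. \<exists>w\<in>W p. x = u + w))"

text \<open>
  The inverse isomorphism adds the two components; its linearity and naturality are immediate, whereas
  the projections of an internal sum exist only by choice.
\<close>

lemma internal_sum_iso:
  assumes F: "persistence_module s P F" and U: "submodule s P F U" and W: "submodule s P F W"
    and UW: "internal_sum P F U W"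
  shows "module_iso s (pointwise s) P F (direct_sum [F\<lparr>Ob := U\<rparr>, F\<lparr>Ob := W\<rparr>])"
proof (rule module_iso_sym)
  note pU = pm_submodule[OF F U] and pW = pm_submodule[OF F W]
  let ?D = "direct_sum [F\<lparr>Ob := U\<rparr>, F\<lparr>Ob := W\<rparr>]"
  show "persistence_module (pointwise s) P ?D"
    using pU pW pm_vs[OF F] by (intro pm_direct_sum) auto
  have ob: "g \<in> Ob ?D p \<longleftrightarrow> g 0 \<in> U p \<and> g 1 \<in> W p \<and> (\<forall>i\<ge>2. g i = 0)" for g p
    by (simp add: Ob_direct_sum_pair)
  have sub: "x \<in> U p \<Longrightarrow> x \<in> Ob F p" "x \<in> W p \<Longrightarrow> x \<in> Ob F p" if "p \<in> P" for p x
    using U W that by (auto simp: submodule_def)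
  note vs = vs_module[OF pm_vs[OF F]]
  have map: "module_map (pointwise s) s P ?D F (\<lambda>p g. g 0 + g 1)"
    by (rule module_mapI)
      (auto simp: ob sub pm_closed[OF F] pointwise_def module.scale_right_distrib[OF vs]
        Mor_direct_sum pm_Mor_map[OF F])
  have "bij_betw (\<lambda>g. g 0 + g 1) (Ob ?D p) (Ob F p)" if p: "p \<in> P" for p
  proof (rule bij_betw_imageI)
    have sU: "module.subspace s (U p)" and sW: "module.subspace s (W p)"
      using U W p by (auto simp: submodule_def)
    show "inj_on (\<lambda>g. g 0 + g 1) (Ob ?D p)"
    proof (rule inj_onI)
      fix g h assume g: "g \<in> Ob ?D p" and h: "h \<in> Ob ?D p" and eq: "g 0 + g 1 = h 0 + h 1"
      have "g 0 - h 0 = h 1 - g 1" using eq by (simp add: algebra_simps)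
      moreover have "g 0 - h 0 \<in> U p" "h 1 - g 1 \<in> W p"
        using g h module.subspace_diff[OF vs sU] module.subspace_diff[OF vs sW] by (auto simp: ob)
      moreover have "U p \<inter> W p \<subseteq> {0}" using UW p by (simp add: internal_sum_def)
      ultimately have "h 1 - g 1 = 0" by auto
      with \<open>g 0 - h 0 = h 1 - g 1\<close> have 01: "g 0 = h 0" "g 1 = h 1" by auto
      show "g = h" using 01 g h by (intro pair_ext) (auto simp: ob)
    qed
    show "(\<lambda>g. g 0 + g 1) ` Ob ?D p = Ob F p"
    proof
      show "(\<lambda>g. g 0 + g 1) ` Ob ?D p \<subseteq> Ob F p"
        using module_mapD(1)[OF map p] by blast
      show "Ob F p \<subseteq> (\<lambda>g. g 0 + g 1) ` Ob ?D p"
      proof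
        fix x assume "x \<in> Ob F p"
        then have "\<exists>u\<in>U p. \<exists>w\<in>W p. x = u + w" using UW p by (simp add: internal_sum_def)
        then obtain u w where "u \<in> U p" "w \<in> W p" "x = u + w" by (elim bexE)
        then show "x \<in> (\<lambda>g. g 0 + g 1) ` Ob ?D p"
          by (intro image_eqI[of _ _ "\<lambda>i::nat. if i = 0 then u else if i = 1 then w else 0"])
            (auto simp: ob)
      qed
    qed
  qed
  then show "module_iso (pointwise s) s P ?D F"
    unfolding module_iso_iff using map by (intro exI[of _ "\<lambda>p g. g 0 + g 1"] conjI ballI)
qed

lemma indecomposable_internal_sum:
  assumes "persistence_module s P F" "indecomposable s P F" "submodule s P F U" "submodule s P F W"
    "internal_sum P F U W"
  shows "(\<forall>p\<in>P. U p = {0}) \<or> (\<forall>p\<in>P. W p = {0})"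
proof -
  have "zero_module P (F\<lparr>Ob := U\<rparr>) \<or> zero_module P (F\<lparr>Ob := W\<rparr>)"
    using assms(2)[unfolded indecomposable_def, rule_format, OF pm_submodule[OF assms(1,3)]
      pm_submodule[OF assms(1,4)] internal_sum_iso[OF assms(1,3-5)]] .
  then show ?thesis by (simp add: zero_module_def)
qed

section \<open>Endomorphisms of indecomposable modules\<close>

lemma module_map_funpow:
  assumes "module_map s s P F F a"
  shows "module_map s s P F F (\<lambda>p. a p ^^ n)"
proof (induction n)
  case 0 show ?case by (intro module_mapI) auto
next
  case (Suc n) then show ?case using module_map_comp[OF Suc assms] by simp
qed

lemma subspace_image:
  assumes F: "persistence_module s P F" and G: "persistence_module t P G"
    and a: "module_map s t P F G a" and p: "p \<in> P"
  shows "module.subspace t (a p ` Ob F p)"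
proof (rule module.subspaceI)
  show "module t" by (rule vs_module[OF pm_vs[OF G]])
  show "0 \<in> a p ` Ob F p"
    by (rule image_eqI[of 0 "a p" 0, OF module_map_0[OF F pm_vs[OF G] a p, symmetric] pm_closed(1)[OF F p]])
  show "x + y \<in> a p ` Ob F p" if "x \<in> a p ` Ob F p" "y \<in> a p ` Ob F p" for x y
    using that module_mapD(2)[OF a p, symmetric] pm_closed(2)[OF F p] by auto
  show "t c x \<in> a p ` Ob F p" if "x \<in> a p ` Ob F p" for c x
    using that module_mapD(3)[OF a p, symmetric] pm_closed(3)[OF F p] by auto
qed

lemma subspace_kernel:
  assumes F: "persistence_module s P F" and t: "vector_space t"
    and a: "module_map s t P F G a" and p: "p \<in> P"
  shows "module.subspace s {x \<in> Ob F p. a p x = 0}"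
proof (rule module.subspaceI)
  show "module s" by (rule vs_module[OF pm_vs[OF F]])
qed (use module_map_0[OF F t a p] module_mapD(2,3)[OF a p] pm_closed[OF F p]
      module.scale_zero_right[OF vs_module[OF t]] in auto)

lemma submodule_image:
  assumes F: "persistence_module s P F" and G: "persistence_module t P G"
    and a: "module_map s t P F G a"
  shows "submodule t P G (\<lambda>p. a p ` Ob F p)"
  unfolding submodule_def
proof (intro conjI ballI impI)
  fix p q assume *: "p \<in> P" "q \<in> P" "p \<le> q"
  show "Mor G p q ` a p ` Ob F p \<subseteq> a q ` Ob F q"
    using module_mapD(4)[OF a *, symmetric] pm_Mor_map(1)[OF F *] by auto
qed (use subspace_image[OF F G a] module_mapD(1)[OF a] in auto)

lemma submodule_kernel:
  assumes F: "persistence_module s P F" and G: "persistence_module t P G"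
    and a: "module_map s t P F G a"
  shows "submodule s P F (\<lambda>p. {x \<in> Ob F p. a p x = 0})"
  unfolding submodule_def
proof (intro conjI ballI impI)
  fix p q assume *: "p \<in> P" "q \<in> P" "p \<le> q"
  show "Mor F p q ` {x \<in> Ob F p. a p x = 0} \<subseteq> {x \<in> Ob F q. a q x = 0}"
    using module_mapD(4)[OF a *] pm_Mor_map(1)[OF F *] pm_Mor_0[OF G *] by auto
qed (use subspace_kernel[OF F pm_vs[OF G] a] in auto)

text \<open>
  Iterated images decrease and iterated kernels increase, so both are stationary for large \<open>n\<close>.
  Comparing \<open>n\<close> with \<open>2 n\<close> is exactly what the Fitting decomposition uses.
\<close>

lemma image_kernel_stable:
  assumes F: "persistence_module s P F" and a: "module_map s s P F F a" and p: "p \<in> P"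
  shows "eventually (\<lambda>n. (a p ^^ (n + n)) ` Ob F p = (a p ^^ n) ` Ob F p \<and>
    {x \<in> Ob F p. (a p ^^ (n + n)) x = 0} = {x \<in> Ob F p. (a p ^^ n) x = 0}) sequentially"
proof -
  note pow = module_map_funpow[OF a]
  obtain B where B: "finite B" "Ob F p = module.span s B" using pm_fin[OF F p] by blast
  note vs = pm_vs[OF F]
  have ap: "a p x \<in> Ob F p" if "x \<in> Ob F p" for x by (rule module_mapD(1)[OF a p that])
  have "\<exists>N. \<forall>n\<ge>N. (a p ^^ n) ` Ob F p = (a p ^^ N) ` Ob F p"
  proof (rule vector_space.decreasing_subspaces_stable[OF vs B(1)])
    show "module.subspace s ((a p ^^ n) ` Ob F p)" for n
      by (rule subspace_image[OF F F pow p])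
    show "(a p ^^ Suc n) ` Ob F p \<subseteq> (a p ^^ n) ` Ob F p" for n
    proof
      fix y assume "y \<in> (a p ^^ Suc n) ` Ob F p"
      then obtain x where "x \<in> Ob F p" "y = (a p ^^ n) (a p x)"
        by (auto simp: funpow_Suc_right simp del: funpow.simps)
      then show "y \<in> (a p ^^ n) ` Ob F p" using ap by (intro image_eqI)
    qed
  qed (simp add: B(2))
  then obtain N1 where N1: "\<forall>n\<ge>N1. (a p ^^ n) ` Ob F p = (a p ^^ N1) ` Ob F p" by (elim exE)
  have "\<exists>N. \<forall>n\<ge>N. {x \<in> Ob F p. (a p ^^ n) x = 0} = {x \<in> Ob F p. (a p ^^ N) x = 0}"
  proof (rule vector_space.increasing_subspaces_stable[OF vs B(1)])
    show "module.subspace s {x \<in> Ob F p. (a p ^^ n) x = 0}" for n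
      by (rule subspace_kernel[OF F vs pow p])
    show "{x \<in> Ob F p. (a p ^^ n) x = 0} \<subseteq> {x \<in> Ob F p. (a p ^^ Suc n) x = 0}" for n
      using module_map_0[OF F vs a p] by auto
    show "{x \<in> Ob F p. (a p ^^ n) x = 0} \<subseteq> module.span s B" for n using B(2) by auto
  qed
  then obtain N2 where N2: "\<forall>n\<ge>N2.
      {x \<in> Ob F p. (a p ^^ n) x = 0} = {x \<in> Ob F p. (a p ^^ N2) x = 0}" by (elim exE)
  show ?thesis
    unfolding eventually_sequentially
  proof (intro exI[of _ "max N1 N2"] allI impI conjI)
    fix n assume "max N1 N2 \<le> n"
    then have "n \<ge> N1" "n + n \<ge> N1" "n \<ge> N2" "n + n \<ge> N2" by auto
    then show "(a p ^^ (n + n)) ` Ob F p = (a p ^^ n) ` Ob F p"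
      "{x \<in> Ob F p. (a p ^^ (n + n)) x = 0} = {x \<in> Ob F p. (a p ^^ n) x = 0}"
      using N1[rule_format, of n] N1[rule_format, of "n + n"]
        N2[rule_format, of n] N2[rule_format, of "n + n"] by simp_all
  qed
qed

text \<open>
  Fitting's lemma: once images and kernels of the powers are stationary (simultaneously at the finitely
  many points of the poset), the module is the internal sum of the image and the kernel of a power
  of \<open>a\<close>.  Indecomposability makes one of them zero.
\<close>

lemma fitting:
  assumes "finite P" and F: "persistence_module s P F" and ind: "indecomposable s P F"
    and a: "module_map s s P F F a"
  shows "(\<forall>p\<in>P. bij_betw (a p) (Ob F p) (Ob F p)) \<or> (\<exists>N. \<forall>p\<in>P. \<forall>x\<in>Ob F p. (a p ^^ N) x = 0)"
proof -
  note pow = module_map_funpow[OF a]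
  have "eventually (\<lambda>n. \<forall>p\<in>P. (a p ^^ (n + n)) ` Ob F p = (a p ^^ n) ` Ob F p \<and>
    {x \<in> Ob F p. (a p ^^ (n + n)) x = 0} = {x \<in> Ob F p. (a p ^^ n) x = 0}) sequentially"
    by (intro eventually_ball_finite \<open>finite P\<close> ballI image_kernel_stable[OF F a])
  from eventually_conj[OF this eventually_gt_at_top[of 0]]
  obtain N where N: "N > 0"
    and im: "\<And>p. p \<in> P \<Longrightarrow> (a p ^^ (N + N)) ` Ob F p = (a p ^^ N) ` Ob F p"
    and ker: "\<And>p. p \<in> P \<Longrightarrow>
      {x \<in> Ob F p. (a p ^^ (N + N)) x = 0} = {x \<in> Ob F p. (a p ^^ N) x = 0}"
    unfolding eventually_sequentially by auto
  let ?I = "\<lambda>p. (a p ^^ N) ` Ob F p" and ?K = "\<lambda>p. {x \<in> Ob F p. (a p ^^ N) x = 0}"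
  have sum: "\<exists>u\<in>?I p. \<exists>w\<in>?K p. x = u + w" if p: "p \<in> P" and x: "x \<in> Ob F p" for p x
  proof -
    have "(a p ^^ N) x \<in> (a p ^^ (N + N)) ` Ob F p" using im[OF p] x by auto
    then obtain y where y: "y \<in> Ob F p" "(a p ^^ N) x = (a p ^^ (N + N)) y" by auto
    have ay: "(a p ^^ N) y \<in> Ob F p" by (rule module_mapD(1)[OF pow p y(1)])
    have "(a p ^^ N) (x - (a p ^^ N) y) = (a p ^^ N) x - (a p ^^ N) ((a p ^^ N) y)"
      by (rule module_map_diff[OF F pow p x ay])
    also have "\<dots> = 0" using y by (simp add: funpow_add)
    finally have "x - (a p ^^ N) y \<in> ?K p" using pm_closed(4)[OF F p x ay] by simp
    moreover have "x = (a p ^^ N) y + (x - (a p ^^ N) y)" by simp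
    moreover have "(a p ^^ N) y \<in> ?I p" using y(1) by (rule imageI)
    ultimately show ?thesis by (intro bexI)
  qed
  have inter: "?I p \<inter> ?K p \<subseteq> {0}" if p: "p \<in> P" for p
  proof
    fix x assume "x \<in> ?I p \<inter> ?K p"
    then obtain y where y: "y \<in> Ob F p" "x = (a p ^^ N) y" "(a p ^^ N) x = 0" by auto
    then have "y \<in> {x \<in> Ob F p. (a p ^^ (N + N)) x = 0}" by (simp add: funpow_add)
    then have "(a p ^^ N) y = 0" unfolding ker[OF p] by simp
    then show "x \<in> {0}" using y by simp
  qed
  have "(\<forall>p\<in>P. ?I p = {0}) \<or> (\<forall>p\<in>P. ?K p = {0})"
    using indecomposable_internal_sum[OF F ind submodule_image[OF F F pow]
      submodule_kernel[OF F F pow], of N] sum inter by (auto simp: internal_sum_def)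
  then show ?thesis
  proof
    assume "\<forall>p\<in>P. ?I p = {0}"
    then show ?thesis by blast
  next
    assume K: "\<forall>p\<in>P. ?K p = {0}"
    have "bij_betw (a p) (Ob F p) (Ob F p)" if p: "p \<in> P" for p
    proof (rule bij_betw_imageI)
      show "inj_on (a p) (Ob F p)"
      proof (rule inj_onI)
        fix x y assume x: "x \<in> Ob F p" and y: "y \<in> Ob F p" and eq: "a p x = a p y"
        obtain M where M: "N = Suc M" using N by (cases N) auto
        have "a p (x - y) = 0" using module_map_diff[OF F a p x y] eq by simp
        then have "(a p ^^ N) (x - y) = (a p ^^ M) 0"
          unfolding M by (simp add: funpow_Suc_right del: funpow.simps)
        also have "\<dots> = 0" by (rule module_map_0[OF F pm_vs[OF F] pow p])
        finally have "x - y \<in> ?K p" using pm_closed(4)[OF F p x y] by simp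
        then show "x = y" using K p by auto
      qed
      show "a p ` Ob F p = Ob F p"
      proof
        show "a p ` Ob F p \<subseteq> Ob F p" using module_mapD(1)[OF a p] by auto
        show "Ob F p \<subseteq> a p ` Ob F p"
        proof
          fix x assume "x \<in> Ob F p"
          from sum[OF p this] obtain u w where "u \<in> ?I p" "w \<in> ?K p" "x = u + w" by (elim bexE)
          then have "x \<in> ?I p" using K p by auto
          moreover obtain M where M: "N = Suc M" using N by (cases N) auto
          ultimately obtain y where "y \<in> Ob F p" "x = a p ((a p ^^ M) y)" by auto
          then show "x \<in> a p ` Ob F p" using module_mapD(1)[OF pow p] by (intro image_eqI)
        qed
      qed
    qed
    then show ?thesis by blast
  qed
qed

text \<open>
  The endomorphism ring of an indecomposable module is local.  After division by the invertible sum
  \<open>u = a + b\<close>, if \<open>u\<^sup>-\<^sup>1 a\<close> is nilpotent, then \<open>b\<close> is injective, since \<open>b x = 0\<close> means that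
  \<open>x\<close> is fixed by \<open>u\<^sup>-\<^sup>1 a\<close>; an injective endomorphism of a nonzero module is not nilpotent, so it is
  bijective by \<open>fitting\<close>.
\<close>

lemma endomorphism_add_bij:
  assumes P: "finite P" and F: "persistence_module s P F" and ind: "indecomposable s P F"
    and nz: "\<not> zero_module P F"
    and a: "module_map s s P F F a" and b: "module_map s s P F F b"
    and bij: "\<And>p. p \<in> P \<Longrightarrow> bij_betw (\<lambda>x. a p x + b p x) (Ob F p) (Ob F p)"
  shows "(\<forall>p\<in>P. bij_betw (a p) (Ob F p) (Ob F p)) \<or> (\<forall>p\<in>P. bij_betw (b p) (Ob F p) (Ob F p))"
proof -
  define u where "u = (\<lambda>p x. a p x + b p x)"
  define v where "v = (\<lambda>p. inv_into (Ob F p) (u p))"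
  have u: "module_map s s P F F u" unfolding u_def by (rule module_map_add[OF F F a b])
  have ubij: "bij_betw (u p) (Ob F p) (Ob F p)" if "p \<in> P" for p
    using bij[OF that] by (simp add: u_def)
  have v: "module_map s s P F F v"
    unfolding v_def by (rule module_map_inverse[OF F u ubij])
  have vu: "v p (u p x) = x" if "p \<in> P" "x \<in> Ob F p" for p x
    unfolding v_def using bij_betw_inv_into_left[OF ubij[OF that(1)] that(2)] .
  have uv: "u p (v p x) = x" if "p \<in> P" "x \<in> Ob F p" for p x
    unfolding v_def using bij_betw_inv_into_right[OF ubij[OF that(1)] that(2)] .
  define a' where "a' = (\<lambda>p x. v p (a p x))"
  have a': "module_map s s P F F a'" unfolding a'_def by (rule module_map_comp[OF a v])
  from fitting[OF P F ind a'] show ?thesis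
  proof
    assume 1: "\<forall>p\<in>P. bij_betw (a' p) (Ob F p) (Ob F p)"
    have "bij_betw (a p) (Ob F p) (Ob F p)" if p: "p \<in> P" for p
    proof -
      have "bij_betw (u p \<circ> a' p) (Ob F p) (Ob F p)"
        by (rule bij_betw_trans[OF 1[rule_format, OF p] ubij[OF p]])
      moreover have "(u p \<circ> a' p) x = a p x" if "x \<in> Ob F p" for x
        using uv[OF p module_mapD(1)[OF a p that]] by (simp add: a'_def)
      ultimately show ?thesis by (simp cong: bij_betw_cong)
    qed
    then show ?thesis by blast
  next
    assume "\<exists>N. \<forall>p\<in>P. \<forall>x\<in>Ob F p. (a' p ^^ N) x = 0"
    then obtain N where N: "\<And>p x. p \<in> P \<Longrightarrow> x \<in> Ob F p \<Longrightarrow> (a' p ^^ N) x = 0" by blast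
    have inj: "x = 0" if p: "p \<in> P" and x: "x \<in> Ob F p" and "b p x = 0" for p x
    proof -
      have "u p x = a p x" using that by (simp add: u_def)
      then have a'x: "a' p x = x" using vu[OF p x] by (simp add: a'_def)
      have "(a' p ^^ n) x = x" for n by (induction n) (simp_all add: a'x)
      then show ?thesis using N[OF p x] by simp
    qed
    from fitting[OF P F ind b] show ?thesis
    proof
      assume "\<exists>N. \<forall>p\<in>P. \<forall>x\<in>Ob F p. (b p ^^ N) x = 0"
      then obtain N where N: "\<And>p x. p \<in> P \<Longrightarrow> x \<in> Ob F p \<Longrightarrow> (b p ^^ N) x = 0" by blast
      have "x = 0" if p: "p \<in> P" and x: "x \<in> Ob F p" for p x
      proof -
        have "(b p ^^ n) x = 0 \<Longrightarrow> x = 0" for n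
        proof (induction n)
          case (Suc n)
          have "(b p ^^ n) x \<in> Ob F p"
            by (rule module_mapD(1)[OF module_map_funpow[OF b] p x])
          then show ?case using Suc inj[OF p] by simp
        qed simp
        then show ?thesis using N[OF p x] by blast
      qed
      then have "zero_module P F"
        using pm_closed(1)[OF F] by (auto simp: zero_module_def)
      then show ?thesis using nz by blast
    qed blast
  qed
qed

lemma endomorphism_sum_bij:
  fixes \<phi> :: "nat \<Rightarrow> 'p::order \<Rightarrow> 'v::ab_group_add \<Rightarrow> 'v"
  assumes P: "finite P" and F: "persistence_module s P F" and ind: "indecomposable s P F"
    and nz: "\<not> zero_module P F"
    and "\<And>i. i < n \<Longrightarrow> module_map s s P F F (\<phi> i)"
    and "\<And>p. p \<in> P \<Longrightarrow> bij_betw (\<lambda>x. \<Sum>i<n. \<phi> i p x) (Ob F p) (Ob F p)"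
  shows "\<exists>i<n. \<forall>p\<in>P. bij_betw (\<phi> i p) (Ob F p) (Ob F p)"
  using assms(5,6)
proof (induction n)
  case 0
  have "Ob F p = {0}" if "p \<in> P" for p
  proof -
    have "(\<lambda>x::'v. 0::'v) ` Ob F p = Ob F p" using 0(2)[OF that] by (simp add: bij_betw_def)
    then show ?thesis using pm_closed(1)[OF F that] by auto
  qed
  then show ?case using nz by (simp add: zero_module_def)
next
  case (Suc n)
  have s: "module_map s s P F F (\<lambda>p x. \<Sum>i<n. \<phi> i p x)"
    by (rule module_map_sum_maps[OF F F]) (use Suc.prems(1) in simp)
  have "(\<forall>p\<in>P. bij_betw (\<lambda>x. \<Sum>i<n. \<phi> i p x) (Ob F p) (Ob F p)) \<or>
      (\<forall>p\<in>P. bij_betw (\<phi> n p) (Ob F p) (Ob F p))"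
    by (rule endomorphism_add_bij[OF P F ind nz s]) (use Suc.prems in simp_all)
  then show ?case
  proof
    assume "\<forall>p\<in>P. bij_betw (\<lambda>x. \<Sum>i<n. \<phi> i p x) (Ob F p) (Ob F p)"
    then have "\<exists>i<n. \<forall>p\<in>P. bij_betw (\<phi> i p) (Ob F p) (Ob F p)"
      using Suc.prems(1) by (intro Suc.IH) simp_all
    then show ?thesis using less_SucI by blast
  qed blast
qed

section \<open>The Krull-Schmidt theorem\<close>

definition remove_nth :: "nat \<Rightarrow> 'a list \<Rightarrow> 'a list" where
  "remove_nth j xs = take j xs @ drop (Suc j) xs"

lemma length_remove_nth: "j < length xs \<Longrightarrow> length (remove_nth j xs) = length xs - 1"
  by (simp add: remove_nth_def)

lemma nth_remove_nth:
  "j < length xs \<Longrightarrow> k < length xs - 1 \<Longrightarrow>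
    remove_nth j xs ! k = (if k < j then xs ! k else xs ! Suc k)"
  by (auto simp: remove_nth_def nth_append min_def)

lemma mset_remove_nth: "j < length xs \<Longrightarrow> mset xs = add_mset (xs ! j) (mset (remove_nth j xs))"
  unfolding remove_nth_def by (subst id_take_nth_drop[of j xs]) auto

text \<open>
  The inclusion of the direct sum without the summand \<open>j\<close> into the full direct sum.
\<close>

definition insert_zero :: "nat \<Rightarrow> (nat \<Rightarrow> 'v::zero) \<Rightarrow> nat \<Rightarrow> 'v" where
  "insert_zero j y = (\<lambda>k. if k < j then y k else if k = j then 0 else y (k - 1))"

lemma insert_zero_in:
  assumes "j < length Gs" "y \<in> Ob (direct_sum (remove_nth j Gs)) p" "0 \<in> Ob (Gs ! j) p"
  shows "insert_zero j y \<in> Ob (direct_sum Gs) p"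
proof -
  have y: "y k \<in> Ob (if k < j then Gs ! k else Gs ! Suc k) p" if "k < length Gs - 1" for k
    using assms(2) that unfolding Ob_direct_sum
    by (simp add: length_remove_nth[OF assms(1)] nth_remove_nth[OF assms(1)])
  have y0: "y k = 0" if "k \<ge> length Gs - 1" for k
    using assms(2) that unfolding Ob_direct_sum by (simp add: length_remove_nth[OF assms(1)])
  show ?thesis unfolding Ob_direct_sum
  proof (intro conjI allI impI)
    fix k assume k: "k < length Gs"
    consider "k < j" | "k = j" | "k > j" by linarith
    then show "insert_zero j y k \<in> Ob (Gs ! k) p"
    proof cases
      case 1 then show ?thesis using y[of k] assms(1) by (simp add: insert_zero_def)
    next
      case 2 then show ?thesis using assms(3) by (simp add: insert_zero_def)
    next
      case 3
      then obtain m where "k = Suc m" "\<not> m < j" by (cases k) auto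
      then show ?thesis using y[of m] k 3 by (auto simp: insert_zero_def)
    qed
  next
    fix k assume "length Gs \<le> k"
    then show "insert_zero j y k = 0" using y0[of "k - 1"] assms(1) by (simp add: insert_zero_def)
  qed
qed

lemma insert_zero_surj:
  assumes "j < length Gs" "g \<in> Ob (direct_sum Gs) p" "g j = 0"
  shows "\<exists>y\<in>Ob (direct_sum (remove_nth j Gs)) p. insert_zero j y = g"
proof (rule bexI)
  let ?y = "\<lambda>k. if k < j then g k else g (Suc k)"
  show "insert_zero j ?y = g"
  proof
    fix k
    show "insert_zero j ?y k = g k"
      using assms(3) by (cases k) (auto simp: insert_zero_def not_less_eq)
  qed
  show "?y \<in> Ob (direct_sum (remove_nth j Gs)) p"
    using assms(1,2) unfolding Ob_direct_sum
    by (auto simp: length_remove_nth[OF assms(1)] nth_remove_nth[OF assms(1)])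
qed

lemma insert_zero_inj: "insert_zero j y = insert_zero j y' \<Longrightarrow> y = y'"
proof
  fix k assume "insert_zero j y = insert_zero j y'"
  from fun_cong[OF this, of k] fun_cong[OF this, of "Suc k"] show "y k = y' k"
    by (auto simp: insert_zero_def split: if_splits)
qed

lemma module_map_insert_zero:
  assumes pm: "\<forall>G\<in>set Gs. persistence_module s P G" and j: "j < length Gs"
  shows "module_map (pointwise s) (pointwise s) P (direct_sum (remove_nth j Gs)) (direct_sum Gs)
    (\<lambda>p. insert_zero j)"
proof -
  have G: "persistence_module s P (Gs ! k)" if "k < length Gs" for k using pm that by simp
  note vs = vs_module[OF pm_vs[OF G[OF j]]]
  show ?thesis
  proof (rule module_mapI)
    show "insert_zero j y \<in> Ob (direct_sum Gs) p"
      if "p \<in> P" "y \<in> Ob (direct_sum (remove_nth j Gs)) p" for p y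
      using insert_zero_in[OF j that(2)] pm_closed(1)[OF G[OF j] that(1)] by blast
    show "insert_zero j (pointwise s c y) = pointwise s c (insert_zero j y)" for c y
      by (simp add: insert_zero_def pointwise_def fun_eq_iff module.scale_zero_right[OF vs])
    show "insert_zero j (Mor (direct_sum (remove_nth j Gs)) p q y) =
        Mor (direct_sum Gs) p q (insert_zero j y)"
      if "p \<in> P" "q \<in> P" "p \<le> q" for p q y
    proof
      fix k
      consider "k < j" | "k = j" | "k > j" by linarith
      then show "insert_zero j (Mor (direct_sum (remove_nth j Gs)) p q y) k =
        Mor (direct_sum Gs) p q (insert_zero j y) k"
        using j pm_Mor_0[OF G[OF j] that]
        by cases (auto simp: insert_zero_def Mor_direct_sum length_remove_nth nth_remove_nth)
    qed
  qed (simp add: insert_zero_def fun_eq_iff)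
qed

text \<open>
  Let \<open>\<eta>\<close> be the isomorphism, \<open>\<theta>\<close> its inverse, \<open>\<alpha> j\<close> and \<open>\<beta> j\<close> their components between \<open>F\<close> and
  \<open>Gs ! j\<close>.  The sum of all \<open>\<beta> j \<circ> \<alpha> j\<close> is the identity of \<open>F\<close>, so by locality one of them is bijective.
  Then \<open>Gs ! j\<close> is the internal sum of the image of \<open>\<alpha> j\<close> and the kernel of \<open>\<beta> j\<close>; the latter must
  vanish, and \<open>F\<close> is isomorphic to \<open>Gs ! j\<close>.  The remaining summands are identified by
  \<open>\<delta>\<close>: include an element without \<open>j\<close>-th entry, apply \<open>\<theta>\<close>, and forget the entry in \<open>F\<close>.  It is
  bijective because \<open>\<alpha> j\<close> is: an entry in \<open>F\<close> can be adjusted in exactly one way so that the \<open>j\<close>-th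
  entry of the image under \<open>\<eta>\<close> becomes \<open>0\<close>.
\<close>

lemma krull_schmidt_exchange:
  assumes P: "finite P"
    and F: "persistence_module s P F" and Fs: "\<forall>F\<in>set Fs. persistence_module s P F"
    and Gs: "\<forall>G\<in>set Gs. persistence_module s P G" "\<forall>G\<in>set Gs. indecomposable s P G"
    and ind: "indecomposable s P F" and nz: "\<not> zero_module P F"
    and iso: "module_iso (pointwise s) (pointwise s) P (direct_sum (F # Fs)) (direct_sum Gs)"
  shows "\<exists>j<length Gs. module_iso s s P F (Gs ! j) \<and>
    module_iso (pointwise s) (pointwise s) P (direct_sum Fs) (direct_sum (remove_nth j Gs))"
proof -
  have FFs: "\<forall>F\<in>set (F # Fs). persistence_module s P F" using F Fs by simp
  note vs = pm_vs[OF F]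
  note pmF = pm_direct_sum[OF vs FFs] and pmG = pm_direct_sum[OF vs Gs(1)]
  note vsp = vector_space_pointwise[OF vs]
  obtain \<eta> where \<eta>: "module_map (pointwise s) (pointwise s) P (direct_sum (F # Fs)) (direct_sum Gs) \<eta>"
    and \<eta>bij: "\<And>p. p \<in> P \<Longrightarrow> bij_betw (\<eta> p) (Ob (direct_sum (F # Fs)) p) (Ob (direct_sum Gs) p)"
    using iso unfolding module_iso_iff by blast
  define \<theta> where "\<theta> = (\<lambda>p. inv_into (Ob (direct_sum (F # Fs)) p) (\<eta> p))"
  have \<theta>: "module_map (pointwise s) (pointwise s) P (direct_sum Gs) (direct_sum (F # Fs)) \<theta>"
    unfolding \<theta>_def by (rule module_map_inverse[OF pmF \<eta> \<eta>bij])
  have \<theta>\<eta>: "\<theta> p (\<eta> p x) = x" if "p \<in> P" "x \<in> Ob (direct_sum (F # Fs)) p" for p x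
    unfolding \<theta>_def by (rule bij_betw_inv_into_left[OF \<eta>bij[OF that(1)] that(2)])
  have \<eta>\<theta>: "\<eta> p (\<theta> p x) = x" if "p \<in> P" "x \<in> Ob (direct_sum Gs) p" for p x
    unfolding \<theta>_def by (rule bij_betw_inv_into_right[OF \<eta>bij[OF that(1)] that(2)])
  define \<alpha> where "\<alpha> = (\<lambda>j p v. \<eta> p (single_entry 0 v) j)"
  define \<beta> where "\<beta> = (\<lambda>j p v. \<theta> p (single_entry j v) 0)"
  have s0: "module_map s (pointwise s) P F (direct_sum (F # Fs)) (\<lambda>p. single_entry 0)"
    using module_map_single_entry[OF FFs, of 0] by simp
  have s0in: "single_entry 0 v \<in> Ob (direct_sum (F # Fs)) p" if "p \<in> P" "v \<in> Ob F p" for p v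
    using module_mapD(1)[OF s0] that .
  have p0: "module_map (pointwise s) s P (direct_sum (F # Fs)) F (\<lambda>p g. g 0)"
    using module_map_proj[of 0 "F # Fs" s P] by simp
  have G: "persistence_module s P (Gs ! j)" "indecomposable s P (Gs ! j)" if "j < length Gs" for j
    using Gs that by simp_all
  have \<alpha>: "module_map s s P F (Gs ! j) (\<alpha> j)" if "j < length Gs" for j
    unfolding \<alpha>_def by (rule module_map_comp[OF module_map_comp[OF s0 \<eta>] module_map_proj[OF that]])
  have \<beta>: "module_map s s P (Gs ! j) F (\<beta> j)" if "j < length Gs" for j
    unfolding \<beta>_def
    by (rule module_map_comp[OF module_map_comp[OF module_map_single_entry[OF Gs(1) that] \<theta>] p0])
  have id: "(\<Sum>j<length Gs. \<beta> j p (\<alpha> j p v)) = v" if p: "p \<in> P" and v: "v \<in> Ob F p" for p v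
  proof -
    let ?g = "\<eta> p (single_entry 0 v)"
    have g: "?g \<in> Ob (direct_sum Gs) p" by (rule module_mapD(1)[OF \<eta> p s0in[OF p v]])
    have "single_entry j (?g j) \<in> Ob (direct_sum Gs) p" if "j < length Gs" for j
      using module_mapD(1)[OF module_map_single_entry[OF Gs(1) that] p] g that
      by (simp add: Ob_direct_sum)
    then have "\<theta> p (\<Sum>j<length Gs. single_entry j (?g j)) = (\<Sum>j<length Gs. \<theta> p (single_entry j (?g j)))"
      by (intro module_map_sum[OF pmG vsp \<theta> p]) simp
    then have "(\<Sum>j<length Gs. \<theta> p (single_entry j (?g j))) = \<theta> p ?g"
      using direct_sum_eq_sum_single_entry[OF g] by simp
    also have "\<dots> = single_entry 0 v" by (rule \<theta>\<eta>[OF p s0in[OF p v]])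
    finally have "(\<Sum>j<length Gs. \<theta> p (single_entry j (?g j))) 0 = v"
      by (simp add: single_entry_apply)
    then show ?thesis by (simp add: \<alpha>_def \<beta>_def sum_apply)
  qed
  have "\<exists>j<length Gs. \<forall>p\<in>P. bij_betw (\<lambda>v. \<beta> j p (\<alpha> j p v)) (Ob F p) (Ob F p)"
  proof (rule endomorphism_sum_bij[OF P F ind nz])
    show "module_map s s P F F (\<lambda>p v. \<beta> j p (\<alpha> j p v))" if "j < length Gs" for j
      by (rule module_map_comp[OF \<alpha>[OF that] \<beta>[OF that]])
    show "bij_betw (\<lambda>v. \<Sum>j<length Gs. \<beta> j p (\<alpha> j p v)) (Ob F p) (Ob F p)" if "p \<in> P" for p
      using id[OF that] bij_betw_id[of "Ob F p"] by (simp cong: bij_betw_cong)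
  qed
  then obtain j where j: "j < length Gs"
    and \<beta>\<alpha>: "\<And>p. p \<in> P \<Longrightarrow> bij_betw (\<lambda>v. \<beta> j p (\<alpha> j p v)) (Ob F p) (Ob F p)" by blast
  have \<beta>\<alpha>surj: "\<exists>v\<in>Ob F p. \<beta> j p (\<alpha> j p v) = w" if "p \<in> P" "w \<in> Ob F p" for p w
  proof -
    have "w \<in> (\<lambda>v. \<beta> j p (\<alpha> j p v)) ` Ob F p"
      using bij_betw_imp_surj_on[OF \<beta>\<alpha>[OF that(1)]] that(2) by simp
    then show ?thesis by auto
  qed
  have \<alpha>inj: "v = v'" if "p \<in> P" "v \<in> Ob F p" "v' \<in> Ob F p" "\<alpha> j p v = \<alpha> j p v'" for p v v'
    using inj_onD[OF bij_betw_imp_inj_on[OF \<beta>\<alpha>[OF that(1)]], of v v'] that by simp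
  let ?G = "Gs ! j"
  have \<beta>ker: "\<forall>p\<in>P. {x \<in> Ob ?G p. \<beta> j p x = 0} = {0}"
  proof -
    have "internal_sum P ?G (\<lambda>p. \<alpha> j p ` Ob F p) (\<lambda>p. {x \<in> Ob ?G p. \<beta> j p x = 0})"
      unfolding internal_sum_def
    proof (intro ballI conjI)
      fix p assume p: "p \<in> P"
      show "\<alpha> j p ` Ob F p \<inter> {x \<in> Ob ?G p. \<beta> j p x = 0} \<subseteq> {0}"
      proof
        fix x assume "x \<in> \<alpha> j p ` Ob F p \<inter> {x \<in> Ob ?G p. \<beta> j p x = 0}"
        then obtain v where v: "v \<in> Ob F p" "x = \<alpha> j p v" "\<beta> j p (\<alpha> j p v) = 0" by auto
        have "\<alpha> j p 0 = 0" by (rule module_map_0[OF F vs \<alpha>[OF j] p])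
        moreover have "\<beta> j p 0 = 0" by (rule module_map_0[OF G(1)[OF j] vs \<beta>[OF j] p])
        ultimately have "v = 0"
          using inj_onD[OF bij_betw_imp_inj_on[OF \<beta>\<alpha>[OF p]], of v 0] v pm_closed(1)[OF F p] by simp
        then show "x \<in> {0}" using v \<open>\<alpha> j p 0 = 0\<close> by simp
      qed
      fix x assume x: "x \<in> Ob ?G p"
      obtain v where v: "v \<in> Ob F p" "\<beta> j p (\<alpha> j p v) = \<beta> j p x"
        using \<beta>\<alpha>surj[OF p module_mapD(1)[OF \<beta>[OF j] p x]] by blast
      have av: "\<alpha> j p v \<in> Ob ?G p" by (rule module_mapD(1)[OF \<alpha>[OF j] p v(1)])
      have "\<beta> j p (x - \<alpha> j p v) = 0"
        using module_map_diff[OF G(1)[OF j] \<beta>[OF j] p x av] v by simp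
      then have "x - \<alpha> j p v \<in> {x \<in> Ob ?G p. \<beta> j p x = 0}"
        using pm_closed(4)[OF G(1)[OF j] p x av] by simp
      moreover have "x = \<alpha> j p v + (x - \<alpha> j p v)" by simp
      moreover have "\<alpha> j p v \<in> \<alpha> j p ` Ob F p" using v(1) by (rule imageI)
      ultimately show "\<exists>u\<in>\<alpha> j p ` Ob F p. \<exists>w\<in>{x \<in> Ob ?G p. \<beta> j p x = 0}. x = u + w"
        by (intro bexI)
    qed
    from indecomposable_internal_sum[OF G[OF j] submodule_image[OF F G(1)[OF j] \<alpha>[OF j]]
      submodule_kernel[OF G(1)[OF j] F \<beta>[OF j]] this]
    show ?thesis
    proof
      assume 0: "\<forall>p\<in>P. \<alpha> j p ` Ob F p = {0}"
      have "zero_module P F" unfolding zero_module_def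
      proof
        fix p assume p: "p \<in> P"
        have "v = 0" if v: "v \<in> Ob F p" for v
        proof (rule \<alpha>inj[OF p v pm_closed(1)[OF F p]])
          have "\<alpha> j p v \<in> {0}" "\<alpha> j p 0 \<in> {0}"
            unfolding 0[rule_format, OF p, symmetric] using v pm_closed(1)[OF F p]
            by (auto intro: imageI)
          then show "\<alpha> j p v = \<alpha> j p 0" by simp
        qed
        then show "Ob F p = {0}" using pm_closed(1)[OF F p] by auto
      qed
      then show ?thesis using nz by blast
    qed
  qed
  have \<beta>bij: "bij_betw (\<beta> j p) (Ob ?G p) (Ob F p)" if p: "p \<in> P" for p
  proof (rule bij_betw_imageI)
    show "inj_on (\<beta> j p) (Ob ?G p)"
    proof (rule inj_onI)
      fix x y assume x: "x \<in> Ob ?G p" and y: "y \<in> Ob ?G p" and "\<beta> j p x = \<beta> j p y"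
      then have "x - y \<in> {x \<in> Ob ?G p. \<beta> j p x = 0}"
        using module_map_diff[OF G(1)[OF j] \<beta>[OF j] p x y] pm_closed(4)[OF G(1)[OF j] p x y] by simp
      then show "x = y" using \<beta>ker p by auto
    qed
    show "\<beta> j p ` Ob ?G p = Ob F p"
    proof
      show "\<beta> j p ` Ob ?G p \<subseteq> Ob F p" using module_mapD(1)[OF \<beta>[OF j] p] by auto
      show "Ob F p \<subseteq> \<beta> j p ` Ob ?G p"
      proof
        fix w assume "w \<in> Ob F p"
        then obtain v where "v \<in> Ob F p" "\<beta> j p (\<alpha> j p v) = w" using \<beta>\<alpha>surj[OF p] by blast
        then show "w \<in> \<beta> j p ` Ob ?G p" using module_mapD(1)[OF \<alpha>[OF j] p] by blast
      qed
    qed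
  qed
  have \<alpha>surj: "\<exists>v\<in>Ob F p. \<alpha> j p v = x" if p: "p \<in> P" and x: "x \<in> Ob ?G p" for p x
  proof -
    obtain v where v: "v \<in> Ob F p" "\<beta> j p (\<alpha> j p v) = \<beta> j p x"
      using \<beta>\<alpha>surj[OF p module_mapD(1)[OF \<beta>[OF j] p x]] by blast
    have "\<alpha> j p v = x"
      by (rule inj_onD[OF bij_betw_imp_inj_on[OF \<beta>bij[OF p]] v(2) module_mapD(1)[OF \<alpha>[OF j] p v(1)] x])
    then show ?thesis using v by blast
  qed
  have isoFG: "module_iso s s P F ?G"
    by (rule module_iso_sym[OF G(1)[OF j]])
      (unfold module_iso_iff, intro exI[of _ "\<beta> j"] conjI ballI \<beta>[OF j] \<beta>bij)
  let ?R = "direct_sum (remove_nth j Gs)"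
  define \<delta> where "\<delta> = (\<lambda>p y i. \<theta> p (insert_zero j y) (Suc i))"
  have rem: "\<forall>G\<in>set (remove_nth j Gs). persistence_module s P G"
    using Gs(1) by (auto simp: remove_nth_def dest: in_set_takeD in_set_dropD)
  note pmR = pm_direct_sum[OF vs rem]
  have shift: "module_map (pointwise s) (pointwise s) P (direct_sum (F # Fs)) (direct_sum Fs)
      (\<lambda>p g i. g (Suc i))"
  proof (rule module_mapI)
    show "(\<lambda>i. g (Suc i)) \<in> Ob (direct_sum Fs) p" if "g \<in> Ob (direct_sum (F # Fs)) p" for p g
      using that unfolding Ob_direct_sum by auto
  qed (auto simp: fun_eq_iff Mor_direct_sum pointwise_def)
  have ins: "insert_zero j y \<in> Ob (direct_sum Gs) p" if "p \<in> P" "y \<in> Ob ?R p" for p y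
    by (rule module_mapD(1)[OF module_map_insert_zero[OF Gs(1) j] that])
  have \<delta>: "module_map (pointwise s) (pointwise s) P ?R (direct_sum Fs) \<delta>"
    unfolding \<delta>_def
    by (rule module_map_comp[OF module_map_comp[OF module_map_insert_zero[OF Gs(1) j] \<theta>] shift])
  have "bij_betw (\<delta> p) (Ob ?R p) (Ob (direct_sum Fs) p)" if p: "p \<in> P" for p
  proof (rule bij_betw_imageI)
    show "inj_on (\<delta> p) (Ob ?R p)"
    proof (rule inj_onI)
      fix y y' assume y: "y \<in> Ob ?R p" and y': "y' \<in> Ob ?R p" and eq: "\<delta> p y = \<delta> p y'"
      let ?z = "insert_zero j y" and ?z' = "insert_zero j y'"
      note z = ins[OF p y] and z' = ins[OF p y']
      let ?x = "\<theta> p ?z" and ?x' = "\<theta> p ?z'"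
      have x: "?x \<in> Ob (direct_sum (F # Fs)) p" and x': "?x' \<in> Ob (direct_sum (F # Fs)) p"
        by (rule module_mapD(1)[OF \<theta> p z], rule module_mapD(1)[OF \<theta> p z'])
      have "?x (Suc i) = ?x' (Suc i)" for i using fun_cong[OF eq, of i] by (simp add: \<delta>_def)
      then have d: "?x - ?x' = single_entry 0 (?x 0 - ?x' 0)"
        unfolding fun_eq_iff by (auto simp: single_entry_def gr0_conv_Suc)
      have 0: "?x 0 \<in> Ob F p" "?x' 0 \<in> Ob F p"
        using module_mapD(1)[OF p0 p x] module_mapD(1)[OF p0 p x'] .
      have "\<eta> p (?x - ?x') = ?z - ?z'"
        using module_map_diff[OF pmF \<eta> p x x'] \<eta>\<theta>[OF p z] \<eta>\<theta>[OF p z'] by simp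
      then have "\<alpha> j p (?x 0 - ?x' 0) = (?z - ?z') j" unfolding \<alpha>_def by (simp add: d)
      also have "\<dots> = 0" by (simp add: insert_zero_def)
      also have "0 = \<alpha> j p 0" using module_map_0[OF F vs \<alpha>[OF j] p] by simp
      finally have "?x 0 - ?x' 0 = 0"
        by (rule \<alpha>inj[OF p pm_closed(4)[OF F p 0] pm_closed(1)[OF F p]])
      then have "?x - ?x' = 0" unfolding d by (simp add: single_entry_def fun_eq_iff)
      then have "?z - ?z' = 0" using \<open>\<eta> p (?x - ?x') = ?z - ?z'\<close> module_map_0[OF pmF vsp \<eta> p] by simp
      then show "y = y'" using insert_zero_inj by auto
    qed
    show "\<delta> p ` Ob ?R p = Ob (direct_sum Fs) p"
    proof
      show "\<delta> p ` Ob ?R p \<subseteq> Ob (direct_sum Fs) p" using module_mapD(1)[OF \<delta> p] by auto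
      show "Ob (direct_sum Fs) p \<subseteq> \<delta> p ` Ob ?R p"
      proof
        fix z assume z: "z \<in> Ob (direct_sum Fs) p"
        define x0 where "x0 = (\<lambda>i::nat. case i of 0 \<Rightarrow> 0 | Suc i \<Rightarrow> z i)"
        have x0: "x0 \<in> Ob (direct_sum (F # Fs)) p"
          using z pm_closed(1)[OF F p] unfolding Ob_direct_sum x0_def
          by (auto split: nat.split)
        have "\<eta> p x0 j \<in> Ob ?G p"
          using module_mapD(1)[OF \<eta> p x0] j by (simp add: Ob_direct_sum)
        then obtain v where v: "v \<in> Ob F p" "\<alpha> j p v = \<eta> p x0 j" using \<alpha>surj[OF p] by blast
        (* the entry in F is corrected so that the j-th entry of the image vanishes *)
        let ?x = "x0 - single_entry 0 v"
        note s = s0in[OF p v(1)]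
        have x: "?x \<in> Ob (direct_sum (F # Fs)) p" by (rule pm_closed(4)[OF pmF p x0 s])
        have "\<eta> p ?x j = 0"
          using module_map_diff[OF pmF \<eta> p x0 s] v by (simp add: \<alpha>_def)
        then obtain y where y: "y \<in> Ob ?R p" "insert_zero j y = \<eta> p ?x"
          using insert_zero_surj[OF j module_mapD(1)[OF \<eta> p x]] by blast
        have "\<delta> p y = z"
          unfolding \<delta>_def y(2) \<theta>\<eta>[OF p x] by (simp add: fun_eq_iff x0_def single_entry_def)
        then show "z \<in> \<delta> p ` Ob ?R p" using y(1) by blast
      qed
    qed
  qed
  then have "module_iso (pointwise s) (pointwise s) P ?R (direct_sum Fs)"
    unfolding module_iso_iff using \<delta> by (intro exI[of _ \<delta>] conjI ballI)
  then have "module_iso (pointwise s) (pointwise s) P (direct_sum Fs) ?R"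
    by (rule module_iso_sym[OF pmR])
  then show ?thesis using j isoFG by (intro exI[of _ j] conjI)
qed

lemma direct_sum_Nil_iso_imp_Nil:
  assumes s: "vector_space s"
    and Gs: "\<forall>G\<in>set Gs. persistence_module s P G" "\<forall>G\<in>set Gs. \<not> zero_module P G"
    and iso: "module_iso (pointwise s) (pointwise s) P (direct_sum []) (direct_sum Gs)"
  shows "Gs = []"
proof (rule ccontr)
  assume "Gs \<noteq> []"
  then have 0: "0 < length Gs" by simp
  have pmN: "persistence_module (pointwise s) P (direct_sum [])"
    by (rule pm_direct_sum[OF s]) simp
  have "zero_module P (direct_sum [])"
    unfolding zero_module_def by (auto simp: Ob_direct_sum fun_eq_iff)
  then have z: "zero_module P (direct_sum Gs)"
    by (rule zero_module_iso[OF pmN pm_direct_sum[OF s Gs(1)] iso])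
  have "zero_module P (Gs ! 0)" unfolding zero_module_def
  proof
    fix p assume p: "p \<in> P"
    have G0: "persistence_module s P (Gs ! 0)" using Gs(1) 0 by simp
    have "v = 0" if v: "v \<in> Ob (Gs ! 0) p" for v
    proof -
      have "single_entry 0 v \<in> Ob (direct_sum Gs) p"
        by (rule single_entry_in_direct_sum[OF Gs(1) 0 p v])
      then have "single_entry 0 v = 0" using z p by (simp add: zero_module_def)
      from fun_cong[OF this, of 0] show ?thesis by (simp add: single_entry_def)
    qed
    then show "Ob (Gs ! 0) p = {0}" using pm_closed(1)[OF G0 p] by auto
  qed
  then show False using Gs(2) 0 by simp
qed

text \<open>
  Summands are exchanged one at a time; the list \<open>Hs\<close> is \<open>Gs\<close> rearranged so that it matches \<open>Fs\<close>.
\<close>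

theorem krull_schmidt:
  assumes P: "finite P" and s: "vector_space s"
    and Fs: "\<forall>F\<in>set Fs. persistence_module s P F \<and> \<not> zero_module P F \<and> indecomposable s P F"
    and Gs: "\<forall>G\<in>set Gs. persistence_module s P G \<and> \<not> zero_module P G \<and> indecomposable s P G"
    and iso: "module_iso (pointwise s) (pointwise s) P (direct_sum Fs) (direct_sum Gs)"
  shows "\<exists>Hs. mset Hs = mset Gs \<and> list_all2 (module_iso s s P) Fs Hs"
  using Fs Gs iso
proof (induction Fs arbitrary: Gs)
  case Nil
  have "Gs = []" by (rule direct_sum_Nil_iso_imp_Nil[OF s _ _ Nil(3)]) (use Nil(2) in simp_all)
  then show ?case by simp
next
  case (Cons F Fs)
  have "\<exists>j<length Gs. module_iso s s P F (Gs ! j) \<and>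
    module_iso (pointwise s) (pointwise s) P (direct_sum Fs) (direct_sum (remove_nth j Gs))"
    by (rule krull_schmidt_exchange[OF P _ _ _ _ _ _ Cons.prems(3)]) (use Cons.prems(1,2) in simp_all)
  then obtain j where j: "j < length Gs" "module_iso s s P F (Gs ! j)"
    and iso: "module_iso (pointwise s) (pointwise s) P (direct_sum Fs) (direct_sum (remove_nth j Gs))"
    by (elim exE conjE)
  have "set (remove_nth j Gs) \<subseteq> set Gs"
    by (auto simp: remove_nth_def dest: in_set_takeD in_set_dropD)
  then have "\<exists>Hs. mset Hs = mset (remove_nth j Gs) \<and> list_all2 (module_iso s s P) Fs Hs"
    using Cons.prems(1,2) by (intro Cons.IH iso) (simp_all add: subset_iff)
  then obtain Hs where "mset Hs = mset (remove_nth j Gs)" "list_all2 (module_iso s s P) Fs Hs"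
    by (elim exE conjE)
  then show ?case
    using j mset_remove_nth[OF j(1)] by (intro exI[of _ "Gs ! j # Hs"]) simp
qed

lemma decomposes_into_count:
  assumes P: "finite P" and F: "persistence_module s P F"
    and Fs: "decomposes_into s P F Fs" and Gs: "decomposes_into s P F Gs"
    and Q: "\<And>A B. persistence_module s P A \<Longrightarrow> module_iso s s P A B \<Longrightarrow> Q A \<longleftrightarrow> Q B"
  shows "length (filter Q Fs) = length (filter Q Gs)"
proof -
  have s: "vector_space s" by (rule pm_vs[OF F])
  have "module_iso (pointwise s) (pointwise s) P (direct_sum Fs) (direct_sum Gs)"
    using module_iso_trans[OF module_iso_sym[OF F]] Fs Gs unfolding decomposes_into_def by blast
  then obtain Hs where Hs: "mset Hs = mset Gs" "list_all2 (module_iso s s P) Fs Hs"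
    using krull_schmidt[OF P s] Fs Gs unfolding decomposes_into_def by blast
  have "\<forall>A\<in>set Fs. persistence_module s P A" using Fs by (simp add: decomposes_into_def)
  with Hs(2) have "length (filter Q Fs) = length (filter Q Hs)"
    by (induction rule: list_all2_induct) (simp_all add: Q)
  also have "\<dots> = size (filter_mset Q (mset Hs))" by (metis mset_filter size_mset)
  also have "\<dots> = length (filter Q Gs)" unfolding Hs(1) by (metis mset_filter size_mset)
  finally show ?thesis .
qed

lemma decomposes_into_iso:
  assumes "module_iso s s P F G" "decomposes_into s P G Fs"
  shows "decomposes_into s P F Fs"
  using assms module_iso_trans unfolding decomposes_into_def by blast

lemma decomposes_into_append:
  assumes A: "persistence_module s P A" and B: "persistence_module s P B"
    and F: "module_iso s (pointwise s) P F (direct_sum [A, B])"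
    and As: "decomposes_into s P A As" and Bs: "decomposes_into s P B Bs"
  shows "decomposes_into s P F (As @ Bs)"
proof -
  have "module_iso (pointwise s) (pointwise s) P (direct_sum [A, B]) (direct_sum (As @ Bs))"
    using As Bs by (intro direct_sum_append_iso[OF A B]) (simp_all add: decomposes_into_def)
  from module_iso_trans[OF F this] show ?thesis
    using As Bs unfolding decomposes_into_def by auto
qed

lemma decomposes_into_singleton:
  assumes "persistence_module s P F" "\<not> zero_module P F" "indecomposable s P F"
  shows "decomposes_into s P F [F]"
  using assms direct_sum_singleton_iso unfolding decomposes_into_def by auto

text \<open>
  A decomposition into modules that are given abstractly is pulled back to submodules of \<open>F\<close>, namely
  the kernels of the two components of the isomorphism.  Dimensions can then be compared inside \<open>F\<close>.
\<close>

lemma not_indecomposable_internal_sum: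
  assumes F: "persistence_module s P F" and ni: "\<not> indecomposable s P F"
  shows "\<exists>U W. submodule s P F U \<and> submodule s P F W \<and> internal_sum P F U W \<and>
    (\<exists>p\<in>P. U p \<noteq> {0}) \<and> (\<exists>p\<in>P. W p \<noteq> {0})"
proof -
  obtain F1 F2 where F1: "persistence_module s P F1" "\<not> zero_module P F1"
    and F2: "persistence_module s P F2" "\<not> zero_module P F2"
    and iso: "module_iso s (pointwise s) P F (direct_sum [F1, F2])"
    using ni unfolding indecomposable_def by blast
  have pm: "\<forall>F\<in>set [F1, F2]. persistence_module s P F" using F1 F2 by simp
  note s = pm_vs[OF F]
  note pmD = pm_direct_sum[OF s pm]
  obtain \<eta> where \<eta>: "module_map s (pointwise s) P F (direct_sum [F1, F2]) \<eta>"
    and bij: "\<And>p. p \<in> P \<Longrightarrow> bij_betw (\<eta> p) (Ob F p) (Ob (direct_sum [F1, F2]) p)"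
    using iso unfolding module_iso_iff by blast
  have ob: "g \<in> Ob (direct_sum [F1, F2]) p \<longleftrightarrow> g 0 \<in> Ob F1 p \<and> g 1 \<in> Ob F2 p \<and> (\<forall>i\<ge>2. g i = 0)" for g p
    by (rule Ob_direct_sum_pair)
  have pr0: "module_map s s P F F1 (\<lambda>p x. \<eta> p x 0)"
    using module_map_comp[OF \<eta> module_map_proj[of 0 "[F1, F2]"]] by simp
  have pr1: "module_map s s P F F2 (\<lambda>p x. \<eta> p x 1)"
    using module_map_comp[OF \<eta> module_map_proj[of 1 "[F1, F2]"]] by simp
  let ?U = "\<lambda>p. {x \<in> Ob F p. \<eta> p x 1 = 0}" and ?W = "\<lambda>p. {x \<in> Ob F p. \<eta> p x 0 = 0}"
  have preim: "\<exists>x\<in>Ob F p. \<eta> p x = g" if "p \<in> P" "g \<in> Ob (direct_sum [F1, F2]) p" for p g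
    by (rule bij_betw_preimage[OF bij[OF that(1)] that(2)])
  have \<eta>0: "x = 0" if "p \<in> P" "x \<in> Ob F p" "\<eta> p x = 0" for p x
    using inj_onD[OF bij_betw_imp_inj_on[OF bij[OF that(1)]], of x 0] that
      module_map_0[OF F vector_space_pointwise[OF s] \<eta> that(1)] pm_closed(1)[OF F that(1)] by simp
  have "internal_sum P F ?U ?W" unfolding internal_sum_def
  proof (intro ballI conjI)
    fix p assume p: "p \<in> P"
    show "?U p \<inter> ?W p \<subseteq> {0}"
    proof
      fix x assume "x \<in> ?U p \<inter> ?W p"
      then have x: "x \<in> Ob F p" "\<eta> p x 0 = 0" "\<eta> p x 1 = 0" by auto
      have "\<eta> p x \<in> Ob (direct_sum [F1, F2]) p" by (rule module_mapD(1)[OF \<eta> p x(1)])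
      then have "\<eta> p x i = 0" for i
        using x(2,3) by (cases "i = 0"; cases "i = 1") (auto simp: ob)
      then show "x \<in> {0}" using \<eta>0[OF p x(1)] by (auto simp: fun_eq_iff)
    qed
    fix x assume x: "x \<in> Ob F p"
    have g: "\<eta> p x \<in> Ob (direct_sum [F1, F2]) p" by (rule module_mapD(1)[OF \<eta> p x])
    then have "single_entry 0 (\<eta> p x 0) \<in> Ob (direct_sum [F1, F2]) p"
      using pm_closed(1)[OF F2(1) p] by (auto simp: ob single_entry_def)
    from preim[OF p this] obtain u where u: "u \<in> Ob F p" "\<eta> p u = single_entry 0 (\<eta> p x 0)"
      by (elim bexE)
    have d: "\<eta> p (x - u) = \<eta> p x - \<eta> p u" by (rule module_map_diff[OF F \<eta> p x u(1)])
    have "u \<in> ?U p" using u by (simp add: single_entry_def)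
    moreover have "x - u \<in> ?W p"
      using pm_closed(4)[OF F p x u(1)] d u(2) by (simp add: single_entry_def)
    moreover have "x = u + (x - u)" by simp
    ultimately show "\<exists>u\<in>?U p. \<exists>w\<in>?W p. x = u + w" by (intro bexI)
  qed
  moreover have "\<exists>p\<in>P. ?U p \<noteq> {0}"
  proof -
    obtain p v where p: "p \<in> P" and v: "v \<in> Ob F1 p" "v \<noteq> 0"
      using F1 pm_closed(1)[OF F1(1)] unfolding zero_module_def by blast
    have "single_entry 0 v \<in> Ob (direct_sum [F1, F2]) p"
      using v pm_closed(1)[OF F2(1) p] by (auto simp: ob single_entry_def)
    from preim[OF p this] obtain x where x: "x \<in> Ob F p" "\<eta> p x = single_entry 0 v" by (elim bexE)
    have "x \<noteq> 0"
      using module_map_0[OF F s pr0 p] x v by (auto simp: single_entry_def)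
    moreover have "x \<in> ?U p" using x by (simp add: single_entry_def)
    ultimately show ?thesis using p by blast
  qed
  moreover have "\<exists>p\<in>P. ?W p \<noteq> {0}"
  proof -
    obtain p v where p: "p \<in> P" and v: "v \<in> Ob F2 p" "v \<noteq> 0"
      using F2 pm_closed(1)[OF F2(1)] unfolding zero_module_def by blast
    have "single_entry 1 v \<in> Ob (direct_sum [F1, F2]) p"
      using v pm_closed(1)[OF F1(1) p] by (auto simp: ob single_entry_def)
    from preim[OF p this] obtain x where x: "x \<in> Ob F p" "\<eta> p x = single_entry 1 v" by (elim bexE)
    have "x \<noteq> 0"
      using module_map_0[OF F s pr1 p] x v by (auto simp: single_entry_def)
    moreover have "x \<in> ?W p" using x by (simp add: single_entry_def)
    ultimately show ?thesis using p by blast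
  qed
  ultimately show ?thesis
    using submodule_kernel[OF F F1(1) pr0] submodule_kernel[OF F F2(1) pr1]
    by (intro exI[of _ ?U] exI[of _ ?W] conjI)
qed

lemma internal_sum_dim_less:
  assumes P: "finite P" and F: "persistence_module s P F"
    and U: "submodule s P F U" and W: "submodule s P F W" and UW: "internal_sum P F U W"
    and nz: "\<exists>p\<in>P. W p \<noteq> {0}"
  shows "(\<Sum>p\<in>P. vector_space.dim s (U p)) < (\<Sum>p\<in>P. vector_space.dim s (Ob F p))"
proof (rule sum_strict_mono_ex1[OF P])
  note s = pm_vs[OF F]
  have sub: "module.subspace s (U p)" "U p \<subseteq> Ob F p" "module.subspace s (W p)" "W p \<subseteq> Ob F p"
    if "p \<in> P" for p using U W that by (auto simp: submodule_def)
  show "\<forall>p\<in>P. vector_space.dim s (U p) \<le> vector_space.dim s (Ob F p)"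
  proof
    fix p assume p: "p \<in> P"
    obtain B where "finite B" "Ob F p = module.span s B" using pm_fin[OF F p] by blast
    then show "vector_space.dim s (U p) \<le> vector_space.dim s (Ob F p)"
      using vector_space.dim_le_subspace[OF s, of B "U p" "Ob F p"] sub[OF p] pm_subspace[OF F p] by simp
  qed
  obtain p where p: "p \<in> P" "W p \<noteq> {0}" using nz by blast
  have "0 \<in> W p" using module.subspace_0[OF vs_module[OF s] sub(3)[OF p(1)]] .
  then obtain w where w: "w \<in> W p" "w \<noteq> 0" using p(2) by blast
  have "U p \<inter> W p \<subseteq> {0}" using UW p(1) by (simp add: internal_sum_def)
  then have "w \<notin> U p" using w by auto
  moreover have "w \<in> Ob F p" using sub(4)[OF p(1)] w(1) by auto
  ultimately have "U p \<subset> Ob F p" using sub(2)[OF p(1)] by auto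
  moreover obtain B where "finite B" "Ob F p = module.span s B" using pm_fin[OF F p(1)] by blast
  ultimately have "vector_space.dim s (U p) < vector_space.dim s (Ob F p)"
    using vector_space.dim_less_subspace[OF s, of B "U p" "Ob F p"] sub[OF p(1)] pm_subspace[OF F p(1)]
    by simp
  then show "\<exists>p\<in>P. vector_space.dim s (U p) < vector_space.dim s (Ob F p)" using p(1) by blast
qed

lemma internal_sum_commute:
  assumes "internal_sum P F U W" shows "internal_sum P F W U"
  unfolding internal_sum_def
proof (intro ballI conjI)
  fix p assume p: "p \<in> P"
  show "W p \<inter> U p \<subseteq> {0}" using assms p by (auto simp: internal_sum_def)
  fix x assume "x \<in> Ob F p"
  then have "\<exists>u\<in>U p. \<exists>w\<in>W p. x = u + w" using assms p by (simp add: internal_sum_def)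
  then obtain u w where "u \<in> U p" "w \<in> W p" "x = u + w" by (elim bexE)
  then show "\<exists>w\<in>W p. \<exists>u\<in>U p. x = w + u" by (intro bexI[of _ w] bexI[of _ u]) (simp_all add: add.commute)
qed

text \<open>
  Induction on the total dimension, which drops in both parts of a nontrivial internal sum.
\<close>

theorem decomposes_into_exists:
  assumes P: "finite P" and F: "persistence_module s P F"
  shows "\<exists>Fs. decomposes_into s P F Fs"
  using F
proof (induction "\<Sum>p\<in>P. vector_space.dim s (Ob F p)" arbitrary: F rule: less_induct)
  case less
  note F = less.prems
  consider "zero_module P F" | "\<not> zero_module P F" "indecomposable s P F" | "\<not> indecomposable s P F"
    by blast
  then show ?case
  proof cases
    case 1
    then have "decomposes_into s P F []"
      using direct_sum_Nil_iso[OF F] by (simp add: decomposes_into_def)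
    then show ?thesis by blast
  next
    case 2
    then show ?thesis using decomposes_into_singleton[OF F] by blast
  next
    case 3
    then obtain U W where U: "submodule s P F U" and W: "submodule s P F W"
      and UW: "internal_sum P F U W" and nz: "\<exists>p\<in>P. U p \<noteq> {0}" "\<exists>p\<in>P. W p \<noteq> {0}"
      using not_indecomposable_internal_sum[OF F] by blast
    obtain As where As: "decomposes_into s P (F\<lparr>Ob := U\<rparr>) As"
      using less.hyps[OF _ pm_submodule[OF F U]] internal_sum_dim_less[OF P F U W UW nz(2)] by auto
    obtain Bs where Bs: "decomposes_into s P (F\<lparr>Ob := W\<rparr>) Bs"
      using less.hyps[OF _ pm_submodule[OF F W]]
        internal_sum_dim_less[OF P F W U internal_sum_commute[OF UW] nz(1)] by auto
    from decomposes_into_append[OF pm_submodule[OF F U] pm_submodule[OF F W]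
        internal_sum_iso[OF F U W UW] As Bs]
    show ?thesis by blast
  qed
qed

lemma is_interval_module_iso:
  assumes "persistence_module s P A" "module_iso s s P A B"
  shows "is_interval_module s P A \<longleftrightarrow> is_interval_module s P B"
  using module_iso_trans[OF assms(2)] module_iso_trans[OF module_iso_sym[OF assms]]
  unfolding is_interval_module_def by blast

lemma num_eqI:
  assumes P: "finite P" and F: "persistence_module s P F" and Fs: "decomposes_into s P F Fs"
  shows "num_summands s P F = length Fs"
    and "num_intervals s P F = length (filter (is_interval_module s P) Fs)"
proof -
  have dec: "decomposes_into s P F (decomposition s P F)"
    unfolding decomposition_def by (rule someI[of "decomposes_into s P F", OF Fs])
  show "num_summands s P F = length Fs"
    using decomposes_into_count[OF P F dec Fs, of "\<lambda>_. True"] by (simp add: num_summands_def)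
  show "num_intervals s P F = length (filter (is_interval_module s P) Fs)"
    using decomposes_into_count[OF P F dec Fs is_interval_module_iso] by (simp add: num_intervals_def)
qed

text \<open>
  Nonzero vectors chosen in the different summands at \<open>p\<close> correspond to independent vectors of \<open>F\<close> at \<open>p\<close>.
\<close>

lemma length_decomposition_le:
  assumes F: "persistence_module s P F" and dec: "decomposes_into s P F Fs"
    and p: "p \<in> P" and B: "finite B" "Ob F p \<subseteq> module.span s B"
    and nz: "\<And>i. i < length Fs \<Longrightarrow> Ob (Fs ! i) p \<noteq> {0}"
  shows "length Fs \<le> card B"
proof -
  note s = pm_vs[OF F]
  interpret vector_space s by (rule s)
  have pmFs: "\<forall>F\<in>set Fs. persistence_module s P F" using dec by (simp add: decomposes_into_def)
  note pmD = pm_direct_sum[OF s pmFs]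
  obtain \<theta> where \<theta>: "module_map (pointwise s) s P (direct_sum Fs) F \<theta>"
    and bij: "\<And>p. p \<in> P \<Longrightarrow> bij_betw (\<theta> p) (Ob (direct_sum Fs) p) (Ob F p)"
    using dec module_iso_sym[OF F] unfolding decomposes_into_def module_iso_iff by blast
  have "\<forall>i. \<exists>v. i < length Fs \<longrightarrow> v \<in> Ob (Fs ! i) p \<and> v \<noteq> 0"
  proof
    fix i show "\<exists>v. i < length Fs \<longrightarrow> v \<in> Ob (Fs ! i) p \<and> v \<noteq> 0"
      using nz[of i] pm_closed(1)[of s P "Fs ! i" p] pmFs p by (cases "i < length Fs") auto
  qed
  from choice[OF this] obtain v where v: "\<And>i. i < length Fs \<Longrightarrow> v i \<in> Ob (Fs ! i) p \<and> v i \<noteq> 0" by blast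
  define w where "w = (\<lambda>i. \<theta> p (single_entry i (v i)))"
  have se: "single_entry i (s c (v i)) \<in> Ob (direct_sum Fs) p" if "i < length Fs" for i c
    using single_entry_in_direct_sum[OF pmFs that p] pm_closed(3)[of s P "Fs ! i" p] pmFs v[OF that] p that
    by simp
  have comb0: "\<forall>i<length Fs. c i = 0" if "(\<Sum>i<length Fs. s (c i) (w i)) = 0" for c
  proof -
    have ps: "pointwise s (c i) (single_entry i (v i)) = single_entry i (s (c i) (v i))" for i
      by (auto simp: pointwise_def single_entry_def fun_eq_iff scale_zero_right)
    have e1: "single_entry i (v i) \<in> Ob (direct_sum Fs) p" if "i < length Fs" for i
      using se[OF that, of 1] by simp
    have "\<theta> p (\<Sum>i<length Fs. single_entry i (s (c i) (v i))) = (\<Sum>i<length Fs. \<theta> p (single_entry i (s (c i) (v i))))"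
      by (rule module_map_sum[OF pmD s \<theta> p]) (simp add: se)
    also have "\<dots> = (\<Sum>i<length Fs. s (c i) (w i))"
    proof (rule sum.cong)
      fix i assume "i \<in> {..<length Fs}"
      then show "\<theta> p (single_entry i (s (c i) (v i))) = s (c i) (w i)"
        using module_mapD(3)[OF \<theta> p e1, of i "c i"] by (simp add: ps w_def)
    qed simp
    also have "\<dots> = \<theta> p 0" using that module_map_0[OF pmD s \<theta> p] by simp
    finally have "(\<Sum>i<length Fs. single_entry i (s (c i) (v i))) = 0"
      by (rule inj_onD[OF bij_betw_imp_inj_on[OF bij[OF p]]])
        (auto intro!: pm_sum[OF pmD p] se pm_closed(1)[OF pmD p])
    then have "(\<Sum>i<length Fs. single_entry i (s (c i) (v i)) k) = 0" for k
      by (metis sum_apply zero_fun_apply)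
    note sum0 = this
    have "s (c k) (v k) = 0" if "k < length Fs" for k
      using sum0[of k] that by (simp add: single_entry_def)
    then show ?thesis using v by simp
  qed
  have wB: "w ` {..<length Fs} \<subseteq> span B"
    using B(2) module_mapD(1)[OF \<theta> p] se[of _ 1] unfolding w_def by auto
  have inj: "inj_on w {..<length Fs}"
  proof (rule inj_onI, rule ccontr)
    fix i j assume ij: "i \<in> {..<length Fs}" "j \<in> {..<length Fs}" "w i = w j" "i \<noteq> j"
    define c where "c = (\<lambda>k. if k = i then 1 else if k = j then -1 else 0 :: 'a)"
    have "(\<Sum>k<length Fs. s (c k) (w k)) = (\<Sum>k\<in>{i, j}. s (c k) (w k))"
      using ij by (intro sum.mono_neutral_right) (auto simp: c_def)
    also have "\<dots> = 0" using ij by (simp add: c_def)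
    finally have "c i = 0" using comb0 ij by blast
    then show False by (simp add: c_def)
  qed
  have "independent (w ` {..<length Fs})"
    unfolding independent_explicit_finite_subsets
  proof (intro allI impI ballI)
    fix A u v assume A: "A \<subseteq> w ` {..<length Fs}" "finite A" "(\<Sum>v\<in>A. s (u v) v) = 0" and vA: "v \<in> A"
    define c where "c = (\<lambda>i. if w i \<in> A then u (w i) else 0)"
    have "(\<Sum>i<length Fs. s (c i) (w i)) = (\<Sum>x\<in>w ` {..<length Fs}. s (if x \<in> A then u x else 0) x)"
      by (simp add: sum.reindex[OF inj] c_def)
    also have "\<dots> = (\<Sum>x\<in>A. s (if x \<in> A then u x else 0) x)"
      using A by (intro sum.mono_neutral_right) auto
    also have "\<dots> = 0" using A(3) by simp
    finally have "\<forall>i<length Fs. c i = 0" by (rule comb0)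
    moreover obtain i where "i < length Fs" "v = w i" using A(1) vA by auto
    ultimately show "u v = 0" using vA by (auto simp: c_def)
  qed
  from independent_span_bound[OF B(1) this wB] show ?thesis by (simp add: card_image[OF inj])
qed

section \<open>Transport along an isomorphism of posets\<close>

definition order_iso :: "'p::order set \<Rightarrow> 'q::order set \<Rightarrow> ('p \<Rightarrow> 'q) \<Rightarrow> ('q \<Rightarrow> 'p) \<Rightarrow> bool" where
  "order_iso P Q \<psi> \<kappa> \<longleftrightarrow>
     (\<forall>p\<in>P. \<psi> p \<in> Q \<and> \<kappa> (\<psi> p) = p) \<and> (\<forall>q\<in>Q. \<kappa> q \<in> P \<and> \<psi> (\<kappa> q) = q) \<and>
     (\<forall>p\<in>P. \<forall>p'\<in>P. p \<le> p' \<longleftrightarrow> \<psi> p \<le> \<psi> p')"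

lemma order_isoD:
  assumes "order_iso P Q \<psi> \<kappa>"
  shows "p \<in> P \<Longrightarrow> \<psi> p \<in> Q" "p \<in> P \<Longrightarrow> \<kappa> (\<psi> p) = p" "q \<in> Q \<Longrightarrow> \<kappa> q \<in> P" "q \<in> Q \<Longrightarrow> \<psi> (\<kappa> q) = q"
    "p \<in> P \<Longrightarrow> p' \<in> P \<Longrightarrow> p \<le> p' \<longleftrightarrow> \<psi> p \<le> \<psi> p'"
  using assms unfolding order_iso_def by auto

lemma order_iso_sym: "order_iso P Q \<psi> \<kappa> \<Longrightarrow> order_iso Q P \<kappa> \<psi>"
  unfolding order_iso_def by simp

text \<open>
  Restriction of a diagram along a map of index sets.  The posets of two samples of the same order
  type are isomorphic but not equal, so their modules are compared after such a restriction.
\<close>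

definition pullback :: "('p \<Rightarrow> 'q) \<Rightarrow> ('q, 'x) diagram \<Rightarrow> ('p, 'x) diagram" where
  "pullback \<psi> F = \<lparr>Ob = (\<lambda>p. Ob F (\<psi> p)), Mor = (\<lambda>p q. Mor F (\<psi> p) (\<psi> q))\<rparr>"

lemma pullback_sel [simp]: "Ob (pullback \<psi> F) p = Ob F (\<psi> p)"
  "Mor (pullback \<psi> F) p q = Mor F (\<psi> p) (\<psi> q)"
  by (simp_all add: pullback_def)

lemma pullback_direct_sum: "pullback \<psi> (direct_sum Fs) = direct_sum (map (pullback \<psi>) Fs)"
  unfolding pullback_def direct_sum_def
  by (auto simp: fun_eq_iff set_eq_iff)

lemma pm_pullback:
  assumes o: "order_iso P Q \<psi> \<kappa>" and F: "persistence_module s Q F"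
  shows "persistence_module s P (pullback \<psi> F)"
  unfolding persistence_module_def functor_on_def
proof (intro conjI ballI impI)
  show "vector_space s" by (rule pm_vs[OF F])
  fix p assume p: "p \<in> P"
  show "\<exists>B. finite B \<and> Ob (pullback \<psi> F) p = module.span s B"
    using pm_fin[OF F order_isoD(1)[OF o p]] by simp
  show "Mor (pullback \<psi> F) p p x = x" if "x \<in> Ob (pullback \<psi> F) p" for x
    using pm_functor(1)[OF F order_isoD(1)[OF o p]] that by simp
  fix q assume q: "q \<in> P" and pq: "p \<le> q"
  have m: "\<psi> p \<in> Q" "\<psi> q \<in> Q" "\<psi> p \<le> \<psi> q" using order_isoD[OF o] p q pq by simp_all
  show "Mor (pullback \<psi> F) p q ` Ob (pullback \<psi> F) p \<subseteq> Ob (pullback \<psi> F) q"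
    using pm_Mor_map(1)[OF F m] by auto
  show "linear_between s s (Ob (pullback \<psi> F) p) (Ob (pullback \<psi> F) q) (Mor (pullback \<psi> F) p q)"
    unfolding linear_between_def by (simp add: pm_Mor_map[OF F m])
  fix r x assume r: "r \<in> P" "q \<le> r" and x: "x \<in> Ob (pullback \<psi> F) p"
  have m2: "\<psi> r \<in> Q" "\<psi> q \<le> \<psi> r" using order_isoD[OF o] q r by simp_all
  show "Mor (pullback \<psi> F) p r x = Mor (pullback \<psi> F) q r (Mor (pullback \<psi> F) p q x)"
    using pm_functor(2)[OF F m(1,2) m2(1) m(3) m2(2)] x by simp
qed

lemma module_iso_pullback:
  assumes o: "order_iso P Q \<psi> \<kappa>" and "module_iso s t Q F G"
  shows "module_iso s t P (pullback \<psi> F) (pullback \<psi> G)"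
proof -
  obtain \<eta> where \<eta>: "module_map s t Q F G \<eta>" "\<forall>q\<in>Q. bij_betw (\<eta> q) (Ob F q) (Ob G q)"
    using assms(2) unfolding module_iso_iff by blast
  have "module_map s t P (pullback \<psi> F) (pullback \<psi> G) (\<lambda>p. \<eta> (\<psi> p))"
  proof (rule module_mapI)
    fix p assume p: "p \<in> P"
    note p' = order_isoD(1)[OF o p]
    show "\<eta> (\<psi> p) x \<in> Ob (pullback \<psi> G) p" if "x \<in> Ob (pullback \<psi> F) p" for x
      using module_mapD(1)[OF \<eta>(1) p'] that by simp
    show "\<eta> (\<psi> p) (x + y) = \<eta> (\<psi> p) x + \<eta> (\<psi> p) y"
      if "x \<in> Ob (pullback \<psi> F) p" "y \<in> Ob (pullback \<psi> F) p" for x y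
      using module_mapD(2)[OF \<eta>(1) p'] that by simp
    show "\<eta> (\<psi> p) (s c x) = t c (\<eta> (\<psi> p) x)" if "x \<in> Ob (pullback \<psi> F) p" for c x
      using module_mapD(3)[OF \<eta>(1) p'] that by simp
    fix q x assume q: "q \<in> P" "p \<le> q" "x \<in> Ob (pullback \<psi> F) p"
    have "\<psi> q \<in> Q" "\<psi> p \<le> \<psi> q" using order_isoD[OF o] p q by simp_all
    then show "\<eta> (\<psi> q) (Mor (pullback \<psi> F) p q x) = Mor (pullback \<psi> G) p q (\<eta> (\<psi> p) x)"
      using module_mapD(4)[OF \<eta>(1) p'] q by simp
  qed
  moreover have "\<forall>p\<in>P. bij_betw (\<eta> (\<psi> p)) (Ob (pullback \<psi> F) p) (Ob (pullback \<psi> G) p)"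
    using \<eta>(2) order_isoD(1)[OF o] by simp
  ultimately show ?thesis unfolding module_iso_iff by (intro exI[of _ "\<lambda>p. \<eta> (\<psi> p)"] conjI)
qed

lemma module_iso_agree:
  assumes "\<And>p. p \<in> P \<Longrightarrow> Ob F p = Ob G p"
    and "\<And>p q x. p \<in> P \<Longrightarrow> q \<in> P \<Longrightarrow> p \<le> q \<Longrightarrow> x \<in> Ob F p \<Longrightarrow> Mor F p q x = Mor G p q x"
  shows "module_iso s s P F G"
  unfolding module_iso_def
  by (rule exI[of _ "\<lambda>_ x. x"]) (use assms in \<open>simp add: linear_between_def bij_betw_def\<close>)

lemma pullback_pullback_iso:
  assumes o: "order_iso P Q \<psi> \<kappa>"
  shows "module_iso s s Q G (pullback \<kappa> (pullback \<psi> G))"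
  by (rule module_iso_agree) (simp_all add: order_isoD[OF o])

lemma indecomposable_pullback:
  assumes o: "order_iso P Q \<psi> \<kappa>" and G: "indecomposable s Q G"
  shows "indecomposable s P (pullback \<psi> G)"
  unfolding indecomposable_def
proof (intro allI impI)
  fix F1 F2 assume F: "persistence_module s P F1" "persistence_module s P F2"
    and iso: "module_iso s (pointwise s) P (pullback \<psi> G) (direct_sum [F1, F2])"
  note o' = order_iso_sym[OF o]
  have "module_iso s (pointwise s) Q (pullback \<kappa> (pullback \<psi> G)) (direct_sum [pullback \<kappa> F1, pullback \<kappa> F2])"
    using module_iso_pullback[OF o' iso] by (simp add: pullback_direct_sum)
  from module_iso_trans[OF pullback_pullback_iso[OF o] this]
  have "zero_module Q (pullback \<kappa> F1) \<or> zero_module Q (pullback \<kappa> F2)"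
    using G[unfolded indecomposable_def, rule_format, OF pm_pullback[OF o' F(1)] pm_pullback[OF o' F(2)]]
    by simp
  then show "zero_module P F1 \<or> zero_module P F2"
    unfolding zero_module_def using order_isoD(1,2)[OF o] by (metis pullback_sel(1))
qed

lemma decomposes_into_pullback:
  assumes o: "order_iso P Q \<psi> \<kappa>" and dec: "decomposes_into s Q F Fs"
  shows "decomposes_into s P (pullback \<psi> F) (map (pullback \<psi>) Fs)"
proof -
  have nz: "\<not> zero_module P (pullback \<psi> G)" if "\<not> zero_module Q G" for G :: "('b, 'd) diagram"
    using that order_isoD(3,4)[OF o] unfolding zero_module_def by (metis pullback_sel(1))
  have iso: "module_iso s (pointwise s) P (pullback \<psi> F) (direct_sum (map (pullback \<psi>) Fs))"
    using dec module_iso_pullback[OF o, of s "pointwise s" F "direct_sum Fs"]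
    by (simp add: decomposes_into_def pullback_direct_sum)
  show ?thesis
    unfolding decomposes_into_def
  proof (intro conjI ballI iso)
    fix H assume "H \<in> set (map (pullback \<psi>) Fs)"
    then obtain G where H: "H = pullback \<psi> G" and "G \<in> set Fs" by auto
    then have G: "persistence_module s Q G" "\<not> zero_module Q G" "indecomposable s Q G"
      using dec by (simp_all add: decomposes_into_def)
    show "persistence_module s P H" unfolding H by (rule pm_pullback[OF o G(1)])
    show "\<not> zero_module P H" unfolding H by (rule nz[OF G(2)])
    show "indecomposable s P H" unfolding H by (rule indecomposable_pullback[OF o G(3)])
  qed
qed

lemma poset_interval_preimage:
  assumes o: "order_iso P Q \<psi> \<kappa>" and I: "poset_interval Q I"
  shows "poset_interval P {p \<in> P. \<psi> p \<in> I}"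
proof -
  have IQ: "I \<subseteq> Q" using I by (simp add: poset_interval_def)
  let ?R = "{(a, b). a \<in> I \<and> b \<in> I \<and> (a \<le> b \<or> b \<le> a)}"
  let ?J = "{p \<in> P. \<psi> p \<in> I}"
  let ?R' = "{(a, b). a \<in> ?J \<and> b \<in> ?J \<and> (a \<le> b \<or> b \<le> a)}"
  have \<kappa>: "\<kappa> a \<in> ?J" if "a \<in> I" for a using that IQ order_isoD(3,4)[OF o] by auto
  have path: "(\<kappa> a, \<kappa> b) \<in> ?R'\<^sup>*" if "(a, b) \<in> ?R\<^sup>*" for a b
    using that
  proof (induction rule: rtrancl_induct)
    case (step y z)
    then have "y \<in> Q" "z \<in> Q" using IQ by auto
    then have "(\<kappa> y, \<kappa> z) \<in> ?R'"
      using step(2) \<kappa>[of y] \<kappa>[of z] order_isoD(5)[OF order_iso_sym[OF o], of y z]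
        order_isoD(5)[OF order_iso_sym[OF o], of z y] by auto
    then show ?case using step(3) by (rule rtrancl_into_rtrancl[rotated])
  qed simp
  show ?thesis unfolding poset_interval_def
  proof (intro conjI ballI impI)
    show "?J \<subseteq> P" by auto
    have "I \<noteq> {}" using I by (simp add: poset_interval_def)
    then show "?J \<noteq> {}" using \<kappa> by fast
    show "poset_connected ?J" unfolding poset_connected_def
    proof (intro ballI)
      fix i j assume "i \<in> ?J" "j \<in> ?J"
      then have ij: "\<psi> i \<in> I" "\<psi> j \<in> I" "\<kappa> (\<psi> i) = i" "\<kappa> (\<psi> j) = j"
        using order_isoD(2)[OF o] by auto
      have con: "\<forall>i\<in>I. \<forall>j\<in>I. (i, j) \<in> ?R\<^sup>*"
        using I unfolding poset_interval_def poset_connected_def by (elim conjE)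
      from path[OF con[rule_format, OF ij(1,2)]] show "(i, j) \<in> ?R'\<^sup>*" unfolding ij(3,4) .
    qed
    fix i j l assume *: "i \<in> ?J" "j \<in> ?J" "l \<in> P" "i \<le> l" "l \<le> j"
    have conv: "\<forall>i\<in>I. \<forall>j\<in>I. \<forall>l\<in>Q. i \<le> l \<longrightarrow> l \<le> j \<longrightarrow> l \<in> I"
      using I unfolding poset_interval_def by (elim conjE)
    have "\<psi> i \<le> \<psi> l" "\<psi> l \<le> \<psi> j"
      using * order_isoD(5)[OF o, of i l] order_isoD(5)[OF o, of l j] by simp_all
    then have "\<psi> l \<in> I"
      using conv[rule_format, of "\<psi> i" "\<psi> j" "\<psi> l"] * order_isoD(1)[OF o] by simp
    then show "l \<in> ?J" using * by simp
  qed
qed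

lemma is_interval_module_pullbackI:
  fixes s :: "'k::field \<Rightarrow> 'v::ab_group_add \<Rightarrow> 'v" and P :: "'p::order set" and Q :: "'q::order set"
  assumes o: "order_iso P Q \<psi> \<kappa>" and "is_interval_module s Q G"
  shows "is_interval_module s P (pullback \<psi> G)"
proof -
  obtain I where I: "poset_interval Q I" "module_iso s (*) Q G (interval_module I)"
    using assms(2)[unfolded is_interval_module_def] by (elim exE conjE)
  have "module_iso (*) (*) P (pullback \<psi> (interval_module I :: ('q, 'k) diagram))
      (interval_module {p \<in> P. \<psi> p \<in> I})"
    by (rule module_iso_agree) (simp_all add: interval_module_def)
  from module_iso_trans[OF module_iso_pullback[OF o I(2)] this]
  show ?thesis
    unfolding is_interval_module_def
    by (intro exI[of _ "{p \<in> P. \<psi> p \<in> I}"] conjI poset_interval_preimage[OF o I(1)])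
qed

lemma is_interval_module_pullback:
  assumes o: "order_iso P Q \<psi> \<kappa>" and G: "persistence_module s Q G"
  shows "is_interval_module s P (pullback \<psi> G) \<longleftrightarrow> is_interval_module s Q G"
proof
  assume "is_interval_module s P (pullback \<psi> G)"
  then have "is_interval_module s Q (pullback \<kappa> (pullback \<psi> G))"
    by (rule is_interval_module_pullbackI[OF order_iso_sym[OF o]])
  then show "is_interval_module s Q G"
    using is_interval_module_iso[OF G pullback_pullback_iso[OF o]] by simp
qed (rule is_interval_module_pullbackI[OF o])

lemma num_pullback:
  assumes P: "finite P" "finite Q" and o: "order_iso P Q \<psi> \<kappa>"
    and F: "persistence_module s P F" and G: "persistence_module s Q G"
    and iso: "module_iso s s P F (pullback \<psi> G)"
  shows "num_summands s P F = num_summands s Q G" "num_intervals s P F = num_intervals s Q G"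
proof -
  obtain Gs where Gs: "decomposes_into s Q G Gs" using decomposes_into_exists[OF P(2) G] by blast
  have d: "decomposes_into s P F (map (pullback \<psi>) Gs)"
    by (rule decomposes_into_iso[OF iso decomposes_into_pullback[OF o Gs]])
  show "num_summands s P F = num_summands s Q G"
    using num_eqI(1)[OF P(1) F d] num_eqI(1)[OF P(2) G Gs] by simp
  have "length (filter (is_interval_module s P \<circ> pullback \<psi>) Gs) = length (filter (is_interval_module s Q) Gs)"
    using is_interval_module_pullback[OF o] Gs
    by (intro arg_cong[of _ _ length] filter_cong) (auto simp: decomposes_into_def)
  then show "num_intervals s P F = num_intervals s Q G"
    using num_eqI(2)[OF P(1) F d] num_eqI(2)[OF P(2) G Gs] by (simp add: filter_map)
qed

section \<open>Cyclic modules and the number of summands\<close>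

text \<open>
  Everything in a module generated at \<open>b\<close> is the image of an element at \<open>b\<close>.  If \<open>U b\<close> is zero, that
  element lies in \<open>W b\<close>, so its images lie in \<open>W\<close>.
\<close>

lemma internal_sum_zero_summand:
  assumes G: "persistence_module s P G" and b: "b \<in> P"
    and gen: "\<And>p. p \<in> P \<Longrightarrow> Ob G p \<noteq> {0} \<Longrightarrow> b \<le> p \<and> Ob G p \<subseteq> Mor G b p ` Ob G b"
    and U: "submodule s P G U" and W: "submodule s P G W" and UW: "internal_sum P G U W"
    and Ub: "U b = {0}" and p: "p \<in> P"
  shows "U p = {0}"
proof -
  have 0: "0 \<in> U p"
    using U p module.subspace_0[OF vs_module[OF pm_vs[OF G]]] by (simp add: submodule_def)
  have "x = 0" if x: "x \<in> U p" for x
  proof (rule ccontr)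
    assume "x \<noteq> 0"
    have xG: "x \<in> Ob G p" using U p x by (auto simp: submodule_def)
    then have bp: "b \<le> p" and "Ob G p \<subseteq> Mor G b p ` Ob G b" using gen[OF p] \<open>x \<noteq> 0\<close> by auto
    then obtain y where y: "y \<in> Ob G b" "x = Mor G b p y" using xG by auto
    have "\<exists>u\<in>U b. \<exists>w\<in>W b. y = u + w" using UW b y(1) by (simp add: internal_sum_def)
    then have "y \<in> W b" using Ub by auto
    then have "x \<in> W p" using W b p bp y(2) unfolding submodule_def by blast
    moreover have "U p \<inter> W p \<subseteq> {0}" using UW p by (simp add: internal_sum_def)
    ultimately show False using x \<open>x \<noteq> 0\<close> by auto
  qed
  then show ?thesis using 0 by auto
qed

text \<open>
  At \<open>b\<close> there is room for only one of the two summands, and a summand that vanishes at \<open>b\<close> vanishes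
  everywhere.
\<close>

lemma indecomposable_if_cyclic:
  assumes G: "persistence_module s P G" and b: "b \<in> P"
    and one: "\<And>x. x \<in> Ob G b \<Longrightarrow> \<exists>c. x = s c v"
    and gen: "\<And>p. p \<in> P \<Longrightarrow> Ob G p \<noteq> {0} \<Longrightarrow> b \<le> p \<and> Ob G p \<subseteq> Mor G b p ` Ob G b"
  shows "indecomposable s P G"
proof (rule ccontr)
  assume "\<not> indecomposable s P G"
  from not_indecomposable_internal_sum[OF G this]
  obtain U W where U: "submodule s P G U" and W: "submodule s P G W" and UW: "internal_sum P G U W"
    and nz: "\<exists>p\<in>P. U p \<noteq> {0}" "\<exists>p\<in>P. W p \<noteq> {0}" by (elim exE conjE)
  interpret vector_space s by (rule pm_vs[OF G])
  have sU: "subspace (U b)" "U b \<subseteq> Ob G b" and sW: "subspace (W b)" "W b \<subseteq> Ob G b"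
    using U W b by (auto simp: submodule_def)
  have "U b \<noteq> {0}"
    using internal_sum_zero_summand[OF G b gen U W UW] nz(1) by blast
  then obtain u where u: "u \<in> U b" "u \<noteq> 0" using subspace_0[OF sU(1)] by blast
  have "W b \<noteq> {0}"
    using internal_sum_zero_summand[OF G b gen W U internal_sum_commute[OF UW]] nz(2) by blast
  then obtain w where w: "w \<in> W b" "w \<noteq> 0" using subspace_0[OF sW(1)] by blast
  obtain c where c: "u = s c v" using one u sU by blast
  obtain c' where c': "w = s c' v" using one w sW by blast
  have "c \<noteq> 0" using c u by auto
  then have "w = s (c' / c) u" by (simp add: c c')
  then have "w \<in> U b" using subspace_scale[OF sU(1) u(1)] by simp
  moreover have "U b \<inter> W b \<subseteq> {0}" using UW b by (simp add: internal_sum_def)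
  ultimately show False using w by auto
qed

text \<open>
  Below every \<open>p\<close> there is a point \<open>b\<close> from which the map to \<open>p\<close> is onto and the map to \<open>p0\<close> is
  injective.  A direct summand inherits both properties, so if it is nonzero at \<open>p\<close>, it is nonzero
  at \<open>b\<close> and hence at \<open>p0\<close>.
\<close>

lemma num_summands_le:
  assumes P: "finite P" and F: "persistence_module s P F" and p0: "p0 \<in> P"
    and B: "finite B" "Ob F p0 \<subseteq> module.span s B"
    and ex: "\<And>p. p \<in> P \<Longrightarrow> \<exists>b\<in>P. b \<le> p \<and> b \<le> p0 \<and> Ob F p \<subseteq> Mor F b p ` Ob F b \<and>
      (\<forall>x\<in>Ob F b. Mor F b p0 x = 0 \<longrightarrow> x = 0)"
  shows "num_summands s P F \<le> card B"
proof -
  obtain Fs where Fs: "decomposes_into s P F Fs" using decomposes_into_exists[OF P F] by blast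
  have pm: "\<forall>G\<in>set Fs. persistence_module s P G" using Fs by (simp add: decomposes_into_def)
  note s = pm_vs[OF F]
  note pmD = pm_direct_sum[OF s pm]
  obtain \<eta> where \<eta>: "module_map s (pointwise s) P F (direct_sum Fs) \<eta>"
    and bij: "\<And>p. p \<in> P \<Longrightarrow> bij_betw (\<eta> p) (Ob F p) (Ob (direct_sum Fs) p)"
    using Fs unfolding decomposes_into_def module_iso_iff by blast
  have preim: "\<exists>x\<in>Ob F p. \<eta> p x = g" if "p \<in> P" "g \<in> Ob (direct_sum Fs) p" for p g
    by (rule bij_betw_preimage[OF bij[OF that(1)] that(2)])
  have nz: "Ob (Fs ! i) p0 \<noteq> {0}" if i: "i < length Fs" for i
  proof
    assume z: "Ob (Fs ! i) p0 = {0}"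
    have Gi: "persistence_module s P (Fs ! i)" using pm i by simp
    have "\<not> zero_module P (Fs ! i)" using Fs i by (simp add: decomposes_into_def)
    then obtain p where p: "p \<in> P" "Ob (Fs ! i) p \<noteq> {0}" by (auto simp: zero_module_def)
    then obtain v where v: "v \<in> Ob (Fs ! i) p" "v \<noteq> 0" using pm_closed(1)[OF Gi p(1)] by blast
    from ex[OF p(1)] obtain b where b: "b \<in> P" "b \<le> p" "b \<le> p0"
      and surj: "Ob F p \<subseteq> Mor F b p ` Ob F b" and inj: "\<forall>x\<in>Ob F b. Mor F b p0 x = 0 \<longrightarrow> x = 0"
      by (elim bexE conjE)
    obtain x where x: "x \<in> Ob F p" "\<eta> p x = single_entry i v"
      using preim[OF p(1) single_entry_in_direct_sum[OF pm i p(1) v(1)]] by (elim bexE)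
    obtain y where y: "y \<in> Ob F b" "x = Mor F b p y" using surj x(1) by auto
    have "single_entry i v = Mor (direct_sum Fs) b p (\<eta> b y)"
      using module_mapD(4)[OF \<eta> b(1) p(1) b(2) y(1)] x y by simp
    from fun_cong[OF this, of i] have v': "v = Mor (Fs ! i) b p (\<eta> b y i)"
      using i by (simp add: Mor_direct_sum single_entry_def)
    define u where "u = \<eta> b y i"
    have u: "u \<in> Ob (Fs ! i) b"
      using module_mapD(1)[OF \<eta> b(1) y(1)] i by (simp add: u_def Ob_direct_sum)
    have "u \<noteq> 0" using v v' pm_Mor_0[OF Gi b(1) p(1) b(2)] by (auto simp: u_def)
    obtain x' where x': "x' \<in> Ob F b" "\<eta> b x' = single_entry i u"
      using preim[OF b(1) single_entry_in_direct_sum[OF pm i b(1) u]] by (elim bexE)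
    have "Mor (Fs ! i) b p0 u = 0" using pm_Mor_map(1)[OF Gi b(1) p0 b(3) u] z by simp
    then have "Mor (direct_sum Fs) b p0 (single_entry i u) = 0"
      using pm_Mor_0[of s P _ b p0] pm b p0
      by (simp add: fun_eq_iff Mor_direct_sum single_entry_def)
    then have "\<eta> p0 (Mor F b p0 x') = \<eta> p0 0"
      using module_mapD(4)[OF \<eta> b(1) p0 b(3) x'(1)] x'(2)
        module_map_0[OF F vector_space_pointwise[OF s] \<eta> p0] by simp
    then have "Mor F b p0 x' = 0"
      by (rule inj_onD[OF bij_betw_imp_inj_on[OF bij[OF p0]] _ pm_Mor_map(1)[OF F b(1) p0 b(3) x'(1)]
          pm_closed(1)[OF F p0]])
    then have "x' = 0" using inj x'(1) by simp
    then have "single_entry i u = 0"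
      using x'(2) module_map_0[OF F vector_space_pointwise[OF s] \<eta> b(1)] by simp
    from fun_cong[OF this, of i] show False using \<open>u \<noteq> 0\<close> by (simp add: single_entry_def)
  qed
  have "length Fs \<le> card B" by (rule length_decomposition_le[OF F Fs p0 B nz])
  then show ?thesis using num_eqI(1)[OF P F Fs] by simp
qed

section \<open>The linearized density-Rips persistent set\<close>

definition rips_class :: "'a::metric_space set \<Rightarrow> real \<Rightarrow> 'a \<Rightarrow> 'a set" where
  "rips_class N \<epsilon> x = rips_connected N dist \<epsilon> `` {x}"

lemma equiv_rips_dist: "equiv N (rips_connected N (dist :: 'a::metric_space \<Rightarrow> _) \<epsilon>)"
  by (rule equiv_rips_connected[OF Met_TC.Metric_space_axioms]) simp

lemma rips_class_self: "x \<in> N \<Longrightarrow> x \<in> rips_class N \<epsilon> x"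
  unfolding rips_class_def by (rule equiv_class_self[OF equiv_rips_dist])

lemma rips_class_subset: "rips_class N \<epsilon> x \<subseteq> N"
  by (auto simp: rips_class_def rips_connected_def)

lemma rips_class_eq:
  "y \<in> rips_class N \<epsilon> x \<Longrightarrow> rips_class N \<epsilon> y = rips_class N \<epsilon> x"
  unfolding rips_class_def using equiv_class_eq[OF equiv_rips_dist] by (metis Image_singleton_iff)

lemma rips_class_edge: "x \<in> N \<Longrightarrow> y \<in> N \<Longrightarrow> dist x y \<le> \<epsilon> \<Longrightarrow> y \<in> rips_class N \<epsilon> x"
  unfolding rips_class_def rips_connected_def by (auto simp: rips_edges_def)

lemma rips_class_isolated:
  assumes x: "x \<in> N" and far: "\<And>z. z \<in> N \<Longrightarrow> z \<noteq> x \<Longrightarrow> \<epsilon> < dist x z"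
  shows "rips_class N \<epsilon> x = {x}"
proof -
  have "y = x" if "(x, y) \<in> (rips_edges N dist \<epsilon>)\<^sup>*" for y
    using that
  proof (induction rule: rtrancl_induct)
    case (step y z)
    then have "z \<in> N" "dist x z \<le> \<epsilon>" by (auto simp: rips_edges_def)
    then show ?case using far[of z] by force
  qed simp
  then show ?thesis
    using rips_class_self[OF x, of \<epsilon>] unfolding rips_class_def rips_connected_def by blast
qed

locale augmented_metric_space =
  fixes M :: "'a::metric_space set" and f :: "'a \<Rightarrow> real"
  assumes fin: "finite M"
begin

abbreviation poset :: "(real \<times> real) set" where "poset \<equiv> density_rips_poset M dist f"
abbreviation Rips :: "(real \<times> real, 'a set) diagram" where "Rips \<equiv> density_rips M dist f"

definition component :: "real \<times> real \<Rightarrow> 'a \<Rightarrow> 'a set" where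
  "component p x = rips_class (sublevel M f (snd p)) (fst p) x"

lemma finite_poset: "finite poset"
proof -
  have "{dist x y |x y. x \<in> M \<and> y \<in> M} = (\<lambda>(x, y). dist x y) ` (M \<times> M)" by auto
  then show ?thesis using fin by (simp add: density_rips_poset_def)
qed

lemma in_poset: "x \<in> M \<Longrightarrow> y \<in> M \<Longrightarrow> z \<in> M \<Longrightarrow> (dist x y, f z) \<in> poset"
  unfolding density_rips_poset_def by auto

lemma in_poset_0: assumes "x \<in> M" shows "(0, f x) \<in> poset"
  using in_poset[OF assms assms assms] by simp

lemma in_posetE:
  assumes "p \<in> poset"
  obtains x y z where "x \<in> M" "y \<in> M" "z \<in> M" "p = (dist x y, f z)"
  using assms unfolding density_rips_poset_def by auto

lemma Ob_Rips: "Ob Rips p = component p ` sublevel M f (snd p)"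
  by (cases p) (auto simp: density_rips_def component_def rips_class_def quotient_def)

lemma finite_Ob_Rips: "finite (Ob Rips p)"
  unfolding Ob_Rips by (rule finite_imageI) (use fin in \<open>simp add: sublevel_def\<close>)

lemma Mor_Rips:
  assumes "p \<le> q" "x \<in> sublevel M f (snd p)"
  shows "Mor Rips p q (component p x) = component q x"
proof -
  have le: "fst p \<le> fst q" "snd p \<le> snd q" using assms(1) by (auto simp: less_eq_prod_def)
  then have "sublevel M f (snd p) \<subseteq> sublevel M f (snd q)" by (auto simp: sublevel_def)
  then have "rips_connected (sublevel M f (snd p)) dist (fst p)
      \<subseteq> rips_connected (sublevel M f (snd q)) dist (fst q)"
    using le by (intro rips_connected_mono)
  then have "rips_connected (sublevel M f (snd q)) dist (fst q) `` component p x = component q x"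
    unfolding component_def rips_class_def by (intro Image_class[OF equiv_rips_dist equiv_rips_dist _ assms(2)])
  then show ?thesis by (cases q) (simp add: density_rips_def)
qed

lemma component_self: "x \<in> sublevel M f (snd p) \<Longrightarrow> x \<in> component p x"
  unfolding component_def by (rule rips_class_self)

lemma component_eq: "y \<in> component p x \<Longrightarrow> component p y = component p x"
  unfolding component_def by (rule rips_class_eq)

lemma component_0:
  assumes "x \<in> sublevel M f (snd p)" "fst p = 0"
  shows "component p x = {x}"
  unfolding component_def by (rule rips_class_isolated[OF assms(1)]) (simp add: assms(2))

lemma persistent_set_Rips: "persistent_set poset Rips"
proof (rule persistent_set_density_rips[OF fin])
  show "Metric_space M dist" by (rule Met_TC.subspace) simp
qed

end

definition basis_vec :: "'x \<Rightarrow> 'x \<Rightarrow> 'k::field" where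
  "basis_vec C = (\<lambda>D. if D = C then 1 else 0)"

lemma Ob_linearization: "g \<in> Ob (linearization S) p \<longleftrightarrow> (\<forall>C. C \<notin> Ob S p \<longrightarrow> g C = 0)"
  by (simp add: linearization_def)

lemma basis_vec_in: "C \<in> Ob S p \<Longrightarrow> basis_vec C \<in> Ob (linearization S) p"
  by (auto simp: Ob_linearization basis_vec_def)

lemma Mor_basis_vec:
  assumes "finite (Ob S p)" "C \<in> Ob S p"
  shows "Mor (linearization S) p q (basis_vec C) = basis_vec (Mor S p q C)"
proof
  fix D
  have "Mor (linearization S) p q (basis_vec C) D = (\<Sum>x\<in>{x \<in> Ob S p. Mor S p q x = D}. if x = C then 1 else 0)"
    by (simp add: linearization_def basis_vec_def)
  also have "\<dots> = basis_vec (Mor S p q C) D"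
    using assms by (auto simp: basis_vec_def)
  finally show "Mor (linearization S) p q (basis_vec C) D = basis_vec (Mor S p q C) D" .
qed

lemma linearization_sum_basis:
  assumes "finite (Ob S p)" "g \<in> Ob (linearization S) p"
  shows "g = (\<Sum>C\<in>Ob S p. pointwise (*) (g C) (basis_vec C))"
proof
  fix D
  have "(\<Sum>C\<in>Ob S p. pointwise (*) (g C) (basis_vec C) D) = (\<Sum>C\<in>Ob S p. if D = C then g C else 0)"
    by (intro sum.cong) (auto simp: pointwise_def basis_vec_def)
  also have "\<dots> = g D" using assms by (auto simp: Ob_linearization)
  finally show "g D = (\<Sum>C\<in>Ob S p. pointwise (*) (g C) (basis_vec C)) D" by (simp add: sum_apply)
qed

lemma vector_space_pointwise_mult: "vector_space (pointwise (*) :: 'k::field \<Rightarrow> ('x \<Rightarrow> 'k) \<Rightarrow> _)"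
  by (intro vector_space_pointwise vector_space_mult)

context augmented_metric_space
begin

lemma pm_LRips: "persistence_module (pointwise (*)) poset (linearization Rips :: (real \<times> real, 'a set \<Rightarrow> 'k::field) diagram)"
  by (rule persistence_module_linearization[OF persistent_set_Rips])

text \<open>
  The criterion \<open>num_summands_le\<close> applies with \<open>b = (0, \<sigma>)\<close> below \<open>p = (\<epsilon>, \<sigma>)\<close> and
  \<open>p0 = (0, max f)\<close>: at \<open>\<epsilon> = 0\<close> all components are single points, every component at \<open>p\<close> contains
  one of them, and different points stay different at \<open>p0\<close>.
\<close>

lemma num_summands_le_card:
  "num_summands (pointwise (*)) poset (linearization Rips :: (real \<times> real, 'a set \<Rightarrow> 'k::field) diagram)
    \<le> card M"
proof (cases "M = {}")
  let ?L = "linearization Rips :: (real \<times> real, 'a set \<Rightarrow> 'k) diagram"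
  have pmL: "persistence_module (pointwise (*)) poset ?L" by (rule pm_LRips)
  case True
  then have P: "poset = {}" by (simp add: density_rips_poset_def)
  obtain Fs where Fs: "decomposes_into (pointwise (*)) poset ?L Fs"
    using decomposes_into_exists[OF finite_poset pmL] by (elim exE)
  have "Fs = []"
  proof (rule ccontr)
    assume "Fs \<noteq> []"
    then have "\<not> zero_module poset (hd Fs)" using Fs by (simp add: decomposes_into_def)
    then show False by (simp add: P zero_module_def)
  qed
  then show ?thesis using num_eqI(1)[OF finite_poset pmL Fs] by simp
next
  case False
  let ?L = "linearization Rips :: (real \<times> real, 'a set \<Rightarrow> 'k) diagram"
  have pmL: "persistence_module (pointwise (*)) poset ?L" by (rule pm_LRips)
  have "Max (f ` M) \<in> f ` M" using fin False by simp
  then obtain m where m1: "m \<in> M" "Max (f ` M) = f m" by (elim imageE)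
  have "f x \<le> f m" if "x \<in> M" for x unfolding m1(2)[symmetric] using fin that by simp
  note m = m1(1) this
  define p0 where "p0 = (0 :: real, f m)"
  have p0: "p0 \<in> poset" unfolding p0_def by (rule in_poset_0[OF m(1)])
  let ?B = "basis_vec ` Ob Rips p0 :: ('a set \<Rightarrow> 'k) set"
  have "num_summands (pointwise (*)) poset ?L \<le> card ?B"
  proof (rule num_summands_le[OF finite_poset pmL p0])
    show "finite ?B" by (intro finite_imageI finite_Ob_Rips)
    show "Ob ?L p0 \<subseteq> module.span (pointwise (*)) ?B"
    proof
      fix g :: "'a set \<Rightarrow> 'k" assume g: "g \<in> Ob ?L p0"
      interpret V: vector_space "pointwise (*) :: 'k \<Rightarrow> ('a set \<Rightarrow> 'k) \<Rightarrow> _"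
        by (rule vector_space_pointwise_mult)
      have "(\<Sum>C\<in>Ob Rips p0. pointwise (*) (g C) (basis_vec C)) \<in> V.span ?B"
        by (intro V.span_sum V.span_scale V.span_base imageI)
      then show "g \<in> V.span ?B" using linearization_sum_basis[OF finite_Ob_Rips g] by simp
    qed
    fix p assume p: "p \<in> poset"
    then obtain x y z where xyz: "x \<in> M" "y \<in> M" "z \<in> M" "p = (dist x y, f z)" by (rule in_posetE)
    define b where "b = (0 :: real, f z)"
    have b: "b \<in> poset" unfolding b_def by (rule in_poset_0[OF xyz(3)])
    have bp: "b \<le> p" "b \<le> p0" using m(2)[OF xyz(3)] by (simp_all add: b_def p0_def xyz(4))
    have sb: "snd b = snd p" "fst b = 0" by (simp_all add: b_def xyz(4))
    have clb: "component b w = {w}" if "w \<in> sublevel M f (snd p)" for w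
      using component_0[of w b] that by (simp add: sb)
    have Obb: "Ob Rips b = (\<lambda>w. {w}) ` sublevel M f (snd p)"
      unfolding Ob_Rips sb(1) using clb by (intro image_cong) simp_all
    have mor: "Mor Rips b q {w} = component q w" if "b \<le> q" "w \<in> sublevel M f (snd p)" for q w
      using Mor_Rips[of b q w] that clb[of w] by (simp add: sb)
    have surj: "Ob ?L p \<subseteq> Mor ?L b p ` Ob ?L b"
    proof
      fix g assume g: "g \<in> Ob ?L p"
      have "\<exists>w. w \<in> sublevel M f (snd p) \<and> component p w = C" if "C \<in> Ob Rips p" for C
        using that unfolding Ob_Rips by auto
      then obtain r where r: "\<And>C. C \<in> Ob Rips p \<Longrightarrow> r C \<in> sublevel M f (snd p) \<and> component p (r C) = C"
        by metis
      have rb: "{r C} \<in> Ob Rips b" "Mor Rips b p {r C} = C" if "C \<in> Ob Rips p" for C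
        using r[OF that] mor[OF bp(1)] by (simp_all add: Obb)
      (* a preimage of g: move each coefficient to a representative r C of the component *)
      define h where "h = (\<Sum>C\<in>Ob Rips p. pointwise (*) (g C) (basis_vec {r C}))"
      have h: "h \<in> Ob ?L b" unfolding h_def
        by (intro pm_sum[OF pmL b] pm_closed(3)[OF pmL b] basis_vec_in rb(1))
      have "Mor ?L b p h = g"
      proof
        fix D
        have "Mor ?L b p h D =
            (\<Sum>E\<in>{E \<in> Ob Rips b. Mor Rips b p E = D}. \<Sum>C\<in>Ob Rips p. if E = {r C} then g C else 0)"
          by (auto simp: linearization_def h_def sum_apply pointwise_def basis_vec_def intro!: sum.cong)
        also have "\<dots> = (\<Sum>C\<in>Ob Rips p. \<Sum>E\<in>{E \<in> Ob Rips b. Mor Rips b p E = D}. if E = {r C} then g C else 0)"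
          by (rule sum.swap)
        also have "\<dots> = (\<Sum>C\<in>Ob Rips p. if D = C then g C else 0)"
        proof (rule sum.cong)
          fix C assume C: "C \<in> Ob Rips p"
          have "(\<Sum>E\<in>{E \<in> Ob Rips b. Mor Rips b p E = D}. if E = {r C} then g C else 0) =
            (if {r C} \<in> {E \<in> Ob Rips b. Mor Rips b p E = D} then g C else 0)"
            using finite_Ob_Rips[of b] by (intro sum.delta) simp
          then show "(\<Sum>E\<in>{E \<in> Ob Rips b. Mor Rips b p E = D}. if E = {r C} then g C else 0) =
            (if D = C then g C else 0)" using rb[OF C] by auto
        qed simp
        also have "\<dots> = g D" using g finite_Ob_Rips[of p] by (auto simp: Ob_linearization)
        finally show "Mor ?L b p h D = g D" .
      qed
      then show "g \<in> Mor ?L b p ` Ob ?L b" using h by (intro image_eqI[of _ _ h]) simp_all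
    qed
    have inj: "x = 0" if x: "x \<in> Ob ?L b" "Mor ?L b p0 x = 0" for x :: "'a set \<Rightarrow> 'k"
    proof
      fix E show "x E = 0 E"
      proof (cases "E \<in> Ob Rips b")
        case True
        then obtain w where w: "w \<in> sublevel M f (snd p)" "E = {w}" unfolding Obb by auto
        have "Mor Rips b p0 {v} = {v}" if "v \<in> sublevel M f (snd p)" for v
          using mor[OF bp(2) that] component_0[of v p0] that m(2) by (auto simp: p0_def sublevel_def)
        then have "{E' \<in> Ob Rips b. Mor Rips b p0 E' = E} = {E}"
          using w True unfolding Obb by auto
        moreover have "Mor ?L b p0 x E = (\<Sum>E'\<in>{E' \<in> Ob Rips b. Mor Rips b p0 E' = E}. x E')"
          by (simp add: linearization_def)
        ultimately have "Mor ?L b p0 x E = x E" by simp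
        then show ?thesis using that(2) by simp
      qed (use x(1) in \<open>simp add: Ob_linearization\<close>)
    qed
    show "\<exists>b\<in>poset. b \<le> p \<and> b \<le> p0 \<and> Ob ?L p \<subseteq> Mor ?L b p ` Ob ?L b \<and>
        (\<forall>x\<in>Ob ?L b. Mor ?L b p0 x = 0 \<longrightarrow> x = 0)"
      using b bp surj inj by (intro bexI[of _ b] conjI ballI impI) simp_all
  qed
  also have "\<dots> \<le> card (Ob Rips p0)" by (rule card_image_le[OF finite_Ob_Rips])
  also have "\<dots> \<le> card (sublevel M f (snd p0))"
    unfolding Ob_Rips by (rule card_image_le) (use fin in \<open>simp add: sublevel_def\<close>)
  also have "\<dots> \<le> card M" by (rule card_mono[OF fin]) (auto simp: sublevel_def)
  finally show ?thesis .
qed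

section \<open>Points with a nearest neighbour of smaller function value\<close>

text \<open>
  Let \<open>I x\<close> be the set of bidegrees at which \<open>x\<close> is present and still isolated, \<open>A x\<close> the submodule
  spanned by \<open>[x] - [nn x]\<close> on \<open>I x\<close>, and \<open>R Z\<close> the submodule of the elements whose coefficient at
  \<open>{x}\<close> vanishes on \<open>I x\<close> for all \<open>x \<in> Z\<close>.  For \<open>x \<notin> Z\<close> the module \<open>R Z\<close> is the internal sum of
  \<open>A x\<close> and \<open>R (insert x Z)\<close>: subtracting a multiple of \<open>[x] - [nn x]\<close> clears the coefficient at \<open>{x}\<close>,
  and it does not affect the coefficients at other points of \<open>X\<close> because \<open>nn x \<notin> X\<close>.  Starting
  from \<open>R {}\<close>, the whole module, one interval module per point of \<open>X\<close> is split off.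
\<close>

lemma num_intervals_ge_card:
  fixes nn :: "'a \<Rightarrow> 'a"
  assumes X: "X \<subseteq> M"
    and nn: "\<And>x. x \<in> X \<Longrightarrow> nn x \<in> M - X" "\<And>x. x \<in> X \<Longrightarrow> f (nn x) \<le> f x"
      "\<And>x z. x \<in> X \<Longrightarrow> z \<in> M \<Longrightarrow> z \<noteq> x \<Longrightarrow> dist x (nn x) \<le> dist x z"
  shows "card X \<le> num_intervals (pointwise (*)) poset
    (linearization Rips :: (real \<times> real, 'a set \<Rightarrow> 'k::field) diagram)"
proof -
  let ?s = "pointwise (*) :: 'k \<Rightarrow> ('a set \<Rightarrow> 'k) \<Rightarrow> _"
  let ?L = "linearization Rips :: (real \<times> real, 'a set \<Rightarrow> 'k) diagram"
  interpret V: vector_space ?s by (rule vector_space_pointwise_mult)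
  have pmL: "persistence_module ?s poset ?L" by (rule pm_LRips)
  define I where "I = (\<lambda>x. {p \<in> poset. fst p < dist x (nn x) \<and> f x \<le> snd p})"
  define a where "a = (\<lambda>x p. basis_vec {x} - basis_vec (component p (nn x)) :: 'a set \<Rightarrow> 'k)"
  define A where "A = (\<lambda>x p. if p \<in> I x then range (\<lambda>c. ?s c (a x p)) else {0})"
  define R where "R = (\<lambda>Z p. {g \<in> Ob ?L p. \<forall>x\<in>Z. p \<in> I x \<longrightarrow> g {x} = 0})"
  have nx: "nn x \<noteq> x" "0 < dist x (nn x)" if "x \<in> X" for x using nn(1)[OF that] that by auto
  have sub: "x \<in> sublevel M f (snd p)" "nn x \<in> sublevel M f (snd p)"
    if "x \<in> X" "f x \<le> snd p" for x p
    using that X nn(1,2)[OF that(1)] by (auto simp: sublevel_def)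
  have clx: "component p x = {x}" if "x \<in> X" "p \<in> I x" for x p
    unfolding component_def
  proof (rule rips_class_isolated)
    show "x \<in> sublevel M f (snd p)" using sub(1)[OF that(1), of p] that(2) by (simp add: I_def)
    fix z assume "z \<in> sublevel M f (snd p)" "z \<noteq> x"
    then have "dist x (nn x) \<le> dist x z" using nn(3)[OF that(1)] by (simp add: sublevel_def)
    then show "fst p < dist x z" using that(2) by (simp add: I_def)
  qed
  have cln: "component p (nn x) \<noteq> {x'}" if "x \<in> X" "x' \<in> X" "p \<in> I x" for x x' p
    using component_self[OF sub(2), of x p] that nn(1)[OF that(1)] by (auto simp: I_def)
  have a_in: "a x p \<in> Ob ?L p" if "x \<in> X" "p \<in> I x" for x p
  proof -
    have "{x} \<in> Ob Rips p" "component p (nn x) \<in> Ob Rips p"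
      using clx[OF that] sub[OF that(1)] that(2) unfolding Ob_Rips by (auto simp: I_def)
    moreover have "p \<in> poset" using that(2) by (simp add: I_def)
    ultimately show ?thesis unfolding a_def by (intro pm_closed(4)[OF pmL] basis_vec_in)
  qed
  have a_x: "a x p {x'} = (if x' = x then 1 else 0)" if "x \<in> X" "x' \<in> X" "p \<in> I x" for x x' p
    using cln[OF that] by (auto simp: a_def basis_vec_def)
  have A_in: "A x p \<subseteq> Ob ?L p" if "x \<in> X" "p \<in> poset" for x p
    using a_in[OF that(1), of p] pm_closed[OF pmL that(2)] by (auto simp: A_def)
  have Mor_a: "Mor ?L p q (a x p) = (if q \<in> I x then a x q else 0)"
    if x: "x \<in> X" and p: "p \<in> I x" and q: "q \<in> poset" "p \<le> q" for x p q
  proof -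
    have pP: "p \<in> poset" using p by (simp add: I_def)
    have in1: "{x} \<in> Ob Rips p" "component p (nn x) \<in> Ob Rips p"
      using clx[OF x p] sub[OF x] p unfolding Ob_Rips by (auto simp: I_def)
    have fx: "f x \<le> snd p" using p by (simp add: I_def)
    have "Mor ?L p q (a x p) + Mor ?L p q (basis_vec (component p (nn x))) = Mor ?L p q (basis_vec {x})"
      using pm_Mor_map(2)[OF pmL pP q a_in[OF x p] basis_vec_in[OF in1(2)]] by (simp add: a_def)
    then have "Mor ?L p q (a x p) = Mor ?L p q (basis_vec {x}) - Mor ?L p q (basis_vec (component p (nn x)))"
      by (simp add: algebra_simps)
    also have "\<dots> = basis_vec (component q x) - basis_vec (component q (nn x))"
      using Mor_Rips[OF q(2) sub(1)[OF x fx]] Mor_Rips[OF q(2) sub(2)[OF x fx]] clx[OF x p]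
      by (simp add: Mor_basis_vec[OF finite_Ob_Rips in1(1)] Mor_basis_vec[OF finite_Ob_Rips in1(2)])
    also have "\<dots> = (if q \<in> I x then a x q else 0)"
    proof (cases "q \<in> I x")
      case True then show ?thesis by (simp add: a_def clx[OF x True])
    next
      case False
      have fq: "f x \<le> snd q" using fx q(2) by (auto simp: less_eq_prod_def)
      then have "dist x (nn x) \<le> fst q" using False q(1) by (auto simp: I_def)
      then have "nn x \<in> component q x"
        unfolding component_def by (intro rips_class_edge sub[OF x fq])
      then show ?thesis using component_eq False by simp
    qed
    finally show ?thesis .
  qed
  have subA: "submodule ?s poset ?L (A x)" if x: "x \<in> X" for x
    unfolding submodule_def
  proof (intro conjI ballI impI)
    fix p assume p: "p \<in> poset"
    show "V.subspace (A x p)"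
    proof (cases "p \<in> I x")
      case True
      have "A x p = V.span {a x p}" using True by (simp add: A_def V.span_singleton)
      then show ?thesis by (simp add: V.subspace_span)
    qed (simp add: A_def V.subspace_single_0)
    show "A x p \<subseteq> Ob ?L p" by (rule A_in[OF x p])
    fix q assume q: "q \<in> poset" "p \<le> q"
    show "Mor ?L p q ` A x p \<subseteq> A x q"
    proof (cases "p \<in> I x")
      case True
      have "Mor ?L p q (?s c (a x p)) \<in> A x q" for c
        using pm_Mor_map(3)[OF pmL p q a_in[OF x True], of c] Mor_a[OF x True q]
        by (auto simp: A_def)
      then show ?thesis using True by (auto simp: A_def)
    next
      case False
      have "0 \<in> A x q" by (auto simp: A_def intro!: image_eqI[of 0 _ 0])
      then show ?thesis using False pm_Mor_0[OF pmL p q] by (simp add: A_def)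
    qed
  qed
  (* a component that is mapped to {x} is {x} itself, so no coefficient can flow into an isolated vertex *)
  have R_closed: "Mor ?L p q g {x} = 0"
    if x: "x \<in> X" and p: "p \<in> poset" and q: "p \<le> q" "q \<in> I x"
      and g: "p \<in> I x \<longrightarrow> g {x} = 0" for x p q and g :: "'a set \<Rightarrow> 'k"
  proof -
    have "g C = 0" if C: "C \<in> Ob Rips p" "Mor Rips p q C = {x}" for C
    proof -
      obtain w where w: "w \<in> sublevel M f (snd p)" "C = component p w" using C(1) unfolding Ob_Rips by auto
      have "component q w = {x}" using Mor_Rips[OF q(1) w(1)] C(2) w(2) by simp
      moreover have "w \<in> sublevel M f (snd q)" using w(1) q(1) by (auto simp: sublevel_def less_eq_prod_def)
      ultimately have "w = x" using component_self[of w q] by auto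
      then have "p \<in> I x" using w(1) p q by (auto simp: I_def sublevel_def less_eq_prod_def)
      moreover have "C = {x}" using clx[OF x \<open>p \<in> I x\<close>] w \<open>w = x\<close> by simp
      ultimately show ?thesis using g by simp
    qed
    then show ?thesis by (simp add: linearization_def)
  qed
  have subR: "submodule ?s poset ?L (R Z)" if Z: "Z \<subseteq> X" for Z
    unfolding submodule_def
  proof (intro conjI ballI impI)
    fix p assume p: "p \<in> poset"
    show "V.subspace (R Z p)"
      by (rule V.subspaceI) (auto simp: R_def pointwise_def pm_closed[OF pmL p, unfolded pointwise_def])
    show "R Z p \<subseteq> Ob ?L p" by (auto simp: R_def)
    fix q assume q: "q \<in> poset" "p \<le> q"
    show "Mor ?L p q ` R Z p \<subseteq> R Z q"
    proof
      fix h assume "h \<in> Mor ?L p q ` R Z p"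
      then obtain g where g: "g \<in> R Z p" "h = Mor ?L p q g" by auto
      have "h \<in> Ob ?L q" using pm_Mor_map(1)[OF pmL p q] g by (simp add: R_def)
      moreover have "h {x} = 0" if "x \<in> Z" "q \<in> I x" for x
        unfolding g(2) using g(1) that Z by (intro R_closed[OF _ p q(2)]) (auto simp: R_def)
      ultimately show "h \<in> R Z q" by (simp add: R_def)
    qed
  qed
  have step: "internal_sum poset (?L\<lparr>Ob := R Z\<rparr>) (A x) (R (insert x Z))"
    if x: "x \<in> X" "x \<notin> Z" and Z: "Z \<subseteq> X" for x Z
    unfolding internal_sum_def
  proof (intro ballI conjI)
    fix p assume p: "p \<in> poset"
    show "A x p \<inter> R (insert x Z) p \<subseteq> {0}"
    proof
      fix g assume g: "g \<in> A x p \<inter> R (insert x Z) p"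
      show "g \<in> {0}"
      proof (cases "p \<in> I x")
        case True
        then obtain c where c: "g = ?s c (a x p)" using g by (auto simp: A_def)
        have "g {x} = 0" using g True by (simp add: R_def)
        then have "c = 0" using a_x[OF x(1) x(1) True] by (simp add: c pointwise_def)
        then show ?thesis by (simp add: c)
      qed (use g in \<open>simp add: A_def\<close>)
    qed
    fix g assume "g \<in> Ob (?L\<lparr>Ob := R Z\<rparr>) p"
    then have g: "g \<in> Ob ?L p" "\<And>y. y \<in> Z \<Longrightarrow> p \<in> I y \<Longrightarrow> g {y} = 0" by (auto simp: R_def)
    show "\<exists>u\<in>A x p. \<exists>w\<in>R (insert x Z) p. g = u + w"
    proof (cases "p \<in> I x")
      case True
      let ?u = "?s (g {x}) (a x p)"
      have u: "?u \<in> A x p" using True by (auto simp: A_def)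
      have uL: "?u \<in> Ob ?L p" using A_in[OF x(1) p] u by auto
      have "(g - ?u) {y} = 0" if "y \<in> insert x Z" "p \<in> I y" for y
      proof -
        have y: "y \<in> X" using that(1) x(1) Z by auto
        have "(g - ?u) {y} = g {y} - g {x} * (if y = x then 1 else 0)"
          using a_x[OF x(1) y True] by (simp add: pointwise_def)
        also have "\<dots> = 0" using g(2)[of y] that by (cases "y = x") simp_all
        finally show ?thesis .
      qed
      then have "\<forall>y\<in>insert x Z. p \<in> I y \<longrightarrow> (g - ?u) {y} = 0" by (intro ballI impI)
      moreover have "g - ?u \<in> Ob ?L p" by (rule pm_closed(4)[OF pmL p g(1) uL])
      ultimately have "g - ?u \<in> R (insert x Z) p" unfolding R_def by (intro CollectI conjI)
      moreover have "g = ?u + (g - ?u)" by simp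
      ultimately show ?thesis using u by (intro bexI)
    next
      case False
      then have "g \<in> R (insert x Z) p" using g by (simp add: R_def)
      moreover have "0 \<in> A x p" using False by (simp add: A_def)
      moreover have "g = 0 + g" by simp
      ultimately show ?thesis by (intro bexI)
    qed
  qed
  have base: "(0, f x) \<in> I x" if "x \<in> X" for x
    using in_poset_0[of x] X that nx(2)[OF that] by (auto simp: I_def)
  have base_le: "(0, f x) \<le> p" if "p \<in> I x" for x p
  proof -
    have "p \<in> poset" "f x \<le> snd p" using that by (auto simp: I_def)
    then show ?thesis by (elim in_posetE) auto
  qed
  have intI: "poset_interval poset (I x)" if x: "x \<in> X" for x
    unfolding poset_interval_def
  proof (intro conjI ballI impI)
    show "I x \<subseteq> poset" by (auto simp: I_def)
    show "I x \<noteq> {}" using base[OF x] by auto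
    show "poset_connected (I x)" unfolding poset_connected_def
    proof (intro ballI)
      let ?T = "{(a, b). a \<in> I x \<and> b \<in> I x \<and> (a \<le> b \<or> b \<le> a)}"
      fix i j assume ij: "i \<in> I x" "j \<in> I x"
      have "(i, (0, f x)) \<in> ?T" "((0, f x), j) \<in> ?T"
        using ij base[OF x] base_le[of i x] base_le[of j x] by simp_all
      then show "(i, j) \<in> ?T\<^sup>*" by (meson converse_rtrancl_into_rtrancl r_into_rtrancl)
    qed
    fix i j l assume "i \<in> I x" "j \<in> I x" "l \<in> poset" "i \<le> l" "l \<le> j"
    then show "l \<in> I x" by (auto simp: I_def less_eq_prod_def)
  qed
  have pmA: "persistence_module ?s poset (?L\<lparr>Ob := A x\<rparr>)" if "x \<in> X" for x
    by (rule pm_submodule[OF pmL subA[OF that]])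
  have intA: "is_interval_module ?s poset (?L\<lparr>Ob := A x\<rparr>)" if x: "x \<in> X" for x
  proof -
    let ?\<eta> = "\<lambda>p g. if p \<in> I x then g {x} else 0 :: 'k"
    let ?A = "?L\<lparr>Ob := A x\<rparr>"
    have ev: "?s c (a x p) {x} = c" if "p \<in> I x" for c p
      using a_x[OF x x that] by (simp add: pointwise_def)
    have "module_map ?s (*) poset ?A (interval_module (I x)) ?\<eta>"
    proof (rule module_mapI)
      fix p q and g :: "'a set \<Rightarrow> 'k" assume pq: "p \<in> poset" "q \<in> poset" "p \<le> q" and g: "g \<in> Ob ?A p"
      show "?\<eta> q (Mor ?A p q g) = Mor (interval_module (I x)) p q (?\<eta> p g)"
      proof (cases "p \<in> I x")
        case True
        then obtain c where c: "g = ?s c (a x p)" using g by (auto simp: A_def)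
        have "Mor ?L p q g = ?s c (if q \<in> I x then a x q else 0)"
          unfolding c using pm_Mor_map(3)[OF pmL pq a_in[OF x True]] Mor_a[OF x True pq(2,3)] by simp
        then show ?thesis using True ev by (auto simp: interval_module_def c)
      next
        case False
        then have "g = 0" using g by (simp add: A_def)
        then show ?thesis using False pm_Mor_0[OF pmL pq] by (simp add: interval_module_def)
      qed
    qed (auto simp: interval_module_def pointwise_def)
    moreover have "bij_betw (?\<eta> p) (Ob ?A p) (Ob (interval_module (I x)) p)" if "p \<in> poset" for p
    proof (cases "p \<in> I x")
      case True
      show ?thesis
        by (rule bij_betw_byWitness[where f' = "\<lambda>c. ?s c (a x p)"])
          (use True ev[OF True] in \<open>auto simp: A_def interval_module_def\<close>)
    qed (simp add: A_def interval_module_def bij_betw_def)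
    ultimately have "module_iso ?s (*) poset ?A (interval_module (I x))"
      unfolding module_iso_iff by (intro exI[of _ ?\<eta>] conjI ballI)
    then show ?thesis
      unfolding is_interval_module_def by (intro exI[of _ "I x"] conjI intI[OF x])
  qed
  have decA: "decomposes_into ?s poset (?L\<lparr>Ob := A x\<rparr>) [?L\<lparr>Ob := A x\<rparr>]" if x: "x \<in> X" for x
  proof (rule decomposes_into_singleton[OF pmA[OF x]])
    let ?b = "(0 :: real, f x)"
    have b: "?b \<in> poset" using base[OF x] by (simp add: I_def)
    have "a x ?b {x} = 1" using a_x[OF x x base[OF x]] by simp
    then have "a x ?b \<noteq> 0" by (auto dest: fun_cong[of _ _ "{x}"])
    moreover have "a x ?b \<in> A x ?b" using base[OF x] by (auto simp: A_def intro!: image_eqI[of _ _ 1])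
    ultimately show "\<not> zero_module poset (?L\<lparr>Ob := A x\<rparr>)" using b by (auto simp: zero_module_def)
    show "indecomposable ?s poset (?L\<lparr>Ob := A x\<rparr>)"
    proof (rule indecomposable_if_cyclic[OF pmA[OF x] b])
      show "\<exists>c. g = ?s c (a x ?b)" if "g \<in> Ob (?L\<lparr>Ob := A x\<rparr>) ?b" for g
        using that base[OF x] by (auto simp: A_def)
      fix p assume p: "p \<in> poset" "Ob (?L\<lparr>Ob := A x\<rparr>) p \<noteq> {0}"
      then have pI: "p \<in> I x" by (auto simp: A_def split: if_splits)
      have "?s c (a x p) \<in> Mor ?L ?b p ` A x ?b" for c
      proof (rule image_eqI)
        show "?s c (a x p) = Mor ?L ?b p (?s c (a x ?b))"
          using pm_Mor_map(3)[OF pmL b p(1) base_le[OF pI] a_in[OF x base[OF x]], of c]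
            Mor_a[OF x base[OF x] p(1) base_le[OF pI]] pI by simp
        show "?s c (a x ?b) \<in> A x ?b" using base[OF x] by (auto simp: A_def)
      qed
      moreover have "A x p = range (\<lambda>c. ?s c (a x p))" using pI by (simp add: A_def)
      ultimately show "?b \<le> p \<and> Ob (?L\<lparr>Ob := A x\<rparr>) p \<subseteq> Mor (?L\<lparr>Ob := A x\<rparr>) ?b p ` Ob (?L\<lparr>Ob := A x\<rparr>) ?b"
        using base_le[OF pI] by auto
    qed
  qed
  have main: "\<exists>Fs. decomposes_into ?s poset (?L\<lparr>Ob := R Z\<rparr>) Fs \<and>
      card Y \<le> length (filter (is_interval_module ?s poset) Fs)"
    if "finite Y" "Y \<subseteq> X" "Z \<subseteq> X" "Y \<inter> Z = {}" for Y Z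
    using that
  proof (induction Y arbitrary: Z rule: finite_induct)
    case empty
    obtain Fs where "decomposes_into ?s poset (?L\<lparr>Ob := R Z\<rparr>) Fs"
      using decomposes_into_exists[OF finite_poset pm_submodule[OF pmL subR]] empty by blast
    then show ?case by auto
  next
    case (insert x Y)
    have x: "x \<in> X" "x \<notin> Z" "Z \<subseteq> X" using insert.prems by auto
    have iZ: "insert x Z \<subseteq> X" using x by simp
    have "\<exists>Fs. decomposes_into ?s poset (?L\<lparr>Ob := R (insert x Z)\<rparr>) Fs \<and>
      card Y \<le> length (filter (is_interval_module ?s poset) Fs)"
      using insert.prems insert.hyps by (intro insert.IH) auto
    then obtain Fs where Fs: "decomposes_into ?s poset (?L\<lparr>Ob := R (insert x Z)\<rparr>) Fs"
      "card Y \<le> length (filter (is_interval_module ?s poset) Fs)" by (elim exE conjE)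
    let ?F = "?L\<lparr>Ob := R Z\<rparr>"
    note pmF = pm_submodule[OF pmL subR[OF x(3)]]
    have AR: "A x p \<subseteq> R Z p" if p: "p \<in> poset" for p
    proof (cases "p \<in> I x")
      case True
      then show ?thesis using A_in[OF x(1) p] x a_x[OF x(1) _ True]
        by (auto simp: A_def R_def pointwise_def)
    qed (use pm_closed(1)[OF pmF p] in \<open>simp add: A_def\<close>)
    have sA: "submodule ?s poset ?F (A x)"
      using subA[OF x(1)] AR by (simp add: submodule_def)
    have sR: "submodule ?s poset ?F (R (insert x Z))"
      using subR[OF iZ] by (auto simp: submodule_def R_def)
    have "decomposes_into ?s poset ?F ([?L\<lparr>Ob := A x\<rparr>] @ Fs)"
    proof (rule decomposes_into_append[OF pmA[OF x(1)] pm_submodule[OF pmL subR[OF iZ]] _ decA[OF x(1)] Fs(1)])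
      show "module_iso ?s (pointwise ?s) poset ?F (direct_sum [?L\<lparr>Ob := A x\<rparr>, ?L\<lparr>Ob := R (insert x Z)\<rparr>])"
        using internal_sum_iso[OF pmF sA sR step[OF x]] by simp
    qed
    moreover have "card (insert x Y) \<le> length (filter (is_interval_module ?s poset) ([?L\<lparr>Ob := A x\<rparr>] @ Fs))"
      using Fs(2) insert.hyps intA[OF x(1)] by simp
    ultimately show ?case by (intro exI conjI)
  qed
  have "finite X" using X fin by (rule finite_subset)
  from main[OF this, of "{}"] obtain Fs where Fs: "decomposes_into ?s poset (?L\<lparr>Ob := R {}\<rparr>) Fs"
      "card X \<le> length (filter (is_interval_module ?s poset) Fs)" by auto
  have "?L\<lparr>Ob := R {}\<rparr> = ?L" by (simp add: R_def)
  with Fs(1) have "decomposes_into ?s poset ?L Fs" by simp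
  from num_eqI(2)[OF finite_poset pmL this] Fs(2) show ?thesis by simp
qed

end

section \<open>Only the order of distances and function values matters\<close>

lemma order_iso_inv_into:
  assumes "bij_betw \<psi> P Q" "\<And>p p'. p \<in> P \<Longrightarrow> p' \<in> P \<Longrightarrow> p \<le> p' \<longleftrightarrow> \<psi> p \<le> \<psi> p'"
  shows "order_iso P Q \<psi> (inv_into P \<psi>)"
  unfolding order_iso_def
proof (intro conjI ballI)
  show "\<psi> p \<in> Q" if "p \<in> P" for p using bij_betwE[OF assms(1)] that by blast
  show "inv_into P \<psi> (\<psi> p) = p" if "p \<in> P" for p by (rule bij_betw_inv_into_left[OF assms(1) that])
  show "inv_into P \<psi> q \<in> P" if "q \<in> Q" for q
    using bij_betwE[OF bij_betw_inv_into[OF assms(1)]] that by blast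
  show "\<psi> (inv_into P \<psi> q) = q" if "q \<in> Q" for q by (rule bij_betw_inv_into_right[OF assms(1) that])
qed (rule assms(2))

text \<open>
  The bijection \<open>b\<close> of the points induces an isomorphism \<open>\<psi>\<close> of the posets, because both sides are
  products of the set of distances and the set of function values with the same order relations,
  and it maps components to components.  The counts agree by \<open>num_pullback\<close>.
\<close>

theorem num_relabel:
  fixes M :: "'a::metric_space set" and f f' :: "'a \<Rightarrow> real" and b :: "'a \<Rightarrow> 'a"
  assumes fin: "finite M"
    and d: "\<And>x y z w. x \<in> M \<Longrightarrow> y \<in> M \<Longrightarrow> z \<in> M \<Longrightarrow> w \<in> M \<Longrightarrow>
      dist x y \<le> dist z w \<longleftrightarrow> dist (b x) (b y) \<le> dist (b z) (b w)"
    and f: "\<And>x y. x \<in> M \<Longrightarrow> y \<in> M \<Longrightarrow> f x \<le> f y \<longleftrightarrow> f' (b x) \<le> f' (b y)"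
  defines "P \<equiv> density_rips_poset M dist f" and "P' \<equiv> density_rips_poset (b ` M) dist f'"
    and "L \<equiv> (linearization (density_rips M dist f) :: (real \<times> real, 'a set \<Rightarrow> 'k::field) diagram)"
    and "L' \<equiv> (linearization (density_rips (b ` M) dist f') :: (real \<times> real, 'a set \<Rightarrow> 'k::field) diagram)"
  shows "num_summands (pointwise (*)) P L = num_summands (pointwise (*)) P' L'"
    and "num_intervals (pointwise (*)) P L = num_intervals (pointwise (*)) P' L'"
proof -
  let ?s = "pointwise (*) :: 'k \<Rightarrow> ('a set \<Rightarrow> 'k) \<Rightarrow> _"
  interpret A: augmented_metric_space M f by unfold_locales (rule fin)
  interpret B: augmented_metric_space "b ` M" f' by unfold_locales (use fin in simp)
  let ?S = "density_rips M dist f" and ?S' = "density_rips (b ` M) dist f'"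
  have P: "finite P" "finite P'" unfolding P_def P'_def by (rule A.finite_poset, rule B.finite_poset)
  have pmL: "persistence_module ?s P L" unfolding P_def L_def by (rule A.pm_LRips)
  have pmL': "persistence_module ?s P' L'" unfolding P'_def L'_def by (rule B.pm_LRips)
  have inj: "inj_on b M"
  proof (rule inj_onI)
    fix x y assume "x \<in> M" "y \<in> M" "b x = b y"
    then have "dist x y \<le> dist x x" using d[of x y x x] by simp
    then show "x = y" by simp
  qed
  define \<alpha> where "\<alpha> = (\<lambda>\<epsilon>. SOME t. \<exists>x\<in>M. \<exists>y\<in>M. \<epsilon> = dist x y \<and> t = dist (b x) (b y))"
  define \<beta> where "\<beta> = (\<lambda>\<sigma>. SOME t. \<exists>x\<in>M. \<sigma> = f x \<and> t = f' (b x))"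
  have \<alpha>: "\<alpha> (dist x y) = dist (b x) (b y)" if xy: "x \<in> M" "y \<in> M" for x y
    unfolding \<alpha>_def
  proof (rule some_equality)
    show "\<exists>z\<in>M. \<exists>w\<in>M. dist x y = dist z w \<and> dist (b x) (b y) = dist (b z) (b w)" using xy by blast
    fix t assume "\<exists>z\<in>M. \<exists>w\<in>M. dist x y = dist z w \<and> t = dist (b z) (b w)"
    then obtain z w where zw: "z \<in> M" "w \<in> M" "dist x y = dist z w" "t = dist (b z) (b w)" by blast
    then show "t = dist (b x) (b y)"
      using d[OF xy zw(1,2)] d[OF zw(1,2) xy] by simp
  qed
  have \<beta>: "\<beta> (f x) = f' (b x)" if x: "x \<in> M" for x
    unfolding \<beta>_def
  proof (rule some_equality)
    show "\<exists>z\<in>M. f x = f z \<and> f' (b x) = f' (b z)" using x by blast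
    fix t assume "\<exists>z\<in>M. f x = f z \<and> t = f' (b z)"
    then obtain z where z: "z \<in> M" "f x = f z" "t = f' (b z)" by blast
    then show "t = f' (b x)" using f[OF x z(1)] f[OF z(1) x] by simp
  qed
  define \<psi> where "\<psi> = (\<lambda>p. (\<alpha> (fst p), \<beta> (snd p)))"
  have \<psi>: "\<psi> (dist x y, f z) = (dist (b x) (b y), f' (b z))" if "x \<in> M" "y \<in> M" "z \<in> M" for x y z
    using \<alpha> \<beta> that by (simp add: \<psi>_def)
  have le: "p \<le> p' \<longleftrightarrow> \<psi> p \<le> \<psi> p'" if p: "p \<in> P" "p' \<in> P" for p p'
  proof -
    obtain x y z where 1: "x \<in> M" "y \<in> M" "z \<in> M" "p = (dist x y, f z)"
      using p(1) unfolding P_def by (rule A.in_posetE)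
    obtain x' y' z' where 2: "x' \<in> M" "y' \<in> M" "z' \<in> M" "p' = (dist x' y', f z')"
      using p(2) unfolding P_def by (rule A.in_posetE)
    show ?thesis
      unfolding 1(4) 2(4) \<psi>[OF 1(1-3)] \<psi>[OF 2(1-3)]
      using d[OF 1(1,2) 2(1,2)] f[OF 1(3) 2(3)] by simp
  qed
  have bij: "bij_betw \<psi> P P'"
  proof (rule bij_betw_imageI)
    show "inj_on \<psi> P"
    proof (rule inj_onI)
      fix p p' assume "p \<in> P" "p' \<in> P" "\<psi> p = \<psi> p'"
      then show "p = p'" using le[of p p'] le[of p' p] by (intro antisym) simp_all
    qed
    show "\<psi> ` P = P'"
    proof
      show "\<psi> ` P \<subseteq> P'"
      proof
        fix q assume "q \<in> \<psi> ` P"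
        then obtain p where p: "p \<in> P" "q = \<psi> p" by auto
        obtain x y z where 1: "x \<in> M" "y \<in> M" "z \<in> M" "p = (dist x y, f z)"
          using p(1) unfolding P_def by (rule A.in_posetE)
        show "q \<in> P'" unfolding p(2) 1(4) \<psi>[OF 1(1-3)] P'_def
          by (rule B.in_poset) (use 1 in simp_all)
      qed
      show "P' \<subseteq> \<psi> ` P"
      proof
        fix q assume "q \<in> P'"
        then obtain x' y' z' where q: "x' \<in> b ` M" "y' \<in> b ` M" "z' \<in> b ` M" "q = (dist x' y', f' z')"
          unfolding P'_def by (rule B.in_posetE)
        then obtain x y z where 1: "x \<in> M" "y \<in> M" "z \<in> M" "x' = b x" "y' = b y" "z' = b z" by auto
        have "(dist x y, f z) \<in> P" unfolding P_def by (rule A.in_poset[OF 1(1-3)])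
        moreover have "q = \<psi> (dist x y, f z)" unfolding \<psi>[OF 1(1-3)] q(4) 1(4-6) by simp
        ultimately show "q \<in> \<psi> ` P" by blast
      qed
    qed
  qed
  have o: "order_iso P P' \<psi> (inv_into P \<psi>)" by (rule order_iso_inv_into[OF bij le])
  have sub: "b x \<in> sublevel (b ` M) f' (snd (\<psi> p)) \<longleftrightarrow> x \<in> sublevel M f (snd p)"
    if p: "p \<in> P" and x: "x \<in> M" for p x
  proof -
    obtain u v z where 1: "u \<in> M" "v \<in> M" "z \<in> M" "p = (dist u v, f z)"
      using p unfolding P_def by (rule A.in_posetE)
    show ?thesis unfolding 1(4) \<psi>[OF 1(1-3)] using x f[OF x 1(3)] by (simp add: sublevel_def)
  qed
  have edge: "dist (b x) (b y) \<le> fst (\<psi> p) \<longleftrightarrow> dist x y \<le> fst p"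
    if p: "p \<in> P" and x: "x \<in> M" "y \<in> M" for p x y
  proof -
    obtain u v z where 1: "u \<in> M" "v \<in> M" "z \<in> M" "p = (dist u v, f z)"
      using p unfolding P_def by (rule A.in_posetE)
    show ?thesis unfolding 1(4) \<psi>[OF 1(1-3)] using d[OF x 1(1,2)] by simp
  qed
  have edges: "(b x, b y) \<in> rips_edges (sublevel (b ` M) f' (snd (\<psi> p))) dist (fst (\<psi> p)) \<longleftrightarrow>
      (x, y) \<in> rips_edges (sublevel M f (snd p)) dist (fst p)"
    if p: "p \<in> P" and x: "x \<in> M" "y \<in> M" for p x y
    using sub[OF p] edge[OF p x] x by (simp add: rips_edges_def)
  have component: "B.component (\<psi> p) (b z) = b ` A.component p z" if p: "p \<in> P" and z: "z \<in> sublevel M f (snd p)" for p z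
  proof -
    let ?E = "rips_edges (sublevel M f (snd p)) dist (fst p)"
    let ?E' = "rips_edges (sublevel (b ` M) f' (snd (\<psi> p))) dist (fst (\<psi> p))"
    have zM: "z \<in> M" using z by (simp add: sublevel_def)
    have EM: "x \<in> M \<and> y \<in> M" if "(x, y) \<in> ?E" for x y using that by (auto simp: rips_edges_def sublevel_def)
    have 1: "(b z, b y) \<in> ?E'\<^sup>*" if "(z, y) \<in> ?E\<^sup>*" for y
      using that
    proof (induction rule: rtrancl_induct)
      case (step y w)
      have "(b y, b w) \<in> ?E'" using edges[OF p] EM[OF step(2)] step(2) by simp
      then show ?case using step(3) by (rule rtrancl_into_rtrancl[rotated])
    qed simp
    have 2: "\<exists>y\<in>M. w = b y \<and> (z, y) \<in> ?E\<^sup>*" if "(b z, w) \<in> ?E'\<^sup>*" for w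
      using that
    proof (induction rule: rtrancl_induct)
      case base show ?case using zM by blast
    next
      case (step v w)
      then obtain y where y: "y \<in> M" "v = b y" "(z, y) \<in> ?E\<^sup>*" by blast
      have "w \<in> b ` M" using step(2) by (auto simp: rips_edges_def sublevel_def)
      then obtain u where u: "u \<in> M" "w = b u" by blast
      have "(y, u) \<in> ?E" using edges[OF p y(1) u(1)] step(2) y(2) u(2) by simp
      with y(3) have "(z, u) \<in> ?E\<^sup>*" by (rule rtrancl_into_rtrancl)
      then show ?case using u by blast
    qed
    have "w \<in> B.component (\<psi> p) (b z) \<longleftrightarrow> w \<in> b ` A.component p z" for w
    proof
      assume w: "w \<in> B.component (\<psi> p) (b z)"
      then obtain y where y: "y \<in> M" "w = b y" "(z, y) \<in> ?E\<^sup>*"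
        using 2 unfolding B.component_def rips_class_def rips_connected_def by blast
      have "w \<in> sublevel (b ` M) f' (snd (\<psi> p))"
        using w unfolding B.component_def rips_class_def rips_connected_def by blast
      then have "y \<in> sublevel M f (snd p)" using sub[OF p y(1)] y(2) by simp
      then have "y \<in> A.component p z"
        using y(3) z unfolding A.component_def rips_class_def rips_connected_def by blast
      then show "w \<in> b ` A.component p z" using y(2) by blast
    next
      assume "w \<in> b ` A.component p z"
      then obtain y where y: "y \<in> A.component p z" "w = b y" by blast
      then have "(z, y) \<in> ?E\<^sup>*" "y \<in> sublevel M f (snd p)"
        unfolding A.component_def rips_class_def rips_connected_def by blast+
      moreover from this(2) have "y \<in> M" by (simp add: sublevel_def)
      ultimately show "w \<in> B.component (\<psi> p) (b z)"
        using 1 sub[OF p] z zM y(2) unfolding B.component_def rips_class_def rips_connected_def by simp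
    qed
    then show ?thesis by blast
  qed
  have clM: "C \<subseteq> M" if "C \<in> Ob ?S p" for C p
    using that rips_class_subset unfolding A.Ob_Rips A.component_def sublevel_def by blast
  define pre where "pre = (\<lambda>C'. {x \<in> M. b x \<in> C'})"
  have pre_im: "pre (b ` C) = C" if "C \<subseteq> M" for C
    using inj that unfolding pre_def inj_on_def by blast
  have im_Ob: "b ` C \<in> Ob ?S' (\<psi> p)" if p: "p \<in> P" and C: "C \<in> Ob ?S p" for p C
  proof -
    obtain z where z: "z \<in> sublevel M f (snd p)" "C = A.component p z" using C unfolding A.Ob_Rips by blast
    have "b z \<in> sublevel (b ` M) f' (snd (\<psi> p))" using sub[OF p, of z] z(1) by (simp add: sublevel_def)
    then show ?thesis unfolding B.Ob_Rips z(2) component[OF p z(1), symmetric] by (rule imageI)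
  qed
  have pre_Ob: "pre C' \<in> Ob ?S p" "b ` pre C' = C'" if p: "p \<in> P" and C': "C' \<in> Ob ?S' (\<psi> p)" for p C'
  proof -
    obtain z' where z': "z' \<in> sublevel (b ` M) f' (snd (\<psi> p))" "C' = B.component (\<psi> p) z'"
      using C' unfolding B.Ob_Rips by blast
    then obtain z where z: "z \<in> M" "z' = b z" by (auto simp: sublevel_def)
    have zs: "z \<in> sublevel M f (snd p)" using sub[OF p z(1)] z' z by simp
    have C: "A.component p z \<in> Ob ?S p" unfolding A.Ob_Rips by (rule imageI[OF zs])
    have C'eq: "C' = b ` A.component p z" unfolding z'(2) z(2) by (rule component[OF p zs])
    then have pr: "pre C' = A.component p z" using pre_im[OF clM[OF C]] by simp
    show "pre C' \<in> Ob ?S p" unfolding pr by (rule C)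
    show "b ` pre C' = C'" by (subst pr) (rule C'eq[symmetric])
  qed
  have mor: "Mor ?S' (\<psi> p) (\<psi> q) (b ` C) = b ` Mor ?S p q C"
    if p: "p \<in> P" and q: "q \<in> P" "p \<le> q" and C: "C \<in> Ob ?S p" for p q :: "real \<times> real" and C
  proof -
    obtain z where z: "z \<in> sublevel M f (snd p)" "C = A.component p z" using C unfolding A.Ob_Rips by blast
    have zq: "z \<in> sublevel M f (snd q)" using z(1) q(2) by (auto simp: sublevel_def less_eq_prod_def)
    have zM: "z \<in> M" using z(1) by (simp add: sublevel_def)
    have bz: "b z \<in> sublevel (b ` M) f' (snd (\<psi> p))" using sub[OF p zM] z(1) by simp
    have le': "\<psi> p \<le> \<psi> q" using le[OF p q(1)] q(2) by simp
    show ?thesis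
      unfolding z(2) component[OF p z(1), symmetric] B.Mor_Rips[OF le' bz] A.Mor_Rips[OF q(2) z(1)]
      by (rule component[OF q(1) zq])
  qed
  have "\<forall>p\<in>P. \<forall>q\<in>P. p \<le> q \<longrightarrow> Mor ?S p q ` Ob ?S p \<subseteq> Ob ?S q"
    using A.persistent_set_Rips unfolding persistent_set_def functor_on_def P_def by (elim conjE)
  then have mor_Ob: "Mor ?S p q C \<in> Ob ?S q" if "p \<in> P" "q \<in> P" "p \<le> q" "C \<in> Ob ?S p" for p q C
    using that by (meson imageI subsetD)
  define \<eta> where "\<eta> = (\<lambda>p (g :: 'a set \<Rightarrow> 'k) C'. if C' \<in> Ob ?S' (\<psi> p) then g (pre C') else 0)"
  have map: "module_map ?s ?s P L (pullback \<psi> L') \<eta>"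
  proof (rule module_mapI)
    show "\<eta> p g \<in> Ob (pullback \<psi> L') p" for p g
      by (simp add: L'_def Ob_linearization \<eta>_def)
    show "\<eta> p (g + h) = \<eta> p g + \<eta> p h" for p g h by (simp add: \<eta>_def fun_eq_iff)
    show "\<eta> p (?s c g) = ?s c (\<eta> p g)" for p c g by (simp add: \<eta>_def fun_eq_iff pointwise_def)
    fix p q g assume p: "p \<in> P" and q: "q \<in> P" "p \<le> q"
    show "\<eta> q (Mor L p q g) = Mor (pullback \<psi> L') p q (\<eta> p g)"
    proof
      fix D'
      let ?T = "{C' \<in> Ob ?S' (\<psi> p). Mor ?S' (\<psi> p) (\<psi> q) C' = D'}"
      have rhs: "Mor (pullback \<psi> L') p q (\<eta> p g) D' = (\<Sum>C'\<in>?T. g (pre C'))"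
        by (simp add: L'_def linearization_def \<eta>_def)
      show "\<eta> q (Mor L p q g) D' = Mor (pullback \<psi> L') p q (\<eta> p g) D'"
      proof (cases "D' \<in> Ob ?S' (\<psi> q)")
        case True
        note pD = pre_Ob[OF q(1) True]
        have "(\<Sum>C\<in>{C \<in> Ob ?S p. Mor ?S p q C = pre D'}. g C) = (\<Sum>C'\<in>?T. g (pre C'))"
        proof (rule sum.reindex_bij_witness[of _ pre "image b"])
          fix C assume C: "C \<in> {C \<in> Ob ?S p. Mor ?S p q C = pre D'}"
          then have C1: "C \<in> Ob ?S p" and C2: "Mor ?S p q C = pre D'" by simp_all
          show "pre (b ` C) = C" by (rule pre_im[OF clM[OF C1]])
          then show "g (pre (b ` C)) = g C" by simp
          show "b ` C \<in> ?T" using im_Ob[OF p C1] mor[OF p q C1] C2 pD(2) by simp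
        next
          fix C' assume C': "C' \<in> ?T"
          then have C1: "C' \<in> Ob ?S' (\<psi> p)" and C2: "Mor ?S' (\<psi> p) (\<psi> q) C' = D'" by simp_all
          note pC = pre_Ob[OF p C1]
          show "b ` pre C' = C'" by (rule pC(2))
          have "b ` Mor ?S p q (pre C') = D'" using mor[OF p q pC(1)] pC(2) C2 by simp
          then have "Mor ?S p q (pre C') = pre D'"
            using pre_im[OF clM[OF mor_Ob[OF p q pC(1)]]] by simp
          then show "pre C' \<in> {C \<in> Ob ?S p. Mor ?S p q C = pre D'}" using pC(1) by simp
        qed
        then show ?thesis using True rhs by (simp add: \<eta>_def L_def linearization_def)
      next
        case False
        have "?T = {}"
        proof (rule ccontr)
          assume "?T \<noteq> {}"
          then obtain C' where C1: "C' \<in> Ob ?S' (\<psi> p)" and C2: "Mor ?S' (\<psi> p) (\<psi> q) C' = D'" by auto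
          note pC = pre_Ob[OF p C1]
          have "b ` Mor ?S p q (pre C') = D'" using mor[OF p q pC(1)] pC(2) C2 by simp
          then show False using im_Ob[OF q(1) mor_Ob[OF p q pC(1)]] False by simp
        qed
        then show ?thesis using False rhs by (simp add: \<eta>_def del: Collect_empty_eq)
      qed
    qed
  qed
  have "bij_betw (\<eta> p) (Ob L p) (Ob (pullback \<psi> L') p)" if p: "p \<in> P" for p
  proof (rule bij_betw_byWitness[where f' = "\<lambda>h C. if C \<in> Ob ?S p then h (b ` C) else 0"])
    show "\<forall>g\<in>Ob L p. (\<lambda>C. if C \<in> Ob ?S p then \<eta> p g (b ` C) else 0) = g"
      using im_Ob[OF p] pre_im[OF clM] by (auto simp: L_def Ob_linearization \<eta>_def fun_eq_iff)
    show "\<forall>h\<in>Ob (pullback \<psi> L') p. \<eta> p (\<lambda>C. if C \<in> Ob ?S p then h (b ` C) else 0) = h"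
      using pre_Ob[OF p] by (auto simp: L'_def Ob_linearization \<eta>_def fun_eq_iff)
    show "\<eta> p ` Ob L p \<subseteq> Ob (pullback \<psi> L') p"
      using module_mapD(1)[OF map p] by blast
    show "(\<lambda>h C. if C \<in> Ob ?S p then h (b ` C) else 0) ` Ob (pullback \<psi> L') p \<subseteq> Ob L p"
      by (auto simp: L_def Ob_linearization)
  qed
  then have iso: "module_iso ?s ?s P L (pullback \<psi> L')"
    unfolding module_iso_iff using map by (intro exI[of _ \<eta>] conjI ballI)
  show "num_summands ?s P L = num_summands ?s P' L'" "num_intervals ?s P L = num_intervals ?s P' L'"
    by (rule num_pullback[OF P o pmL pmL' iso])+
qed

section \<open>Volumes of unions of two balls\<close>

lemma lessThan_Suc_eq_insert_0_Icc: "{..<Suc k} = insert 0 {1..<Suc k}"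
  by auto

text \<open>
  Fubini in the first coordinate: the slice at \<open>t\<close> is a ball of radius \<open>sqrt (m t)\<close> in \<open>k\<close>
  dimensions.  Heights with \<open>m t = 0\<close> are excluded because the volume of a degenerate ball in
  dimension \<open>0\<close> is \<open>1\<close>.
\<close>

lemma emeasure_slices:
  fixes m :: "real \<Rightarrow> real"
  assumes [measurable]: "m \<in> borel_measurable borel" and nz: "AE t in lborel. m t \<noteq> 0"
  shows "emeasure (lebesgue_Rd (Suc k)) {x \<in> space (lebesgue_Rd (Suc k)). (\<Sum>i=1..<Suc k. (x i)\<^sup>2) \<le> m (x 0)} =
    ennreal (unit_ball_vol k) * (\<integral>\<^sup>+t. (if m t > 0 then ennreal (sqrt (m t) ^ k) else 0) \<partial>lborel)"
proof -
  interpret product_sigma_finite "\<lambda>_. lborel :: real measure" by standard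
  have gm: "(\<lambda>t. if m t > 0 then ennreal (sqrt (m t) ^ k) else 0) \<in> borel_measurable lborel"
    by measurable
  let ?A = "{1..<Suc k}"
  let ?N = "Pi\<^sub>M ?A (\<lambda>_. lborel :: real measure)"
  let ?M = "Pi\<^sub>M (insert 0 ?A) (\<lambda>_. lborel :: real measure)"
  have M: "lebesgue_Rd (Suc k) = ?M"
    unfolding lebesgue_Rd_def lessThan_Suc_eq_insert_0_Icc ..
  have [measurable]: "(\<lambda>x. \<Sum>i\<in>?A. (x i)\<^sup>2) \<in> borel_measurable ?M"
    by (intro borel_measurable_sum borel_measurable_power)
      (rule measurable_compose[OF measurable_component_singleton], auto)
  have [measurable]: "(\<lambda>x. x 0) \<in> borel_measurable ?M"
    using measurable_component_singleton[of 0 "insert 0 ?A" "\<lambda>_. lborel :: real measure"] by simp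
  have [measurable]: "(\<lambda>x. \<Sum>i\<in>?A. (x i)\<^sup>2) \<in> borel_measurable ?N"
    by (intro borel_measurable_sum borel_measurable_power)
      (rule measurable_compose[OF measurable_component_singleton], auto)
  let ?S = "{x \<in> space ?M. (\<Sum>i\<in>?A. (x i)\<^sup>2) \<le> m (x 0)}"
  have S [measurable]: "?S \<in> sets ?M" by measurable
  have "emeasure ?M ?S = (\<integral>\<^sup>+x. indicator ?S x \<partial>?M)"
    by (rule nn_integral_indicator[OF S, symmetric])
  also have "\<dots> = (\<integral>\<^sup>+t. \<integral>\<^sup>+x. indicator ?S (x(0 := t)) \<partial>?N \<partial>lborel)"
    by (rule product_nn_integral_insert_rev[OF _ _ borel_measurable_indicator[OF S]]) auto
  also have "\<dots> = (\<integral>\<^sup>+t. emeasure ?N {x \<in> space ?N. (\<Sum>i\<in>?A. (x i)\<^sup>2) \<le> m t} \<partial>lborel)"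
  proof (rule nn_integral_cong)
    fix t :: real
    have "(\<integral>\<^sup>+x. indicator ?S (x(0 := t)) \<partial>?N) =
        (\<integral>\<^sup>+x. indicator {x \<in> space ?N. (\<Sum>i\<in>?A. (x i)\<^sup>2) \<le> m t} x \<partial>?N)"
    proof (rule nn_integral_cong)
      fix x assume x: "x \<in> space ?N"
      have "(\<Sum>i\<in>?A. ((x(0 := t)) i)\<^sup>2) = (\<Sum>i\<in>?A. (x i)\<^sup>2)" by (intro sum.cong) auto
      moreover have "x(0 := t) \<in> space ?M" using x by (auto simp: space_PiM PiE_def extensional_def)
      ultimately show "indicator ?S (x(0 := t)) = (indicator {x \<in> space ?N. (\<Sum>i\<in>?A. (x i)\<^sup>2) \<le> m t} x :: ennreal)"
        using x by (simp add: indicator_def del: sum.op_ivl_Suc)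
    qed
    moreover have "{x \<in> space ?N. (\<Sum>i\<in>?A. (x i)\<^sup>2) \<le> m t} \<in> sets ?N" by measurable
    ultimately show "(\<integral>\<^sup>+x. indicator ?S (x(0 := t)) \<partial>?N) = emeasure ?N {x \<in> space ?N. (\<Sum>i\<in>?A. (x i)\<^sup>2) \<le> m t}"
      by (simp only: nn_integral_indicator)
  qed
  also have "\<dots> = (\<integral>\<^sup>+t. ennreal (unit_ball_vol k) * (if m t > 0 then ennreal (sqrt (m t) ^ k) else 0) \<partial>lborel)"
  proof (rule nn_integral_cong_AE)
    show "AE t in lborel. emeasure ?N {x \<in> space ?N. (\<Sum>i\<in>?A. (x i)\<^sup>2) \<le> m t} =
        ennreal (unit_ball_vol k) * (if m t > 0 then ennreal (sqrt (m t) ^ k) else 0)"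
      using nz
    proof eventually_elim
      case (elim t)
      show ?case
      proof (cases "m t > 0")
        case True
        have "{x \<in> space ?N. (\<Sum>i\<in>?A. (x i)\<^sup>2) \<le> m t} =
            {x. sqrt (\<Sum>i\<in>?A. (x i)\<^sup>2) \<le> sqrt (m t)} \<inter> space ?N" by auto
        then have "emeasure ?N {x \<in> space ?N. (\<Sum>i\<in>?A. (x i)\<^sup>2) \<le> m t} =
            ennreal (unit_ball_vol (card ?A) * sqrt (m t) ^ card ?A)"
          using True by (simp only: emeasure_cball_aux[of ?A "sqrt (m t)"] finite_atLeastLessThan real_sqrt_gt_zero)
        then show ?thesis using True by (simp add: ennreal_mult)
      next
        case False
        then have "m t < 0" using elim by simp
        moreover have "0 \<le> (\<Sum>i\<in>?A. (x i)\<^sup>2)" for x :: "nat \<Rightarrow> real" by (intro sum_nonneg) simp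
        ultimately have "{x \<in> space ?N. (\<Sum>i\<in>?A. (x i)\<^sup>2) \<le> m t} = {}"
          by (auto simp: not_le simp del: sum.op_ivl_Suc intro: less_le_trans)
        then show ?thesis using False by (simp only: emeasure_empty if_False mult_zero_right)
      qed
    qed
  qed
  also have "\<dots> = ennreal (unit_ball_vol k) * (\<integral>\<^sup>+t. (if m t > 0 then ennreal (sqrt (m t) ^ k) else 0) \<partial>lborel)"
    by (rule nn_integral_cmult[OF gm])
  finally show ?thesis unfolding M .
qed

definition slice :: "nat \<Rightarrow> real \<Rightarrow> ennreal" where
  "slice k t = (if 1 - t\<^sup>2 > 0 then ennreal (sqrt (1 - t\<^sup>2) ^ k) else 0)"

lemma measurable_slice [measurable]: "slice k \<in> borel_measurable borel"
  unfolding slice_def by measurable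

text \<open>
  Up to the factor \<^term>\<open>unit_ball_vol k\<close>, the volume of the part of the unit ball in dimension
  \<open>k + 1\<close> whose first coordinate lies in \<open>S\<close>.
\<close>

definition slab :: "nat \<Rightarrow> real set \<Rightarrow> ennreal" where
  "slab k S = (\<integral>\<^sup>+t. slice k t * indicator S t \<partial>lborel)"

lemma slab_union:
  assumes "S \<in> sets borel" "T \<in> sets borel" "S \<inter> T = {}"
  shows "slab k (S \<union> T) = slab k S + slab k T"
proof -
  have [measurable]: "S \<in> sets borel" "T \<in> sets borel" using assms by auto
  have "slab k (S \<union> T) = (\<integral>\<^sup>+t. slice k t * indicator S t + slice k t * indicator T t \<partial>lborel)"
    unfolding slab_def using assms(3)
    by (intro nn_integral_cong) (auto simp: indicator_def)
  also have "\<dots> = slab k S + slab k T" unfolding slab_def by (rule nn_integral_add) measurable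
  finally show ?thesis .
qed

lemma slab_singleton: "slab k {a} = 0"
proof -
  have "AE t in lborel. t \<notin> {a}" by (intro AE_not_in countable_imp_null_set_lborel) auto
  then have "AE t in lborel. slice k t * indicator {a} t = 0" by eventually_elim auto
  then show ?thesis unfolding slab_def by (subst nn_integral_0_iff_AE) auto
qed

lemma slab_reflect: "slab k (uminus ` S) = slab k S" if [measurable]: "S \<in> sets borel"
proof -
  have "slab k S = (\<integral>\<^sup>+t. slice k (0 + (-1) * t) * indicator S (0 + (-1) * t) \<partial>lborel)"
    unfolding slab_def by (subst nn_integral_real_affine[where c = "-1" and t = 0]) auto
  also have "\<dots> = slab k (uminus ` S)"
    unfolding slab_def by (intro nn_integral_cong) (auto simp: slice_def indicator_def image_iff)
  finally show ?thesis by simp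
qed

text \<open>
  The hyperplane at height \<open>1/2\<close>, halfway between the two centres, cuts the half-ball of positive
  height into an inner and an outer part.  All volumes below are expressed through these two.
\<close>

definition inner_slab :: "nat \<Rightarrow> ennreal" where "inner_slab k = slab k {0..1/2}"
definition outer_slab :: "nat \<Rightarrow> ennreal" where "outer_slab k = slab k {1/2<..}"

lemma slab_pos: "slab k {0<..} = inner_slab k + outer_slab k"
proof -
  have "slab k ({0} \<union> {0<..}) = slab k {0<..}"
    by (subst slab_union) (auto simp: slab_singleton)
  moreover have "{0} \<union> {0<..} = {0..1/2} \<union> ({1/2<..} :: real set)" by auto
  ultimately have "slab k {0<..} = slab k ({0..1/2} \<union> {1/2<..})" by simp
  also have "\<dots> = inner_slab k + outer_slab k"
    unfolding inner_slab_def outer_slab_def by (subst slab_union) auto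
  finally show ?thesis .
qed

lemma slab_neg: "slab k {..<0} = inner_slab k + outer_slab k"
proof -
  have "uminus ` {0::real<..} = {..<0}"
  proof
    show "{..<0} \<subseteq> uminus ` {0::real<..}"
      by (auto intro!: image_eqI[where x = "- x" for x])
  qed auto
  then show ?thesis using slab_reflect[of "{0<..}" k] slab_pos[of k] by simp
qed

lemma slab_left: "slab k {..1/2} = 2 * inner_slab k + outer_slab k"
proof -
  have eq: "{..1/2::real} = {..<0} \<union> {0..1/2}" by auto
  have "slab k {..1/2} = slab k {..<0} + slab k {0..1/2}"
    unfolding eq by (rule slab_union) auto
  then show ?thesis unfolding slab_neg inner_slab_def[symmetric] mult_2 by (simp only: ac_simps)
qed

lemma slab_all: "slab k UNIV = 2 * (inner_slab k + outer_slab k)"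
proof -
  have eq: "(UNIV :: real set) = {..1/2} \<union> {1/2<..}" by auto
  have "slab k UNIV = slab k {..1/2} + slab k {1/2<..}"
    unfolding eq by (rule slab_union) auto
  then show ?thesis unfolding slab_left outer_slab_def[symmetric] mult_2 by (simp only: ac_simps)
qed

lemma unit_ball_Rd_slices:
  "unit_ball_Rd (Suc k) a = {x \<in> space (lebesgue_Rd (Suc k)).
     (\<Sum>i=1..<Suc k. (x i - a i)\<^sup>2) \<le> 1 - (x 0 - a 0)\<^sup>2}"
proof -
  have "(\<Sum>i<Suc k. (x i - a i)\<^sup>2) = (x 0 - a 0)\<^sup>2 + (\<Sum>i=1..<Suc k. (x i - a i)\<^sup>2)" for x
    unfolding lessThan_Suc_eq_insert_0_Icc by (subst sum.insert) auto
  then show ?thesis unfolding unit_ball_Rd_def L2_set_def by (auto simp: real_sqrt_le_1_iff algebra_simps)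
qed

lemma emeasure_unit_ball_Rd:
  "emeasure (lebesgue_Rd (Suc k)) (unit_ball_Rd (Suc k) (\<lambda>_. 0)) =
    ennreal (unit_ball_vol k) * (2 * (inner_slab k + outer_slab k))"
proof -
  have "AE t in lborel. t \<notin> {-1, 1::real}" by (intro AE_not_in countable_imp_null_set_lborel) auto
  then have nz: "AE t in lborel. 1 - t\<^sup>2 \<noteq> (0::real)"
    by eventually_elim (auto simp: power2_eq_1_iff)
  have "emeasure (lebesgue_Rd (Suc k)) (unit_ball_Rd (Suc k) (\<lambda>_. 0)) =
      ennreal (unit_ball_vol k) * (\<integral>\<^sup>+t. (if 1 - t\<^sup>2 > 0 then ennreal (sqrt (1 - t\<^sup>2) ^ k) else 0) \<partial>lborel)"
    unfolding unit_ball_Rd_slices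
    using emeasure_slices[of "\<lambda>t. 1 - t\<^sup>2" k, OF _ nz] by simp
  also have "(\<integral>\<^sup>+t. (if 1 - t\<^sup>2 > 0 then ennreal (sqrt (1 - t\<^sup>2) ^ k) else 0) \<partial>lborel) = slab k UNIV"
    unfolding slab_def slice_def by simp
  finally show ?thesis unfolding slab_all .
qed

abbreviation e0 :: "nat \<Rightarrow> real" where "e0 \<equiv> \<lambda>i. if i = 0 then 1 else 0"

text \<open>
  Below the height \<open>1/2\<close> the union of the two balls coincides with the first ball, and the reflection at that
  height exchanges the two halves of the union.
\<close>

lemma emeasure_union_Rd:
  "emeasure (lebesgue_Rd (Suc k)) (unit_ball_Rd (Suc k) (\<lambda>_. 0) \<union> unit_ball_Rd (Suc k) e0) =
    ennreal (unit_ball_vol k) * (2 * (2 * inner_slab k + outer_slab k))"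
proof -
  define m where "m = (\<lambda>t::real. max (1 - t\<^sup>2) (1 - (t - 1)\<^sup>2))"
  have [measurable]: "m \<in> borel_measurable borel" unfolding m_def by measurable
  have "AE t in lborel. t \<notin> {-1, 0, 1, 2::real}" by (intro AE_not_in countable_imp_null_set_lborel) auto
  then have nz: "AE t in lborel. m t \<noteq> 0"
  proof eventually_elim
    case (elim t)
    have "1 - t\<^sup>2 \<noteq> 0" using elim by (auto simp: power2_eq_1_iff)
    moreover have "1 - (t - 1)\<^sup>2 \<noteq> 0" using elim by (auto simp: power2_eq_1_iff)
    ultimately show ?case by (auto simp: m_def max_def)
  qed
  have m1: "m t = 1 - t\<^sup>2" if "t \<le> 1/2" for t
    using that by (auto simp: m_def max_def power2_eq_square algebra_simps)
  have m2: "m t = 1 - (1 - t)\<^sup>2" if "\<not> t \<le> 1/2" for t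
    using that by (auto simp: m_def max_def power2_eq_square algebra_simps)
  have sum_e0: "(\<Sum>i=1..<Suc k. (x i - e0 i)\<^sup>2) = (\<Sum>i=1..<Suc k. (x i)\<^sup>2)" for x :: "nat \<Rightarrow> real"
    by (intro sum.cong) auto
  have "unit_ball_Rd (Suc k) (\<lambda>_. 0) \<union> unit_ball_Rd (Suc k) e0 =
      {x \<in> space (lebesgue_Rd (Suc k)). (\<Sum>i=1..<Suc k. (x i)\<^sup>2) \<le> m (x 0)}"
    unfolding unit_ball_Rd_slices sum_e0 m_def by (auto simp: le_max_iff_disj)
  then have "emeasure (lebesgue_Rd (Suc k)) (unit_ball_Rd (Suc k) (\<lambda>_. 0) \<union> unit_ball_Rd (Suc k) e0) =
      ennreal (unit_ball_vol k) * (\<integral>\<^sup>+t. (if m t > 0 then ennreal (sqrt (m t) ^ k) else 0) \<partial>lborel)"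
    using emeasure_slices[OF _ nz, of k] by simp
  also have "(\<integral>\<^sup>+t. (if m t > 0 then ennreal (sqrt (m t) ^ k) else 0) \<partial>lborel) =
      (\<integral>\<^sup>+t. slice k t * indicator {..1/2} t + slice k (1 - t) * indicator {1/2<..} t \<partial>lborel)"
    by (intro nn_integral_cong) (auto simp: slice_def m1 m2 indicator_def)
  also have "\<dots> = slab k {..1/2} + (\<integral>\<^sup>+t. slice k (1 - t) * indicator {1/2<..} t \<partial>lborel)"
    unfolding slab_def by (rule nn_integral_add) measurable
  also have "(\<integral>\<^sup>+t. slice k (1 - t) * indicator {1/2<..} t \<partial>lborel) =
      (\<integral>\<^sup>+t. slice k t * indicator {..<1/2} t \<partial>lborel)"
    by (subst nn_integral_real_affine[where c = "-1" and t = 1])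
      (auto intro!: nn_integral_cong simp: indicator_def)
  also have "\<dots> = slab k {..<1/2}" by (simp add: slab_def)
  also have "slab k {..<1/2} = slab k {..1/2}"
  proof -
    have eq: "{..1/2::real} = {..<1/2} \<union> {1/2}" by auto
    have "slab k {..1/2} = slab k {..<1/2} + slab k {1/2}"
      unfolding eq by (rule slab_union) auto
    then show ?thesis by (simp add: slab_singleton)
  qed
  finally show ?thesis
    unfolding slab_left by (simp only: mult_2[of "2 * inner_slab k + outer_slab k"])
qed

lemma slab_le:
  assumes "S \<subseteq> {a..b}" "a \<le> b" "\<And>t. t \<in> S \<Longrightarrow> 1 - t\<^sup>2 > 0 \<Longrightarrow> sqrt (1 - t\<^sup>2) \<le> q" "q \<ge> 0"
  shows "slab k S \<le> ennreal (q ^ k * (b - a))"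
proof -
  have "slab k S \<le> (\<integral>\<^sup>+t. ennreal (q ^ k) * indicator {a..b} t \<partial>lborel)"
    unfolding slab_def slice_def
  proof (rule nn_integral_mono)
    fix t
    show "(if 1 - t\<^sup>2 > 0 then ennreal (sqrt (1 - t\<^sup>2) ^ k) else 0) * indicator S t
        \<le> ennreal (q ^ k) * indicator {a..b} t"
      using assms by (auto simp: indicator_def intro!: ennreal_leI power_mono)
  qed
  also have "\<dots> = ennreal (q ^ k * (b - a))"
    using assms by (simp add: nn_integral_cmult_indicator ennreal_mult)
  finally show ?thesis .
qed

lemma slab_ge:
  assumes "{a..b} \<subseteq> S" "a \<le> b" "\<And>t. t \<in> {a..b} \<Longrightarrow> 1 - t\<^sup>2 > 0 \<and> q \<le> sqrt (1 - t\<^sup>2)" "q \<ge> 0"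
  shows "ennreal (q ^ k * (b - a)) \<le> slab k S"
proof -
  have "ennreal (q ^ k * (b - a)) = (\<integral>\<^sup>+t. ennreal (q ^ k) * indicator {a..b} t \<partial>lborel)"
    using assms by (simp add: nn_integral_cmult_indicator ennreal_mult)
  also have "\<dots> \<le> slab k S"
    unfolding slab_def slice_def
  proof (rule nn_integral_mono)
    fix t
    show "ennreal (q ^ k) * indicator {a..b} t
       \<le> (if 1 - t\<^sup>2 > 0 then ennreal (sqrt (1 - t\<^sup>2) ^ k) else 0) * indicator S t"
    proof (cases "t \<in> {a..b}")
      case True
      then show ?thesis using assms(1) assms(3)[OF True] assms(4)
        by (auto simp: indicator_def intro!: ennreal_leI power_mono)
    qed simp
  qed
  finally show ?thesis .
qed

lemma sqrt_slice_le: "sqrt (1 - t\<^sup>2) \<le> sqrt (3/4)" if "t \<ge> 1/2" for t :: real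
proof -
  have "(1/2)\<^sup>2 \<le> t\<^sup>2" using that by (intro power_mono) auto
  then show ?thesis by (simp add: power2_eq_square)
qed

lemma one_minus_square_ge: "1 - t\<^sup>2 \<ge> 1 - r\<^sup>2" if "t \<in> {0..r}" for t :: real
  using that by (simp add: power_mono)

definition inner_vol :: "nat \<Rightarrow> real" where "inner_vol k = enn2real (inner_slab k)"
definition outer_vol :: "nat \<Rightarrow> real" where "outer_vol k = enn2real (outer_slab k)"

lemma outer_slab_eq: "outer_slab k = slab k {1/2<..1}"
  unfolding outer_slab_def slab_def
proof (intro nn_integral_cong)
  fix t :: real
  have "\<not> 1 - t\<^sup>2 > 0" if "t > 1" using that by (simp add: power2_eq_square) (smt (verit) mult_less_cancel_left1)
  then show "slice k t * indicator {1/2<..} t = slice k t * indicator {1/2<..1} t"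
    by (auto simp: slice_def indicator_def)
qed

lemma outer_slab_le: "outer_slab k \<le> ennreal (sqrt (3/4) ^ k / 2)"
proof -
  have "slab k {1/2<..1} \<le> ennreal (sqrt (3/4) ^ k * (1 - 1/2))"
    by (rule slab_le) (auto intro!: sqrt_slice_le[simplified])
  then show ?thesis by (simp add: outer_slab_eq)
qed

lemma inner_slab_le: "inner_slab k \<le> ennreal (1/2)"
proof -
  have "slab k {0..1/2} \<le> ennreal (1 ^ k * (1/2 - 0))"
    by (rule slab_le) auto
  then show ?thesis by (simp add: inner_slab_def)
qed

lemma inner_slab_ge: "ennreal (sqrt (15/16) ^ k / 4) \<le> inner_slab k"
proof -
  have "ennreal (sqrt (15/16) ^ k * (1/4 - 0)) \<le> slab k {0..1/2}"
  proof (rule slab_ge)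
    fix t :: real assume "t \<in> {0..1/4}"
    from one_minus_square_ge[OF this] have "15/16 \<le> 1 - t\<^sup>2" by (simp add: power2_eq_square)
    then show "1 - t\<^sup>2 > 0 \<and> sqrt (15/16) \<le> sqrt (1 - t\<^sup>2)" by simp
  qed auto
  then show ?thesis by (simp add: inner_slab_def)
qed

lemma inner_slab_vol: "inner_slab k = ennreal (inner_vol k)"
  using inner_slab_le[of k] unfolding inner_vol_def by (metis ennreal_enn2real ennreal_less_top order_le_less_trans)

lemma outer_slab_vol: "outer_slab k = ennreal (outer_vol k)"
  using outer_slab_le[of k] unfolding outer_vol_def by (metis ennreal_enn2real ennreal_less_top order_le_less_trans)

lemma inner_outer_vol_nonneg: "0 \<le> inner_vol k" "0 \<le> outer_vol k" by (simp_all add: inner_vol_def outer_vol_def)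

lemma inner_vol_ge: "sqrt (15/16) ^ k / 4 \<le> inner_vol k"
  using inner_slab_ge[of k] unfolding inner_slab_vol by (simp add: inner_outer_vol_nonneg)

lemma inner_vol_pos: "0 < inner_vol k"
proof -
  have "0 < sqrt (15/16) ^ k / 4" by simp
  then show ?thesis using inner_vol_ge[of k] by linarith
qed

lemma outer_vol_le: "outer_vol k \<le> sqrt (3/4) ^ k / 2"
  using outer_slab_le[of k] unfolding outer_slab_vol by (simp add: inner_outer_vol_nonneg)

lemma inner_vol_le: "inner_vol k \<le> 1/2"
  using inner_slab_le[of k] unfolding inner_slab_vol by (subst (asm) ennreal_le_iff) auto

lemma measure_unit_ball_Rd:
  "measure (lebesgue_Rd (Suc k)) (unit_ball_Rd (Suc k) (\<lambda>_. 0)) = unit_ball_vol k * (2 * (inner_vol k + outer_vol k))"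
  unfolding measure_def emeasure_unit_ball_Rd inner_slab_vol outer_slab_vol
  using inner_outer_vol_nonneg[of k] unit_ball_vol_nonneg[of "real k"]
  by (simp add: enn2real_mult ennreal_plus[symmetric] del: ennreal_plus)

lemma measure_union_Rd:
  "measure (lebesgue_Rd (Suc k)) (unit_ball_Rd (Suc k) (\<lambda>_. 0) \<union> unit_ball_Rd (Suc k) e0) =
    unit_ball_vol k * (2 * (2 * inner_vol k + outer_vol k))"
  unfolding measure_def emeasure_union_Rd inner_slab_vol outer_slab_vol
proof -
  have two: "2 * ennreal z = ennreal (2 * z)" if "0 \<le> z" for z
    using that by (simp add: ennreal_mult)
  have nn: "0 \<le> inner_vol k" "0 \<le> outer_vol k" "0 \<le> 2 * inner_vol k + outer_vol k" using inner_outer_vol_nonneg[of k] by simp_all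
  have "2 * ennreal (inner_vol k) + ennreal (outer_vol k) = ennreal (2 * inner_vol k + outer_vol k)"
    unfolding two[OF nn(1)] using nn by (intro ennreal_plus[symmetric]) auto
  then show "enn2real (ennreal (unit_ball_vol k) * (2 * (2 * ennreal (inner_vol k) + ennreal (outer_vol k)))) =
      unit_ball_vol k * (2 * (2 * inner_vol k + outer_vol k))"
    using nn(3) by (simp only: two[OF nn(3)] enn2real_mult enn2real_ennreal unit_ball_vol_nonneg
      mult_nonneg_nonneg zero_le_numeral of_nat_0_le_iff)
qed

text \<open>
  With \<open>A\<close> and \<open>B\<close> the inner and outer parts, the ball has volume \<open>2 (A + B)\<close> and the union \<open>2 (2 A + B)\<close>
  in the same units, so the constant is an increasing function of \<open>B / A\<close>.
\<close>

lemma c_const_Suc: "c_const (Suc k) = (inner_vol k + outer_vol k) / (2 * (2 * inner_vol k + outer_vol k))"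
proof -
  have "0 < unit_ball_vol (real k)" by simp
  then have v: "unit_ball_vol (real k) \<noteq> 0" by linarith
  have "unit_ball_vol (real k) * (2 * (inner_vol k + outer_vol k)) / (unit_ball_vol (real k) * (2 * (2 * inner_vol k + outer_vol k)))
      = (inner_vol k + outer_vol k) / (2 * inner_vol k + outer_vol k)"
    by (subst mult_divide_mult_cancel_left[OF v], subst mult_divide_mult_cancel_left) simp_all
  then show ?thesis
    unfolding c_const_def b_const_def measure_unit_ball_Rd measure_union_Rd by simp
qed

text \<open>
  Passing to the next dimension multiplies the integrand by \<open>sqrt (1 - t\<^sup>2)\<close>, which is at most
  \<open>sqrt (3/4)\<close> on the outer part and at least \<open>sqrt (3/4)\<close> on the inner part.  Hence \<open>B / A\<close> decreases with the
  dimension.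
\<close>

lemma outer_vol_Suc: "outer_vol (Suc k) \<le> sqrt (3/4) * outer_vol k"
proof -
  have "outer_slab (Suc k) \<le> (\<integral>\<^sup>+t. ennreal (sqrt (3/4)) * (slice k t * indicator {1/2<..} t) \<partial>lborel)"
    unfolding outer_slab_def slab_def
  proof (rule nn_integral_mono)
    fix t :: real
    show "slice (Suc k) t * indicator {1/2<..} t \<le> ennreal (sqrt (3/4)) * (slice k t * indicator {1/2<..} t)"
    proof (cases "t > 1/2 \<and> 1 - t\<^sup>2 > 0")
      case True
      have "sqrt (1 - t\<^sup>2) ^ Suc k \<le> sqrt (3/4) * sqrt (1 - t\<^sup>2) ^ k"
        using sqrt_slice_le[of t] True by (auto intro!: mult_right_mono)
      then show ?thesis using True by (simp add: slice_def ennreal_mult[symmetric] ennreal_leI)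
    qed (auto simp: slice_def indicator_def)
  qed
  also have "\<dots> = ennreal (sqrt (3/4)) * outer_slab k"
    unfolding outer_slab_def slab_def by (rule nn_integral_cmult) measurable
  finally show ?thesis
    unfolding outer_slab_vol using inner_outer_vol_nonneg[of k]
    by (simp add: ennreal_mult[symmetric] ennreal_le_iff)
qed

lemma inner_vol_Suc: "sqrt (3/4) * inner_vol k \<le> inner_vol (Suc k)"
proof -
  have "ennreal (sqrt (3/4)) * inner_slab k = (\<integral>\<^sup>+t. ennreal (sqrt (3/4)) * (slice k t * indicator {0..1/2} t) \<partial>lborel)"
    unfolding inner_slab_def slab_def by (rule nn_integral_cmult[symmetric]) measurable
  also have "\<dots> \<le> inner_slab (Suc k)"
    unfolding inner_slab_def slab_def
  proof (rule nn_integral_mono)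
    fix t :: real
    show "ennreal (sqrt (3/4)) * (slice k t * indicator {0..1/2} t) \<le> slice (Suc k) t * indicator {0..1/2} t"
    proof (cases "t \<in> {0..1/2}")
      case True
      from one_minus_square_ge[OF this] have t: "3/4 \<le> 1 - t\<^sup>2" by (simp add: power2_eq_square)
      then have "sqrt (3/4) * sqrt (1 - t\<^sup>2) ^ k \<le> sqrt (1 - t\<^sup>2) ^ Suc k"
        by (auto intro!: mult_right_mono)
      then show ?thesis using True t by (simp add: slice_def ennreal_mult[symmetric] ennreal_leI)
    qed (auto simp: indicator_def)
  qed
  finally show ?thesis
    unfolding inner_slab_vol using inner_outer_vol_nonneg[of k] inner_outer_vol_nonneg[of "Suc k"]
    by (simp add: ennreal_mult[symmetric] ennreal_le_iff)
qed

lemma decseq_c_const: "decseq (\<lambda>d. c_const (Suc d))"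
proof (rule decseq_SucI)
  fix k
  have "inner_vol k * outer_vol (Suc k) \<le> inner_vol k * (sqrt (3/4) * outer_vol k)"
    by (intro mult_left_mono outer_vol_Suc inner_outer_vol_nonneg)
  also have "\<dots> = (sqrt (3/4) * inner_vol k) * outer_vol k" by simp
  also have "\<dots> \<le> inner_vol (Suc k) * outer_vol k" by (intro mult_right_mono inner_vol_Suc inner_outer_vol_nonneg)
  finally have "inner_vol k * outer_vol (Suc k) \<le> inner_vol (Suc k) * outer_vol k" .
  moreover have "2 * inner_vol k + outer_vol k > 0" "2 * inner_vol (Suc k) + outer_vol (Suc k) > 0"
    using inner_vol_pos[of k] inner_outer_vol_nonneg[of k] inner_vol_pos[of "Suc k"] inner_outer_vol_nonneg[of "Suc k"] by linarith+
  ultimately show "c_const (Suc (Suc k)) \<le> c_const (Suc k)"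
    unfolding c_const_Suc by (simp add: field_simps)
qed

text \<open>
  The constant exceeds \<open>1/4\<close> by at most \<open>B / (8 A)\<close>.  The inner part contains the slab of heights in
  \<open>[0, 1/4]\<close>, where \<open>sqrt (1 - t\<^sup>2) \<ge> sqrt (15/16)\<close>, and on the outer part it is at most \<open>sqrt (3/4)\<close>, so
  \<open>B / A\<close> decays geometrically.
\<close>

lemma c_const_limit: "c_const \<longlonglongrightarrow> 1 / 4"
proof -
  have "(\<lambda>k. c_const (Suc k)) \<longlonglongrightarrow> 1 / 4"
  proof (rule tendsto_sandwich[where f = "\<lambda>_. 1/4" and h = "\<lambda>k. 1/4 + (sqrt (3/4) / sqrt (15/16)) ^ k / 4"])
    have lower: "1/4 \<le> c_const (Suc k)" for k
    proof -
      have "2 * inner_vol k + outer_vol k > 0" using inner_vol_pos[of k] inner_outer_vol_nonneg[of k] by linarith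
      then show ?thesis unfolding c_const_Suc using inner_outer_vol_nonneg[of k] by (simp add: field_simps)
    qed
    then show "\<forall>\<^sub>F k in sequentially. 1/4 \<le> c_const (Suc k)" by simp
    have upper: "c_const (Suc k) \<le> 1/4 + (sqrt (3/4) / sqrt (15/16)) ^ k / 4" for k
    proof -
      have p: "2 * inner_vol k + outer_vol k > 0" using inner_vol_pos[of k] inner_outer_vol_nonneg[of k] by linarith
      have "c_const (Suc k) = 1/4 + outer_vol k / (4 * (2 * inner_vol k + outer_vol k))"
        unfolding c_const_Suc using p by (simp add: field_simps)
      also have "outer_vol k / (4 * (2 * inner_vol k + outer_vol k)) \<le> outer_vol k / (8 * inner_vol k)"
        using inner_outer_vol_nonneg[of k] inner_vol_pos[of k] by (intro divide_left_mono) auto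
      also have "\<dots> \<le> (sqrt (3/4) ^ k / 2) / (8 * (sqrt (15/16) ^ k / 4))"
        using outer_vol_le[of k] inner_vol_ge[of k] inner_outer_vol_nonneg[of k] by (intro frac_le) auto
      also have "\<dots> = (sqrt (3/4) / sqrt (15/16)) ^ k / 4" by (simp add: power_divide)
      finally show ?thesis by simp
    qed
    then show "\<forall>\<^sub>F k in sequentially. c_const (Suc k) \<le> 1/4 + (sqrt (3/4) / sqrt (15/16)) ^ k / 4" by simp
    have "sqrt (3/4) < sqrt (15/16)" by (rule real_sqrt_less_mono) simp
    then have "(\<lambda>k. (sqrt (3/4) / sqrt (15/16)) ^ k) \<longlonglongrightarrow> 0"
      by (intro LIMSEQ_realpow_zero) auto
    from tendsto_add[OF tendsto_const[of "1/4"] tendsto_divide[OF this tendsto_const[of 4]]]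
    show "(\<lambda>k. 1/4 + (sqrt (3/4) / sqrt (15/16)) ^ k / 4) \<longlonglongrightarrow> 1 / 4" by simp
  qed simp
  then show ?thesis by (rule LIMSEQ_imp_Suc)
qed

lemma c_const_1: "c_const 1 = 1 / 3"
proof -
  have "inner_slab 0 = ennreal (1/2)"
  proof (rule antisym[OF inner_slab_le])
    have "ennreal (0 ^ 0 * (1/2 - 0)) \<le> slab 0 {0..1/2}"
    proof (rule slab_ge)
      fix t :: real assume "t \<in> {0..1/2}"
      from one_minus_square_ge[OF this] show "1 - t\<^sup>2 > 0 \<and> 0 \<le> sqrt (1 - t\<^sup>2)" by (simp add: power2_eq_square)
    qed auto
    then show "ennreal (1/2) \<le> inner_slab 0" by (simp add: inner_slab_def)
  qed
  then have i: "inner_vol 0 = 1/2" unfolding inner_vol_def by (simp only: enn2real_ennreal)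
  have "outer_slab 0 = ennreal (1/2)"
  proof (rule antisym)
    show "outer_slab 0 \<le> ennreal (1/2)" using outer_slab_le[of 0] by simp
    have "ennreal (1/2) = (\<integral>\<^sup>+t. indicator {1/2<..<1::real} t \<partial>lborel)" by simp
    also have "\<dots> \<le> slab 0 {1/2<..}"
      unfolding slab_def slice_def
    proof (rule nn_integral_mono)
      fix t :: real
      have "1 - t\<^sup>2 > 0" if "1/2 < t" "t < 1" using that power_strict_mono[of t 1 2] by simp
      then show "indicator {1/2<..<1} t \<le> (if 1 - t\<^sup>2 > 0 then ennreal (sqrt (1 - t\<^sup>2) ^ 0) else 0) * indicator {1/2<..} t"
        by (auto simp: indicator_def)
    qed
    finally show "ennreal (1/2) \<le> outer_slab 0" by (simp add: outer_slab_def)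
  qed
  then have "outer_vol 0 = 1/2" unfolding outer_vol_def by (simp only: enn2real_ennreal)
  with i show ?thesis using c_const_Suc[of 0] by simp
qed

text \<open>
  In dimension \<open>2\<close> one has \<open>A + B = \<pi> / 4\<close>, so the constant is \<open>\<pi> / (2 (\<pi> + 4 A))\<close>.  The bounds
  \<open>0.475 \<le> A \<le> 0.5\<close> suffice; the lower one comes from \<open>1 - 0.6 t\<^sup>2 \<le> sqrt (1 - t\<^sup>2)\<close> on \<open>[0, 1/2]\<close>.
\<close>

lemma c_const_2: "\<bar>c_const 2 - 0.31\<bar> \<le> 0.005"
proof -
  have "emeasure (lebesgue_Rd 2) (unit_ball_Rd 2 (\<lambda>_. 0)) = ennreal (unit_ball_vol (real (card {..<2::nat})) * 1 ^ card {..<2::nat})"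
    unfolding lebesgue_Rd_def unit_ball_Rd_def L2_set_def
    by (subst emeasure_cball_aux[symmetric]) (auto intro!: arg_cong2[where f = emeasure])
  then have "measure (lebesgue_Rd 2) (unit_ball_Rd 2 (\<lambda>_. 0)) = pi"
    by (simp add: measure_def unit_ball_vol_2)
  moreover have "measure (lebesgue_Rd 2) (unit_ball_Rd 2 (\<lambda>_. 0)) = 4 * (inner_vol 1 + outer_vol 1)"
    using measure_unit_ball_Rd[of 1, unfolded Suc_1] by simp
  ultimately have sum: "inner_vol 1 + outer_vol 1 = pi / 4" by simp
  have "ennreal (0.475) \<le> inner_slab 1"
  proof -
    define F where "F = (\<lambda>t::real. t - 0.2 * t ^ 3)"
    have "(\<integral>\<^sup>+t. ennreal (1 - 0.6 * t\<^sup>2) * indicator {0..1/2} t \<partial>lborel) = ennreal (F (1/2) - F 0)"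
    proof (rule nn_integral_FTC_Icc)
      fix t :: real assume "t \<in> {0..1/2}"
      then have t: "0 \<le> t" "t \<le> 1/2" by auto
      show "(F has_real_derivative 1 - 0.6 * t\<^sup>2) (at t)"
        unfolding F_def by (auto intro!: derivative_eq_intros simp: power2_eq_square)
      have "t\<^sup>2 \<le> (1/2)\<^sup>2" using t by (intro power_mono) auto
      then show "0 \<le> 1 - 0.6 * t\<^sup>2" by (simp add: power2_eq_square)
    qed auto
    moreover have "F (1/2) - F 0 = 0.475" by (simp add: F_def power3_eq_cube)
    moreover have "(\<integral>\<^sup>+t. ennreal (1 - 0.6 * t\<^sup>2) * indicator {0..1/2} t \<partial>lborel) \<le> inner_slab 1"
      unfolding inner_slab_def slab_def slice_def
    proof (rule nn_integral_mono)
      fix t :: real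
      show "ennreal (1 - 0.6 * t\<^sup>2) * indicator {0..1/2} t
        \<le> (if 1 - t\<^sup>2 > 0 then ennreal (sqrt (1 - t\<^sup>2) ^ 1) else 0) * indicator {0..1/2} t"
      proof (cases "t \<in> {0..1/2}")
        case True
        from one_minus_square_ge[OF this] have t: "3/4 \<le> 1 - t\<^sup>2" by (simp add: power2_eq_square)
        define u where "u = t\<^sup>2"
        have u: "0 \<le> u" "u \<le> 1/4" using t by (auto simp: u_def)
        have "u * (0.36 * u) \<le> u * 0.2" using u by (intro mult_left_mono) auto
        then have "(1 - 0.6 * u)\<^sup>2 \<le> 1 - u" by (simp add: power2_eq_square algebra_simps)
        then have "1 - 0.6 * t\<^sup>2 \<le> sqrt (1 - t\<^sup>2)" by (intro real_le_rsqrt) (simp add: u_def)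
        then show ?thesis using True t by (auto intro!: ennreal_leI)
      qed simp
    qed
    ultimately show ?thesis by (simp only:)
  qed
  then have i: "0.475 \<le> inner_vol 1" unfolding inner_slab_vol by (simp add: inner_outer_vol_nonneg)
  have i2: "inner_vol 1 \<le> 0.5" using inner_vol_le[of 1] by simp
  have "2 * inner_vol 1 + outer_vol 1 = pi / 4 + inner_vol 1" using sum by linarith
  then have c: "c_const 2 = (pi / 4) / (2 * (pi / 4 + inner_vol 1))"
    using c_const_Suc[of 1, unfolded Suc_1] by (simp only: sum)
  have pi: "3.14 \<le> pi" "pi \<le> 3.15" using pi_approx by simp_all
  have "c_const 2 \<le> 0.315" unfolding c using pi i by (simp add: field_simps)
  moreover have "0.305 \<le> c_const 2" unfolding c using pi i i2 by (simp add: field_simps)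
  ultimately show ?thesis unfolding abs_le_iff by (intro conjI) simp_all
qed

section \<open>Balls in Euclidean space\<close>

text \<open>
  The product measure that defines the constant agrees with Lebesgue measure on the type of vectors
  once the coordinates are numbered.
\<close>

lemma PiM_lborel_eq_lborel:
  fixes h :: "nat \<Rightarrow> 'n::finite"
  assumes h: "bij_betw h {..<CARD('n)} UNIV"
  defines "T \<equiv> \<lambda>g :: nat \<Rightarrow> real. \<chi> j. g (inv_into {..<CARD('n)} h j)"
  shows "T \<in> lebesgue_Rd CARD('n) \<rightarrow>\<^sub>M borel"
    and "lborel = distr (lebesgue_Rd CARD('n)) borel T"
proof -
  interpret product_sigma_finite "\<lambda>_. lborel :: real measure" by standard
  let ?I = "{..<CARD('n)}"
  let ?k = "inv_into ?I h"
  have k: "bij_betw ?k UNIV ?I" by (rule bij_betw_inv_into[OF h])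
  have kI: "?k j \<in> ?I" for j using k by (auto simp: bij_betw_def)
  show m: "T \<in> lebesgue_Rd CARD('n) \<rightarrow>\<^sub>M borel"
  proof (rule borel_measurable_euclidean_space[THEN iffD2], intro ballI)
    fix b :: "real ^ 'n" assume "b \<in> Basis"
    then obtain j where b: "b = axis j 1" by (auto simp: Basis_vec_def)
    have "(\<lambda>g. g (?k j)) \<in> lebesgue_Rd CARD('n) \<rightarrow>\<^sub>M borel"
      unfolding lebesgue_Rd_def using measurable_component_singleton[OF kI[of j], of "\<lambda>_. lborel :: real measure"] by simp
    then show "(\<lambda>g. T g \<bullet> b) \<in> lebesgue_Rd CARD('n) \<rightarrow>\<^sub>M borel" by (simp add: b inner_axis T_def)
  qed
  show "lborel = distr (lebesgue_Rd CARD('n)) borel T"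
  proof (rule lborel_eqI)
    fix l u :: "real ^ 'n" assume le: "\<And>b. b \<in> Basis \<Longrightarrow> l \<bullet> b \<le> u \<bullet> b"
    have lu: "l $ j \<le> u $ j" for j using le[of "axis j 1"] by (simp add: inner_axis axis_in_Basis_iff)
    have hk: "h (?k j) = j" for j by (rule bij_betw_inv_into_right[OF h]) simp
    have kh: "?k (h i) = i" if "i \<in> ?I" for i by (rule bij_betw_inv_into_left[OF h that])
    have eq: "T -` box l u \<inter> space (lebesgue_Rd CARD('n)) = (\<Pi>\<^sub>E i\<in>?I. {l $ h i<..<u $ h i})"
    proof -
      have "(\<forall>j. l $ j < x (?k j) \<and> x (?k j) < u $ j) \<longleftrightarrow> (\<forall>i\<in>?I. l $ h i < x i \<and> x i < u $ h i)" for x :: "nat \<Rightarrow> real"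
        using hk kh kI by metis
      then show ?thesis
        unfolding T_def lebesgue_Rd_def space_PiM
        by (auto simp: mem_box_cart PiE_iff)
    qed
    have "emeasure (distr (lebesgue_Rd CARD('n)) borel T) (box l u) =
        emeasure (lebesgue_Rd CARD('n)) (\<Pi>\<^sub>E i\<in>?I. {l $ h i<..<u $ h i})"
      by (subst emeasure_distr[OF m]) (simp_all add: eq)
    also have "\<dots> = (\<Prod>i\<in>?I. emeasure lborel {l $ h i<..<u $ h i})"
      unfolding lebesgue_Rd_def by (rule emeasure_PiM) auto
    also have "\<dots> = (\<Prod>i\<in>?I. ennreal (u $ h i - l $ h i))" using lu by (intro prod.cong) auto
    also have "\<dots> = ennreal (\<Prod>i\<in>?I. u $ h i - l $ h i)" using lu by (intro prod_ennreal) simp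
    also have "(\<Prod>i\<in>?I. u $ h i - l $ h i) = (\<Prod>j\<in>UNIV. (u - l) $ j)"
      using prod.reindex_bij_betw[OF h, of "\<lambda>j. (u - l) $ j"] by simp
    also have "\<dots> = (\<Prod>b\<in>Basis. (u - l) \<bullet> b)"
    proof -
      have "bij_betw (\<lambda>j::'n. axis j (1::real)) UNIV Basis"
        by (rule bij_betw_imageI) (auto simp: Basis_vec_def inj_on_def axis_eq_axis)
      from prod.reindex_bij_betw[OF this, of "\<lambda>b. (u - l) \<bullet> b"] show ?thesis
        by (simp add: inner_axis)
    qed
    finally show "emeasure (distr (lebesgue_Rd CARD('n)) borel T) (box l u) =
        ennreal (\<Prod>b\<in>Basis. (u - l) \<bullet> b)" .
  qed simp
qed

definition union_vol :: "nat \<Rightarrow> real" where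
  "union_vol d = measure (lebesgue_Rd d) (unit_ball_Rd d (\<lambda>_. 0) \<union> unit_ball_Rd d e0)"

lemma union_vol_pos: "d > 0 \<Longrightarrow> 0 < union_vol d"
proof -
  assume "d > 0"
  then obtain k where d: "d = Suc k" by (cases d) auto
  have "0 < unit_ball_vol (real k)" by simp
  moreover have "2 * inner_vol k + outer_vol k > 0" using inner_vol_pos[of k] inner_outer_vol_nonneg[of k] by linarith
  ultimately show ?thesis unfolding union_vol_def d measure_union_Rd by simp
qed

lemma b_const_eq: "b_const CARD('n::finite) = unit_ball_vol CARD('n) / union_vol CARD('n)"
proof -
  have "emeasure (lebesgue_Rd CARD('n)) (unit_ball_Rd CARD('n) (\<lambda>_. 0)) =
      ennreal (unit_ball_vol (real (card {..<CARD('n)})) * 1 ^ card {..<CARD('n)})"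
    unfolding lebesgue_Rd_def unit_ball_Rd_def L2_set_def
    by (subst emeasure_cball_aux[symmetric]) (auto intro!: arg_cong2[where f = emeasure])
  then show ?thesis unfolding b_const_def union_vol_def by (simp add: measure_def)
qed

lemma coordinates_ex:
  "\<exists>T :: (nat \<Rightarrow> real) \<Rightarrow> real ^ 'n. T \<in> lebesgue_Rd CARD('n) \<rightarrow>\<^sub>M borel \<and>
    lborel = distr (lebesgue_Rd CARD('n)) borel T \<and>
    (\<forall>a x. dist (T a) (T x) = L2_set (\<lambda>i. x i - a i) {..<CARD('n)}) \<and> T (\<lambda>_. 0) = 0 \<and> surj T"
proof -
  let ?d = "CARD('n)"
  obtain h :: "nat \<Rightarrow> 'n" where h: "bij_betw h {..<?d} UNIV"
    using ex_bij_betw_nat_finite[of "UNIV :: 'n set"] by (auto simp: atLeast0LessThan)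
  define T where "T = (\<lambda>g :: nat \<Rightarrow> real. \<chi> j. g (inv_into {..<?d} h j))"
  note T = PiM_lborel_eq_lborel[OF h, folded T_def]
  have k: "bij_betw (inv_into {..<?d} h) UNIV {..<?d}" by (rule bij_betw_inv_into[OF h])
  have dist: "dist (T a) (T x) = L2_set (\<lambda>i. x i - a i) {..<?d}" for a x
  proof -
    have "dist (T a) (T x) = sqrt (\<Sum>j\<in>UNIV. (x (inv_into {..<?d} h j) - a (inv_into {..<?d} h j))\<^sup>2)"
      by (simp add: dist_norm norm_vec_def L2_set_def T_def power2_commute)
    also have "\<dots> = sqrt (\<Sum>i<?d. (x i - a i)\<^sup>2)"
      using sum.reindex_bij_betw[OF k, of "\<lambda>i. (x i - a i)\<^sup>2"] by simp
    finally show ?thesis by (simp add: L2_set_def)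
  qed
  have "T (\<lambda>i. v $ h i) = v" for v
    by (simp add: T_def vec_eq_iff bij_betw_inv_into_right[OF h])
  then have "surj T" by (intro surjI[where f = "\<lambda>v i. v $ h i"])
  moreover have "T (\<lambda>_. 0) = 0" by (simp add: T_def vec_eq_iff)
  ultimately show ?thesis by (intro exI[of _ T] conjI allI T dist)
qed

lemma emeasure_union_cballs_coordinates:
  fixes T :: "(nat \<Rightarrow> real) \<Rightarrow> real ^ 'n"
  assumes T: "T \<in> lebesgue_Rd CARD('n) \<rightarrow>\<^sub>M borel" "lborel = distr (lebesgue_Rd CARD('n)) borel T"
    and dist: "\<And>a x. dist (T a) (T x) = L2_set (\<lambda>i. x i - a i) {..<CARD('n)}"
  shows "emeasure lborel (cball (T a) r \<union> cball (T b) r) =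
    emeasure (lebesgue_Rd CARD('n)) {x \<in> space (lebesgue_Rd CARD('n)).
      L2_set (\<lambda>i. x i - a i) {..<CARD('n)} \<le> r \<or> L2_set (\<lambda>i. x i - b i) {..<CARD('n)} \<le> r}"
proof -
  have "emeasure lborel (cball (T a) r \<union> cball (T b) r) =
      emeasure (lebesgue_Rd CARD('n)) (T -` (cball (T a) r \<union> cball (T b) r) \<inter> space (lebesgue_Rd CARD('n)))"
    by (subst T(2), subst emeasure_distr[OF T(1)]) auto
  also have "T -` (cball (T a) r \<union> cball (T b) r) \<inter> space (lebesgue_Rd CARD('n)) =
      {x \<in> space (lebesgue_Rd CARD('n)).
        L2_set (\<lambda>i. x i - a i) {..<CARD('n)} \<le> r \<or> L2_set (\<lambda>i. x i - b i) {..<CARD('n)} \<le> r}"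
    by (auto simp: dist)
  finally show ?thesis .
qed

lemma emeasure_union_unit_cballs:
  "\<exists>e :: real ^ 'n. norm e = 1 \<and>
    emeasure lborel (cball 0 1 \<union> cball e 1) = ennreal (union_vol CARD('n))"
proof -
  let ?d = "CARD('n)"
  obtain T :: "(nat \<Rightarrow> real) \<Rightarrow> real ^ 'n" where T: "T \<in> lebesgue_Rd CARD('n) \<rightarrow>\<^sub>M borel"
    "lborel = distr (lebesgue_Rd CARD('n)) borel T"
    and "\<forall>a x. dist (T a) (T x) = L2_set (\<lambda>i. x i - a i) {..<CARD('n)}" and T0: "T (\<lambda>_. 0) = 0"
    using coordinates_ex[where ?'n = 'n] by (elim exE conjE)
  note dist = this(3)[rule_format]
  have "norm (T e0) = dist (T (\<lambda>_. 0)) (T e0)" by (simp add: T0)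
  also have "\<dots> = sqrt (\<Sum>i<?d. if i = 0 then 1 else 0)"
    unfolding dist L2_set_def by (intro arg_cong[where f = sqrt] sum.cong) auto
  also have "\<dots> = 1" by simp
  finally have n: "norm (T e0) = 1" .
  have "{x \<in> space (lebesgue_Rd ?d). L2_set (\<lambda>i. x i - 0) {..<?d} \<le> 1 \<or> L2_set (\<lambda>i. x i - e0 i) {..<?d} \<le> 1}
      = unit_ball_Rd ?d (\<lambda>_. 0) \<union> unit_ball_Rd ?d e0"
    unfolding unit_ball_Rd_def by blast
  then have eq: "emeasure lborel (cball 0 1 \<union> cball (T e0) 1) =
      emeasure (lebesgue_Rd ?d) (unit_ball_Rd ?d (\<lambda>_. 0) \<union> unit_ball_Rd ?d e0)"
    using emeasure_union_cballs_coordinates[OF T dist, of "\<lambda>_. 0" 1 e0] by (simp only: T0)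
  have "emeasure lborel (cball 0 1 \<union> cball (T e0) 1) < \<infinity>"
    by (intro emeasure_bounded_finite) simp
  then have "emeasure lborel (cball 0 1 \<union> cball (T e0) 1) = ennreal (union_vol ?d)"
    unfolding eq union_vol_def measure_def by (simp add: infinity_ennreal_def)
  with n show ?thesis by blast
qed



text \<open>
  An index type of the same cardinality as \<open>'n\<close> that carries a well-order, which is what the rotation
  invariance of Lebesgue measure (\<open>measure_orthogonal_image\<close>) refers to.  Volumes of unions of balls
  are transferred to an arbitrary index type through the product measure.
\<close>

typedef (overloaded) ('n::finite) index = "{..<CARD('n)}"
  by (rule exI[of _ 0]) simp

instance index :: (finite) finite
proof
  show "finite (UNIV :: 'a index set)"
    using type_definition.univ[OF type_definition_index] by (metis finite_imageI finite_lessThan)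
qed

instantiation index :: (finite) wellorder
begin

definition less_eq_index :: "'a index \<Rightarrow> 'a index \<Rightarrow> bool" where
  "less_eq_index i j \<longleftrightarrow> Rep_index i \<le> Rep_index j"

definition less_index :: "'a index \<Rightarrow> 'a index \<Rightarrow> bool" where
  "less_index i j \<longleftrightarrow> Rep_index i < Rep_index j"

instance
proof
  fix P :: "'a index \<Rightarrow> bool" and a :: "'a index"
  assume *: "\<And>x. (\<And>y. y < x \<Longrightarrow> P y) \<Longrightarrow> P x"
  show "P a"
  proof (induction "Rep_index a" arbitrary: a rule: less_induct)
    case less
    show ?case by (rule *, rule less) (simp add: less_index_def)
  qed
qed (auto simp: less_eq_index_def less_index_def Rep_index_inject)

end

lemma card_index: "CARD('n index) = CARD('n::finite)"
  using type_definition.card[OF type_definition_index] by simp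

text \<open>
  A rotation, a dilation and a translation carry the union of two unit balls with centres \<open>0\<close> and
  \<open>e\<close> to the given union.
\<close>

lemma emeasure_union_cballs_wellorder:
  fixes x y :: "real ^ 'n::{finite,wellorder}"
  assumes r: "r > 0" and xy: "dist x y = r"
  shows "emeasure lborel (cball x r \<union> cball y r) = ennreal (r ^ CARD('n) * union_vol CARD('n))"
proof -
  obtain e :: "real ^ 'n::{finite,wellorder}" where e: "norm e = 1"
    and ve: "emeasure lborel (cball 0 1 \<union> cball e 1) = ennreal (union_vol CARD('n))"
    using emeasure_union_unit_cballs by blast
  define w where "w = (1 / r) *\<^sub>R (y - x)"
  have w: "norm w = 1" using r xy by (simp add: w_def dist_norm norm_minus_commute)
  have y: "y = r *\<^sub>R w + x" using r by (simp add: w_def)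
  obtain g where g: "orthogonal_transformation g" "g e = w"
    using orthogonal_transformation_exists_1[OF e w] by blast
  let ?E = "cball 0 1 \<union> cball e 1" and ?W = "cball 0 1 \<union> cball w 1"
  have "g 0 = 0" using orthogonal_transformation_linear[OF g(1)] by (rule linear_0)
  then have W: "?W = g ` ?E"
    unfolding image_Un image_orthogonal_transformation_cball[OF g(1)] g(2) by simp
  have lm: "?E \<in> lmeasurable" "?W \<in> lmeasurable" by (intro fmeasurable.Un lmeasurable_cball)+
  have "emeasure lebesgue ?W = emeasure lebesgue ?E"
    using measure_orthogonal_image[OF g(1) lm(1)] lm unfolding W[symmetric]
    by (simp add: emeasure_eq_measure2 fmeasurableD2)
  then have vw: "emeasure lebesgue ?W = ennreal (union_vol CARD('n))"
    using ve by simp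
  have im: "(\<lambda>z. r *\<^sub>R z + x) ` cball c 1 = cball (r *\<^sub>R c + x) r" for c
  proof
    show "(\<lambda>z. r *\<^sub>R z + x) ` cball c 1 \<subseteq> cball (r *\<^sub>R c + x) r"
      using r by (auto simp: dist_norm scaleR_diff_right[symmetric])
    show "cball (r *\<^sub>R c + x) r \<subseteq> (\<lambda>z. r *\<^sub>R z + x) ` cball c 1"
    proof
      fix z assume z: "z \<in> cball (r *\<^sub>R c + x) r"
      let ?u = "(1 / r) *\<^sub>R (z - x)"
      have zu: "z = r *\<^sub>R ?u + x" using r by simp
      have "r * dist c ?u = norm (r *\<^sub>R (c - ?u))" using r by (simp add: dist_norm)
      also have "r *\<^sub>R (c - ?u) = r *\<^sub>R c + x - z" using r by (simp add: scaleR_diff_right)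
      also have "norm \<dots> \<le> r" using z by (simp add: dist_norm)
      finally have "dist c ?u \<le> 1" using r by simp
      then show "z \<in> (\<lambda>z. r *\<^sub>R z + x) ` cball c 1" using zu by (intro image_eqI[of _ _ ?u]) auto
    qed
  qed
  have "cball x r \<union> cball y r = (\<lambda>z. r *\<^sub>R z + x) ` ?W"
    unfolding image_Un im y by simp
  then have "emeasure lebesgue (cball x r \<union> cball y r) = ennreal (\<bar>r\<bar> ^ CARD('n)) * emeasure lebesgue ?W"
    using emeasure_lebesgue_affine[of r x ?W] by simp
  then have "emeasure lebesgue (cball x r \<union> cball y r) = ennreal (r ^ CARD('n) * union_vol CARD('n))"
    using r unfolding vw by (simp add: ennreal_mult' [symmetric])
  then show ?thesis by simp
qed

lemma emeasure_union_cballs: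
  fixes x y :: "real ^ 'n"
  assumes r: "r > 0" and xy: "dist x y = r"
  shows "emeasure lborel (cball x r \<union> cball y r) = ennreal (r ^ CARD('n) * union_vol CARD('n))"
proof -
  obtain T :: "(nat \<Rightarrow> real) \<Rightarrow> real ^ 'n" where T: "T \<in> lebesgue_Rd CARD('n) \<rightarrow>\<^sub>M borel"
    "lborel = distr (lebesgue_Rd CARD('n)) borel T"
    and dT0: "\<forall>a x. dist (T a) (T x) = L2_set (\<lambda>i. x i - a i) {..<CARD('n)}" and "surj T"
    using coordinates_ex[where ?'n = 'n] by (elim exE conjE)
  note dT = dT0[rule_format]
  obtain T' :: "(nat \<Rightarrow> real) \<Rightarrow> real ^ ('n index)" where T': "T' \<in> lebesgue_Rd CARD('n index) \<rightarrow>\<^sub>M borel"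
    "lborel = distr (lebesgue_Rd CARD('n index)) borel T'"
    and dT0': "\<forall>a x. dist (T' a) (T' x) = L2_set (\<lambda>i. x i - a i) {..<CARD('n index)}"
    using coordinates_ex[where ?'n = "'n index"] by (elim exE conjE)
  note dT' = dT0'[rule_format]
  obtain a b where ab: "x = T a" "y = T b" using \<open>surj T\<close> by (meson surj_def)
  have "dist (T' a) (T' b) = r" using xy unfolding ab dT dT' card_index .
  from emeasure_union_cballs_wellorder[OF r this]
  show ?thesis
    unfolding ab emeasure_union_cballs_coordinates[OF T dT] emeasure_union_cballs_coordinates[OF T' dT'] card_index .
qed

section \<open>The limiting intensity of mutual nearest neighbours\<close>

text \<open>
  Layer cake: write \<open>exp (- s)\<close> as the integral of \<open>exp (- t)\<close> over \<open>t \<ge> s\<close> and exchange the integrals.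
  The points with \<open>a |u|\<^sup>d \<le> t\<close> form a ball whose volume is linear in \<open>t\<close>.
\<close>

lemma nn_integral_exp_norm_power:
  fixes a :: real
  assumes a: "a > 0"
  shows "(\<integral>\<^sup>+u. ennreal (exp (- (a * norm u ^ DIM('a::euclidean_space)))) \<partial>(lborel :: 'a measure)) =
    ennreal (unit_ball_vol DIM('a) / a)"
proof -
  let ?d = "DIM('a)"
  have d: "?d > 0" by simp
  have tail: "ennreal (exp (- s)) = (\<integral>\<^sup>+t. ennreal (exp (- t)) * indicator {s..} t \<partial>lborel)" for s :: real
  proof -
    have "((\<lambda>t::real. - exp (- t)) \<longlongrightarrow> 0) at_top"
      using tendsto_minus[OF filterlim_compose[OF exp_at_bot filterlim_uminus_at_bot_at_top]] by simp
    then have "(\<integral>\<^sup>+t. ennreal (exp (- t)) * indicator {s..} t \<partial>lborel) = ennreal (0 - (- exp (- s)))"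
      by (intro nn_integral_FTC_atLeast) (auto intro!: derivative_eq_intros)
    then show ?thesis by simp
  qed
  have "(\<integral>\<^sup>+u. ennreal (exp (- (a * norm u ^ ?d))) \<partial>(lborel :: 'a measure)) =
      (\<integral>\<^sup>+u. \<integral>\<^sup>+t. ennreal (exp (- t)) * indicator {a * norm u ^ ?d..} t \<partial>lborel \<partial>(lborel :: 'a measure))"
    by (intro nn_integral_cong tail)
  also have "\<dots> = (\<integral>\<^sup>+u. \<integral>\<^sup>+t. ennreal (exp (- t)) * (if a * norm u ^ ?d \<le> t then 1 else 0) \<partial>lborel \<partial>(lborel :: 'a measure))"
    by (intro nn_integral_cong) (auto simp: indicator_def)
  also have "\<dots> = (\<integral>\<^sup>+t. \<integral>\<^sup>+u. ennreal (exp (- t)) * (if a * norm u ^ ?d \<le> t then 1 else 0) \<partial>(lborel :: 'a measure) \<partial>lborel)"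
    by (rule lborel_pair.Fubini'[symmetric]) measurable
  also have "\<dots> = (\<integral>\<^sup>+t. ennreal (unit_ball_vol ?d / a) * (ennreal (t ^ 1 * exp (- t)) * indicator {0..} t) \<partial>lborel)"
  proof (rule nn_integral_cong)
    fix t :: real
    show "(\<integral>\<^sup>+u. ennreal (exp (- t)) * (if a * norm u ^ ?d \<le> t then 1 else 0) \<partial>(lborel :: 'a measure)) =
      ennreal (unit_ball_vol ?d / a) * (ennreal (t ^ 1 * exp (- t)) * indicator {0..} t)"
    proof (cases "t \<ge> 0")
      case True
      define R where "R = root ?d (t / a)"
      have R: "R \<ge> 0" "R ^ ?d = t / a" using True a by (simp_all add: R_def)
      have eq: "(a * norm u ^ ?d \<le> t) \<longleftrightarrow> u \<in> cball 0 R" for u :: 'a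
      proof -
        have "a * norm u ^ ?d \<le> t \<longleftrightarrow> norm u ^ ?d \<le> R ^ ?d" using a by (simp add: R(2) field_simps)
        also have "\<dots> \<longleftrightarrow> norm u \<le> R" using R(1) d power_mono_iff[of "norm u" R ?d] by simp
        finally show ?thesis by simp
      qed
      have "(\<integral>\<^sup>+u. ennreal (exp (- t)) * (if a * norm u ^ ?d \<le> t then 1 else 0) \<partial>(lborel :: 'a measure)) =
          (\<integral>\<^sup>+u. ennreal (exp (- t)) * indicator (cball 0 R) u \<partial>(lborel :: 'a measure))"
        unfolding eq by (intro nn_integral_cong) (simp add: indicator_def)
      also have "\<dots> = ennreal (exp (- t)) * emeasure lborel (cball (0::'a) R)"
        by (rule nn_integral_cmult_indicator) simp
      also have "\<dots> = ennreal (exp (- t)) * ennreal (unit_ball_vol ?d * (t / a))"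
        unfolding emeasure_cball[OF R(1)] R(2) ..
      also have "\<dots> = ennreal (unit_ball_vol ?d / a) * ennreal (t * exp (- t))"
        using True a unit_ball_vol_nonneg[of "real ?d"]
        by (simp add: ennreal_mult[symmetric] mult_ac)
      finally show ?thesis using True by simp
    next
      case False
      have "\<not> a * norm u ^ ?d \<le> t" for u :: 'a
      proof -
        have "0 \<le> a * norm u ^ ?d" using a by simp
        then show ?thesis using False by linarith
      qed
      then show ?thesis using False by simp
    qed
  qed
  also have "\<dots> = ennreal (unit_ball_vol ?d / a) * (\<integral>\<^sup>+t. ennreal (t ^ 1 * exp (- t)) * indicator {0..} t \<partial>lborel)"
    by (rule nn_integral_cmult) measurable
  also have "(\<integral>\<^sup>+t. ennreal (t ^ 1 * exp (- t)) * indicator {0..} t \<partial>lborel) = ennreal (real (fact 1))"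
    by (rule nn_intergal_power_times_exp_Ici)
  finally show ?thesis by simp
qed

locale density_on_Rn =
  fixes f :: "real ^ 'n \<Rightarrow> real" and \<mu> :: "(real ^ 'n) measure"
  assumes f_meas [measurable]: "f \<in> borel_measurable borel"
    and f_nonneg: "\<And>x. 0 \<le> f x"
    and f_cont: "AE x in lborel. isCont f x"
  defines "\<mu> \<equiv> density lborel (\<lambda>x. ennreal (f x))"
  assumes prob: "prob_space \<mu>"
begin

sublocale prob_space \<mu> by (rule prob)

lemma sets_mu [measurable_cong, simp]: "sets \<mu> = sets borel" by (simp add: \<mu>_def)

lemma space_mu [simp]: "space \<mu> = UNIV" by (simp add: \<mu>_def)

text \<open>
  The probability that a further sample point is farther from both \<open>x\<close> and \<open>y\<close> than they are from
  each other.  The form as an integral makes its joint measurability evident.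
\<close>

definition void_prob :: "real ^ 'n \<Rightarrow> real ^ 'n \<Rightarrow> ennreal" where
  "void_prob x y = (\<integral>\<^sup>+z. (if dist x y < dist x z \<and> dist x y < dist y z then 1 else 0) \<partial>\<mu>)"

lemma measurable_void_prob [measurable]:
  "(\<lambda>(x, y). void_prob x y) \<in> borel_measurable (borel \<Otimes>\<^sub>M borel)"
  unfolding void_prob_def by measurable

lemma void_prob_eq: "void_prob x y = emeasure \<mu> (UNIV - (cball x (dist x y) \<union> cball y (dist x y)))"
proof -
  let ?S = "UNIV - (cball x (dist x y) \<union> cball y (dist x y))"
  have "void_prob x y = (\<integral>\<^sup>+z. indicator ?S z \<partial>\<mu>)"
    unfolding void_prob_def by (intro nn_integral_cong) (auto simp: indicator_def)
  also have "\<dots> = emeasure \<mu> ?S" by (rule nn_integral_indicator) simp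
  finally show ?thesis .
qed

text \<open>
  The order of magnitude of the distance to the nearest neighbour among \<open>n\<close> sample points.
\<close>

definition scale :: "nat \<Rightarrow> real" where "scale n = 1 / root CARD('n) (real n)"

lemma scale_pos: "n > 0 \<Longrightarrow> scale n > 0" by (simp add: scale_def)

lemma scale_power: "n > 0 \<Longrightarrow> scale n ^ CARD('n) = 1 / real n"
  by (simp add: scale_def power_divide)

lemma scale_tendsto: "scale \<longlonglongrightarrow> 0"
proof -
  have "filterlim (\<lambda>n. root CARD('n) (real n)) at_top sequentially"
    unfolding filterlim_at_top_gt[of _ _ 0]
  proof (intro allI impI)
    fix Z :: real assume Z: "Z > 0"
    obtain N where N: "real N > Z ^ CARD('n)" using reals_Archimedean2 by blast
    show "\<forall>\<^sub>F n in sequentially. Z \<le> root CARD('n) (real n)"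
      using eventually_ge_at_top[of N]
    proof eventually_elim
      case (elim n)
      have "Z = root CARD('n) (Z ^ CARD('n))" using Z by (simp add: real_root_power_cancel)
      also have "\<dots> \<le> root CARD('n) (real n)" using N elim by (intro real_root_le_mono) auto
      finally show ?case .
    qed
  qed
  then show ?thesis unfolding scale_def by (rule tendsto_divide_0[OF tendsto_const filterlim_at_top_imp_at_infinity])
qed

text \<open>
  The integrand of the mutual neighbour probability after the substitution \<open>y = x + scale n *\<^sub>R u\<close>,
  without the Jacobian \<open>1 / n\<close>.  Coinciding points, that is \<open>u = 0\<close>, are not mutual neighbours.
\<close>

definition rescaled :: "nat \<Rightarrow> real ^ 'n \<Rightarrow> real ^ 'n \<Rightarrow> ennreal" where
  "rescaled n x u = ennreal (f x) * (ennreal (f (x + scale n *\<^sub>R u)) *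
     (if u \<noteq> 0 then void_prob x (x + scale n *\<^sub>R u) ^ (n - 2) else 0))"

lemma measurable_rescaled [measurable]: "(\<lambda>(x, u). rescaled n x u) \<in> borel_measurable (borel \<Otimes>\<^sub>M borel)"
proof -
  have [measurable]: "(\<lambda>p. void_prob (fst p) (fst p + scale n *\<^sub>R snd p)) \<in> borel_measurable (borel \<Otimes>\<^sub>M borel)"
    by (rule measurable_compose[of "\<lambda>p. (fst p, fst p + scale n *\<^sub>R snd p)" _ "borel \<Otimes>\<^sub>M borel" "\<lambda>(x, y). void_prob x y", simplified])
      measurable
  show ?thesis unfolding rescaled_def case_prod_beta by measurable
qed

lemma emeasure_union_le:
  assumes \<delta>: "\<And>z. dist x z \<le> 2 * r \<Longrightarrow> f z \<le> c" and r: "dist x y = r" "r > 0" and c: "c \<ge> 0"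
  shows "emeasure \<mu> (cball x r \<union> cball y r) \<le> ennreal (c * (r ^ CARD('n) * union_vol CARD('n)))"
proof -
  let ?U = "cball x r \<union> cball y r"
  have "emeasure \<mu> ?U = (\<integral>\<^sup>+z. ennreal (f z) * indicator ?U z \<partial>lborel)"
    unfolding \<mu>_def by (rule emeasure_density) auto
  also have "\<dots> \<le> (\<integral>\<^sup>+z. ennreal c * indicator ?U z \<partial>lborel)"
  proof (rule nn_integral_mono)
    fix z
    have "f z \<le> c" if "z \<in> ?U"
    proof (rule \<delta>)
      have "dist x z \<le> r \<or> dist y z \<le> r" using that by auto
      then show "dist x z \<le> 2 * r" using r dist_triangle[of x z y] by (elim disjE) linarith+
    qed
    then show "ennreal (f z) * indicator ?U z \<le> ennreal c * indicator ?U z"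
      by (auto simp: indicator_def intro!: ennreal_leI)
  qed
  also have "\<dots> = ennreal c * emeasure lborel ?U" by (rule nn_integral_cmult_indicator) simp
  also have "\<dots> = ennreal (c * (r ^ CARD('n) * union_vol CARD('n)))"
    unfolding emeasure_union_cballs[OF r(2,1)] using c by (simp add: ennreal_mult')
  finally show ?thesis .
qed

text \<open>
  Near \<open>x\<close> the density stays between \<open>f x - \<delta>\<close> and \<open>f x + \<delta>\<close>.  The two balls shrink to \<open>x\<close> and
  their union has volume \<open>V / n\<close>, so each of the other \<open>n - 2\<close> points avoids them with probability at least
  \<open>1 - c / n\<close>, where \<open>c = (f x + \<delta>) V\<close>.  The power \<open>n\<close> in place of \<open>n - 2\<close> only lowers the bound, and
  \<open>(1 - c / n)\<^sup>n\<close> tends to \<open>exp (- c)\<close>.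
\<close>

lemma liminf_rescaled_delta:
  assumes cont: "isCont f x" and u: "u \<noteq> 0" and \<delta>: "\<delta> > 0"
  defines "V \<equiv> norm u ^ CARD('n) * union_vol CARD('n)"
  shows "ennreal (f x * ((f x - \<delta>) * exp (- ((f x + \<delta>) * V)))) \<le>
    liminf (\<lambda>n. ennreal ((real n - 1) / real n) * rescaled n x u)"
proof -
  define c where "c = (f x + \<delta>) * V"
  have V: "V \<ge> 0" unfolding V_def using union_vol_pos[of "CARD('n)"] by simp
  have c: "c \<ge> 0" unfolding c_def using V f_nonneg[of x] \<delta> by simp
  let ?s = "\<lambda>n. (real n - 1) / real n * (f x * ((f x - \<delta>) * (1 + (- c) / real n) ^ n))"
  have lim: "?s \<longlonglongrightarrow> 1 * (f x * ((f x - \<delta>) * exp (- c)))"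
  proof (intro tendsto_mult tendsto_const tendsto_exp_limit_sequentially)
    have "(\<lambda>n. 1 - 1 / real n) \<longlonglongrightarrow> 1 - 0"
      by (intro tendsto_diff tendsto_const lim_1_over_n)
    moreover have "\<forall>\<^sub>F n in sequentially. 1 - 1 / real n = (real n - 1) / real n"
      using eventually_gt_at_top[of 0] by eventually_elim (simp add: field_simps)
    ultimately show "(\<lambda>n. (real n - 1) / real n) \<longlonglongrightarrow> 1" by (simp add: filterlim_cong)
  qed
  obtain \<rho> where \<rho>: "\<rho> > 0" "\<And>z. dist z x < \<rho> \<Longrightarrow> dist (f z) (f x) < \<delta>"
    using cont \<delta> unfolding continuous_at_eps_delta by (metis dist_norm dist_commute)
  have "(\<lambda>n. 2 * (scale n * norm u)) \<longlonglongrightarrow> 2 * (0 * norm u)"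
    by (intro tendsto_intros scale_tendsto)
  then have ev_r: "\<forall>\<^sub>F n in sequentially. 2 * (scale n * norm u) < \<rho>"
    using \<rho>(1) by (intro order_tendstoD(2)) auto
  obtain N where N: "real N > c" using reals_Archimedean2 by blast
  have "\<forall>\<^sub>F n in sequentially. ennreal (?s n) \<le> ennreal ((real n - 1) / real n) * rescaled n x u"
    using ev_r eventually_gt_at_top[of 0] eventually_ge_at_top[of N]
  proof eventually_elim
    case (elim n)
    let ?y = "x + scale n *\<^sub>R u"
    define r where "r = scale n * norm u"
    have r: "r > 0" "dist x ?y = r" using scale_pos[of n] elim u by (simp_all add: r_def dist_norm)
    have near: "f z \<le> f x + \<delta>" "f x - \<delta> \<le> f z" if "dist x z \<le> 2 * r" for z
      using \<rho>(2)[of z] that elim(1) by (auto simp: r_def dist_commute dist_real_def abs_less_iff)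
    let ?U = "cball x r \<union> cball ?y r"
    have rd: "r ^ CARD('n) = norm u ^ CARD('n) / real n"
      using scale_power[of n] elim by (simp add: r_def power_mult_distrib)
    have "emeasure \<mu> ?U \<le> ennreal ((f x + \<delta>) * (r ^ CARD('n) * union_vol CARD('n)))"
      using near f_nonneg[of x] \<delta> r by (intro emeasure_union_le) auto
    also have "(f x + \<delta>) * (r ^ CARD('n) * union_vol CARD('n)) = c / real n"
      unfolding rd c_def V_def by simp
    finally have mU: "measure \<mu> ?U \<le> c / real n"
      using c by (simp add: emeasure_eq_measure)
    define w where "w = measure \<mu> (UNIV - ?U)"
    have w: "1 - c / real n \<le> w" "w \<le> 1"
      using prob_compl[of ?U] mU by (simp_all add: w_def)
    have Ww: "void_prob x ?y = ennreal w" unfolding void_prob_eq r(2) w_def by (rule emeasure_eq_measure)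
    have cn: "0 \<le> 1 - c / real n" "1 - c / real n \<le> 1" using elim N c by (simp_all add: field_simps)
    have "(1 + (- c) / real n) ^ n \<le> (1 - c / real n) ^ (n - 2)"
      using power_decreasing[of "n - 2" n "1 - c / real n"] cn by simp
    also have "\<dots> \<le> w ^ (n - 2)" using cn w by (intro power_mono) auto
    finally have wn: "(1 + (- c) / real n) ^ n \<le> w ^ (n - 2)" .
    have w0: "0 \<le> w" using cn w by linarith
    have fy: "f x - \<delta> \<le> f ?y" using near(2)[of ?y] r by simp
    have pos: "0 \<le> (1 + (- c) / real n) ^ n" using cn by simp
    have "(f x - \<delta>) * (1 + (- c) / real n) ^ n \<le> f ?y * w ^ (n - 2)"
    proof -
      have "(f x - \<delta>) * (1 + (- c) / real n) ^ n \<le> f ?y * (1 + (- c) / real n) ^ n"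
        using fy pos by (rule mult_right_mono)
      also have "\<dots> \<le> f ?y * w ^ (n - 2)" using wn f_nonneg by (intro mult_left_mono)
      finally show ?thesis .
    qed
    then have le: "?s n \<le> (real n - 1) / real n * (f x * (f ?y * w ^ (n - 2)))"
      using f_nonneg[of x] elim by (intro mult_left_mono) auto
    have n1: "0 \<le> (real n - 1) / real n" using elim by simp
    have "ennreal ((real n - 1) / real n) * rescaled n x u =
        ennreal ((real n - 1) / real n * (f x * (f ?y * w ^ (n - 2))))"
      unfolding rescaled_def Ww using u f_nonneg w0 n1
      by (simp add: ennreal_power ennreal_mult[symmetric])
    then show ?case using le by (simp add: ennreal_leI)
  qed
  then have "liminf (\<lambda>n. ennreal (?s n)) \<le> liminf (\<lambda>n. ennreal ((real n - 1) / real n) * rescaled n x u)"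
    by (rule Liminf_mono)
  moreover have "(\<lambda>n. ennreal (?s n)) \<longlonglongrightarrow> ennreal (f x * ((f x - \<delta>) * exp (- c)))"
    using tendsto_ennrealI[OF lim] by simp
  then have "liminf (\<lambda>n. ennreal (?s n)) = ennreal (f x * ((f x - \<delta>) * exp (- c)))"
    by (intro lim_imp_Liminf) auto
  ultimately show ?thesis by (simp add: c_def)
qed

lemma liminf_rescaled:
  assumes cont: "isCont f x" and u: "u \<noteq> 0"
  shows "ennreal (f x * (f x * exp (- (f x * union_vol CARD('n) * norm u ^ CARD('n))))) \<le>
    liminf (\<lambda>n. ennreal ((real n - 1) / real n) * rescaled n x u)"
proof -
  let ?V = "norm u ^ CARD('n) * union_vol CARD('n)"
  have "((\<lambda>\<delta>. f x * ((f x - \<delta>) * exp (- ((f x + \<delta>) * ?V)))) \<longlongrightarrow> f x * ((f x - 0) * exp (- ((f x + 0) * ?V))))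
      (at_right 0)"
    by (intro tendsto_intros)
  from tendsto_ennrealI[OF this]
  have "ennreal (f x * ((f x - 0) * exp (- ((f x + 0) * ?V)))) \<le> liminf (\<lambda>n. ennreal ((real n - 1) / real n) * rescaled n x u)"
  proof (rule tendsto_upperbound)
    show "\<forall>\<^sub>F \<delta> in at_right 0. ennreal (f x * ((f x - \<delta>) * exp (- ((f x + \<delta>) * ?V)))) \<le>
        liminf (\<lambda>n. ennreal ((real n - 1) / real n) * rescaled n x u)"
      using eventually_at_right_less[of 0] by eventually_elim (rule liminf_rescaled_delta[OF cont u])
  qed simp
  then show ?thesis by (simp add: mult_ac)
qed

text \<open>
  The probability that two given points among \<open>n\<close> sample points are mutual nearest neighbours.
\<close>

definition mutual_prob :: "nat \<Rightarrow> ennreal" where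
  "mutual_prob n = (\<integral>\<^sup>+x. \<integral>\<^sup>+y. (if x \<noteq> y then void_prob x y ^ (n - 2) else 0) \<partial>\<mu> \<partial>\<mu>)"

lemma mutual_prob_eq:
  assumes n: "n > 0"
  shows "mutual_prob n = (\<integral>\<^sup>+x. \<integral>\<^sup>+u. ennreal (1 / real n) * rescaled n x u \<partial>lborel \<partial>lborel)"
proof -
  have inner: "(\<integral>\<^sup>+y. (if x \<noteq> y then void_prob x y ^ (n - 2) else 0) \<partial>\<mu>) =
      (\<integral>\<^sup>+u. ennreal (1 / real n) * (ennreal (f (x + scale n *\<^sub>R u)) *
        (if u \<noteq> 0 then void_prob x (x + scale n *\<^sub>R u) ^ (n - 2) else 0)) \<partial>lborel)" for x
  proof -
    let ?g = "\<lambda>y. ennreal (f y) * (if x \<noteq> y then void_prob x y ^ (n - 2) else 0)"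
    have Wx [measurable]: "void_prob x \<in> borel_measurable borel"
      using measurable_compose[OF measurable_Pair1'[of x borel borel] measurable_void_prob] by simp
    have [measurable]: "?g \<in> borel_measurable borel" by measurable
    have "(\<integral>\<^sup>+y. (if x \<noteq> y then void_prob x y ^ (n - 2) else 0) \<partial>\<mu>) = (\<integral>\<^sup>+y. ?g y \<partial>lborel)"
      unfolding \<mu>_def by (subst nn_integral_density) auto
    also have "\<dots> = (\<integral>\<^sup>+y. ?g y \<partial>density (distr lborel borel (\<lambda>u. x + scale n *\<^sub>R u)) (\<lambda>_. ennreal (\<bar>scale n\<bar> ^ DIM(real ^ 'n))))"
      using lborel_affine[of "scale n" x] scale_pos[OF n] by simp
    also have "\<dots> = (\<integral>\<^sup>+u. ennreal (\<bar>scale n\<bar> ^ DIM(real ^ 'n)) * ?g (x + scale n *\<^sub>R u) \<partial>lborel)"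
      by (subst nn_integral_density, simp, simp, subst nn_integral_distr) auto
    also have "\<dots> = (\<integral>\<^sup>+u. ennreal (1 / real n) * (ennreal (f (x + scale n *\<^sub>R u)) *
        (if u \<noteq> 0 then void_prob x (x + scale n *\<^sub>R u) ^ (n - 2) else 0)) \<partial>lborel)"
      using scale_pos[OF n] scale_power[OF n] by (intro nn_integral_cong) auto
    finally show ?thesis .
  qed
  have [measurable]: "(\<lambda>x. \<integral>\<^sup>+u. ennreal (1 / real n) * (ennreal (f (x + scale n *\<^sub>R u)) *
        (if u \<noteq> 0 then void_prob x (x + scale n *\<^sub>R u) ^ (n - 2) else 0)) \<partial>lborel) \<in> borel_measurable borel"
  proof -
    have [measurable]: "(\<lambda>p. void_prob (fst p) (fst p + scale n *\<^sub>R snd p)) \<in> borel_measurable (borel \<Otimes>\<^sub>M borel)"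
      by (rule measurable_compose[of "\<lambda>p. (fst p, fst p + scale n *\<^sub>R snd p)" _ "borel \<Otimes>\<^sub>M borel" "\<lambda>(x, y). void_prob x y", simplified])
        measurable
    have "(\<lambda>p. ennreal (1 / real n) * (ennreal (f (fst p + scale n *\<^sub>R snd p)) *
        (if snd p \<noteq> 0 then void_prob (fst p) (fst p + scale n *\<^sub>R snd p) ^ (n - 2) else 0))) \<in> borel_measurable (borel \<Otimes>\<^sub>M lborel)"
      by measurable
    then have "(\<lambda>(x, u). ennreal (1 / real n) * (ennreal (f (x + scale n *\<^sub>R u)) *
        (if u \<noteq> 0 then void_prob x (x + scale n *\<^sub>R u) ^ (n - 2) else 0))) \<in> borel_measurable (borel \<Otimes>\<^sub>M lborel)"
      by (simp add: case_prod_beta)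
    then show ?thesis by (rule lborel.borel_measurable_nn_integral)
  qed
  show ?thesis
    unfolding mutual_prob_def inner unfolding \<mu>_def
  proof (subst nn_integral_density)
    have "ennreal (f x) * (\<integral>\<^sup>+u. ennreal (1 / real n) * (ennreal (f (x + scale n *\<^sub>R u)) *
          (if u \<noteq> 0 then void_prob x (x + scale n *\<^sub>R u) ^ (n - 2) else 0)) \<partial>lborel) =
        (\<integral>\<^sup>+u. ennreal (1 / real n) * rescaled n x u \<partial>lborel)" for x
    proof -
      have Wx [measurable]: "void_prob x \<in> borel_measurable borel"
        using measurable_compose[OF measurable_Pair1'[of x borel borel] measurable_void_prob] by simp
      show ?thesis unfolding rescaled_def
        by (subst nn_integral_cmult[symmetric]) (auto intro!: nn_integral_cong simp: mult_ac)
    qed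
    then show "(\<integral>\<^sup>+x. ennreal (f x) * (\<integral>\<^sup>+u. ennreal (1 / real n) * (ennreal (f (x + scale n *\<^sub>R u)) *
          (if u \<noteq> 0 then void_prob x (x + scale n *\<^sub>R u) ^ (n - 2) else 0)) \<partial>lborel) \<partial>lborel) =
        (\<integral>\<^sup>+x. \<integral>\<^sup>+u. ennreal (1 / real n) * rescaled n x u \<partial>lborel \<partial>lborel)" by simp
  qed auto
qed

lemma nn_integral_limit:
  "(\<integral>\<^sup>+x. \<integral>\<^sup>+u. ennreal (f x * (f x * exp (- (f x * union_vol CARD('n) * norm (u :: real ^ 'n) ^ CARD('n))))) \<partial>lborel \<partial>lborel)
    = ennreal (b_const CARD('n))"
proof -
  let ?V = "union_vol CARD('n)"
  have V: "?V > 0" by (rule union_vol_pos) simp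
  have b: "b_const CARD('n) = unit_ball_vol CARD('n) / ?V" by (rule b_const_eq)
  have b0: "0 \<le> b_const CARD('n)" unfolding b using V by simp
  have "(\<integral>\<^sup>+u. ennreal (f x * (f x * exp (- (f x * ?V * norm (u :: real ^ 'n) ^ CARD('n))))) \<partial>lborel) =
      ennreal (f x) * ennreal (b_const CARD('n))" for x
  proof (cases "f x = 0")
    case False
    then have fx: "f x > 0" using f_nonneg[of x] by linarith
    have "(\<integral>\<^sup>+u. ennreal (f x * (f x * exp (- (f x * ?V * norm (u :: real ^ 'n) ^ CARD('n))))) \<partial>lborel) =
        (\<integral>\<^sup>+u. ennreal (f x * f x) * ennreal (exp (- (f x * ?V * norm (u :: real ^ 'n) ^ DIM(real ^ 'n)))) \<partial>lborel)"
      using fx by (intro nn_integral_cong) (simp add: ennreal_mult[symmetric] mult.assoc)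
    also have "\<dots> = ennreal (f x * f x) * ennreal (unit_ball_vol DIM(real ^ 'n) / (f x * ?V))"
      using fx V by (subst nn_integral_cmult) (simp_all only: nn_integral_exp_norm_power mult_pos_pos, measurable)
    also have "\<dots> = ennreal (f x) * ennreal (b_const CARD('n))"
      using fx V unfolding b by (simp add: ennreal_mult[symmetric] field_simps)
    finally show ?thesis .
  qed simp
  then have "(\<integral>\<^sup>+x. \<integral>\<^sup>+u. ennreal (f x * (f x * exp (- (f x * ?V * norm (u :: real ^ 'n) ^ CARD('n))))) \<partial>lborel \<partial>lborel) =
      (\<integral>\<^sup>+x. ennreal (f x) * ennreal (b_const CARD('n)) \<partial>lborel)" by simp
  also have "\<dots> = (\<integral>\<^sup>+x. ennreal (f x) \<partial>lborel) * ennreal (b_const CARD('n))"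
    by (rule nn_integral_multc) measurable
  also have "(\<integral>\<^sup>+x. ennreal (f x) \<partial>lborel) = 1"
    using emeasure_space_1 unfolding \<mu>_def by (subst (asm) emeasure_density) auto
  finally show ?thesis by simp
qed

text \<open>
  Fatou's lemma in the inner and in the outer integral.
\<close>

theorem liminf_mutual_prob: "ennreal (b_const CARD('n)) \<le> liminf (\<lambda>n. ennreal (real n - 1) * mutual_prob n)"
proof -
  let ?L = "\<lambda>x u. ennreal (f x * (f x * exp (- (f x * union_vol CARD('n) * norm (u :: real ^ 'n) ^ CARD('n)))))"
  let ?g = "\<lambda>n x u. ennreal ((real n - 1) / real n) * rescaled n x u"
  have [measurable]: "(\<lambda>(x, u). ?g n x u) \<in> borel_measurable (borel \<Otimes>\<^sub>M lborel)" for n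
  proof -
    have "(\<lambda>p. ennreal ((real n - 1) / real n) * (case p of (x, u) \<Rightarrow> rescaled n x u)) \<in> borel_measurable (borel \<Otimes>\<^sub>M lborel)"
      by measurable
    then show ?thesis by (simp add: case_prod_beta)
  qed
  have gx [measurable]: "?g n x \<in> borel_measurable lborel" for n x
    using measurable_compose[OF measurable_Pair1'[of x borel borel] measurable_rescaled[of n]] by simp
  have gi [measurable]: "(\<lambda>x. \<integral>\<^sup>+u. ?g n x u \<partial>lborel) \<in> borel_measurable lborel" for n
  proof -
    have "(\<lambda>x. \<integral>\<^sup>+u. ?g n x u \<partial>lborel) \<in> borel_measurable borel"
      by (rule lborel.borel_measurable_nn_integral) measurable
    then show ?thesis by simp
  qed
  have "ennreal (b_const CARD('n)) = (\<integral>\<^sup>+x. \<integral>\<^sup>+u. ?L x u \<partial>lborel \<partial>lborel)"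
    by (rule nn_integral_limit[symmetric])
  also have "\<dots> \<le> (\<integral>\<^sup>+x. liminf (\<lambda>n. \<integral>\<^sup>+u. ?g n x u \<partial>lborel) \<partial>lborel)"
  proof (rule nn_integral_mono_AE)
    show "AE x in lborel. (\<integral>\<^sup>+u. ?L x u \<partial>lborel) \<le> liminf (\<lambda>n. \<integral>\<^sup>+u. ?g n x u \<partial>lborel)"
      using f_cont
    proof eventually_elim
      case (elim x)
      have "AE u in lborel. u \<notin> {0 :: real ^ 'n}" by (intro AE_not_in countable_imp_null_set_lborel) auto
      then have "AE u in lborel. ?L x u \<le> liminf (\<lambda>n. ?g n x u)"
        by eventually_elim (intro liminf_rescaled[OF elim], simp)
      then have "(\<integral>\<^sup>+u. ?L x u \<partial>lborel) \<le> (\<integral>\<^sup>+u. liminf (\<lambda>n. ?g n x u) \<partial>lborel)"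
        by (rule nn_integral_mono_AE)
      also have "\<dots> \<le> liminf (\<lambda>n. \<integral>\<^sup>+u. ?g n x u \<partial>lborel)"
        by (rule nn_integral_liminf[OF gx])
      finally show ?case .
    qed
  qed
  also have "\<dots> \<le> liminf (\<lambda>n. \<integral>\<^sup>+x. \<integral>\<^sup>+u. ?g n x u \<partial>lborel \<partial>lborel)"
    by (rule nn_integral_liminf[OF gi])
  also have "\<dots> = liminf (\<lambda>n. ennreal (real n - 1) * mutual_prob n)"
  proof (rule Liminf_eq)
    show "\<forall>\<^sub>F n in sequentially. (\<integral>\<^sup>+x. \<integral>\<^sup>+u. ?g n x u \<partial>lborel \<partial>lborel) = ennreal (real n - 1) * mutual_prob n"
      using eventually_gt_at_top[of 0]
    proof eventually_elim
      case (elim n)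
      have Gx [measurable]: "rescaled n x \<in> borel_measurable lborel" for x
        using measurable_compose[OF measurable_Pair1'[of x borel borel] measurable_rescaled[of n]] by simp
      have Gi [measurable]: "(\<lambda>x. \<integral>\<^sup>+u. ennreal (1 / real n) * rescaled n x u \<partial>lborel) \<in> borel_measurable lborel"
      proof -
        have "(\<lambda>p. ennreal (1 / real n) * (case p of (x, u) \<Rightarrow> rescaled n x u)) \<in> borel_measurable (borel \<Otimes>\<^sub>M lborel)"
          by measurable
        then have "(\<lambda>(x, u). ennreal (1 / real n) * rescaled n x u) \<in> borel_measurable (borel \<Otimes>\<^sub>M lborel)"
          by (simp add: case_prod_beta)
        from lborel.borel_measurable_nn_integral[OF this] show ?thesis by simp
      qed
      have "ennreal (real n - 1) * mutual_prob n =
          (\<integral>\<^sup>+x. ennreal (real n - 1) * (\<integral>\<^sup>+u. ennreal (1 / real n) * rescaled n x u \<partial>lborel) \<partial>lborel)"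
        unfolding mutual_prob_eq[OF elim] by (rule nn_integral_cmult[symmetric]) measurable
      also have "\<dots> = (\<integral>\<^sup>+x. \<integral>\<^sup>+u. ennreal (real n - 1) * (ennreal (1 / real n) * rescaled n x u) \<partial>lborel \<partial>lborel)"
        by (intro nn_integral_cong nn_integral_cmult[symmetric]) measurable
      also have "\<dots> = (\<integral>\<^sup>+x. \<integral>\<^sup>+u. ?g n x u \<partial>lborel \<partial>lborel)"
      proof -
        have "ennreal (real n - 1) * (ennreal (1 / real n) * rescaled n x u) = ?g n x u" for x u
          unfolding mult.assoc[symmetric] using elim by (subst ennreal_mult[symmetric]) auto
        then show ?thesis by simp
      qed
      finally show ?case by simp
    qed
  qed
  finally show ?thesis .
qed

end

section \<open>Mutual nearest neighbours\<close>

text \<open>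
  Strict inequalities make the partner of a point unique.  Indices are paired rather than points, so
  the first conjunct has to exclude indices with the same value.
\<close>

definition mutual :: "'i set \<Rightarrow> ('i \<Rightarrow> 'a::metric_space) \<Rightarrow> 'i \<Rightarrow> 'i \<Rightarrow> bool" where
  "mutual I X i j \<longleftrightarrow> X i \<noteq> X j \<and>
     (\<forall>k\<in>I - {i, j}. dist (X i) (X j) < dist (X i) (X k) \<and> dist (X i) (X j) < dist (X j) (X k))"

lemma mutual_sym: "mutual I X i j \<Longrightarrow> mutual I X j i"
  by (auto simp: mutual_def dist_commute)

lemma mutual_unique:
  assumes "mutual I X i j" "mutual I X i k" "j \<in> I" "k \<in> I" "i \<noteq> j" "i \<noteq> k"
  shows "j = k"
proof (rule ccontr)
  assume "j \<noteq> k"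
  then have "dist (X i) (X j) < dist (X i) (X k)" "dist (X i) (X k) < dist (X i) (X j)"
    using assms by (auto simp: mutual_def)
  then show False by simp
qed

lemma mutual_inj:
  assumes "mutual I X i j" "i \<in> I" "k \<in> I" "X k = X i"
  shows "k = i"
proof (rule ccontr)
  assume "k \<noteq> i"
  show False
  proof (cases "k = j")
    case True then show False using assms by (simp add: mutual_def)
  next
    case False
    then have "dist (X i) (X j) < dist (X i) (X k)" using assms(1)[unfolded mutual_def] assms(3) \<open>k \<noteq> i\<close> by blast
    then show False using assms(4) zero_le_dist[of "X i" "X j"] by simp
  qed
qed

definition mutual_pairs :: "'i::linorder set \<Rightarrow> ('i \<Rightarrow> 'a::metric_space) \<Rightarrow> ('i \<times> 'i) set" where
  "mutual_pairs I X = {(i, j). i \<in> I \<and> j \<in> I \<and> i < j \<and> mutual I X i j}"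

text \<open>
  From each pair take the point \<open>hi\<close> with the larger function value; its nearest neighbour is the partner
  \<open>lo\<close>.  Since partners are unique, no \<open>lo\<close> is a \<open>hi\<close> of another pair, and
  \<open>num_intervals_ge_card\<close> applies.
\<close>

lemma card_mutual_pairs_le_num_intervals:
  fixes X :: "'i::linorder \<Rightarrow> 'a::metric_space" and f :: "'a \<Rightarrow> real"
  assumes I: "finite I"
  shows "card (mutual_pairs I X) \<le> num_intervals (pointwise (*)) (density_rips_poset (X ` I) dist f)
    (linearization (density_rips (X ` I) dist f) :: (real \<times> real, 'a set \<Rightarrow> 'k::field) diagram)"
proof -
  interpret augmented_metric_space "X ` I" f by unfold_locales (use I in simp)
  define hi where "hi = (\<lambda>(i, j). if f (X j) \<le> f (X i) then i else j :: 'i)"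
  define lo where "lo = (\<lambda>(i, j). if f (X j) \<le> f (X i) then j else i :: 'i)"
  let ?P = "mutual_pairs I X"
  have P: "hi p \<in> I" "lo p \<in> I" "hi p \<noteq> lo p" "mutual I X (hi p) (lo p)" "f (X (lo p)) \<le> f (X (hi p))"
    "p = (min (hi p) (lo p), max (hi p) (lo p))" if "p \<in> ?P" for p
    using that by (auto simp: mutual_pairs_def hi_def lo_def mutual_sym split: if_splits)
  have eqI: "p = q" if "p \<in> ?P" "q \<in> ?P" "hi p = hi q \<or> hi p = lo q" for p q
  proof -
    have "mutual I X (hi p) (lo p)" "lo p \<in> I" "hi p \<noteq> lo p" using P[OF that(1)] by auto
    moreover have "mutual I X (hi q) (lo q)" "mutual I X (lo q) (hi q)" "hi q \<in> I" "lo q \<in> I" "hi q \<noteq> lo q"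
      using P[OF that(2)] mutual_sym by auto
    ultimately have "hi p = hi q \<and> lo p = lo q \<or> hi p = lo q \<and> lo p = hi q"
      using that(3) mutual_unique by metis
    then have "min (hi p) (lo p) = min (hi q) (lo q)" "max (hi p) (lo p) = max (hi q) (lo q)"
      by (auto simp: min.commute max.commute)
    then show ?thesis using P(6)[OF that(1)] P(6)[OF that(2)] by simp
  qed
  have idx: "k = hi p" if "p \<in> ?P" "k \<in> I" "X k = X (hi p)" for k p
    using mutual_inj[OF P(4)[OF that(1)] P(1)[OF that(1)] that(2,3)] .
  have inj: "inj_on (\<lambda>p. X (hi p)) ?P"
  proof (rule inj_onI)
    fix p q assume pq: "p \<in> ?P" "q \<in> ?P" "X (hi p) = X (hi q)"
    have "hi p = hi q" by (rule idx[OF pq(2) P(1)[OF pq(1)] pq(3)])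
    then show "p = q" using eqI[OF pq(1,2)] by blast
  qed
  define nn where "nn = (\<lambda>x. X (lo (inv_into ?P (\<lambda>p. X (hi p)) x)))"
  have nn: "nn (X (hi p)) = X (lo p)" if "p \<in> ?P" for p
    unfolding nn_def using inv_into_f_f[OF inj that] by simp
  let ?X = "(\<lambda>p. X (hi p)) ` ?P"
  have "card ?P = card ?X" by (rule card_image[OF inj, symmetric])
  also have "\<dots> \<le> num_intervals (pointwise (*)) poset
      (linearization Rips :: (real \<times> real, 'a set \<Rightarrow> 'k::field) diagram)"
  proof (rule num_intervals_ge_card[where nn = nn])
    show "?X \<subseteq> X ` I" using P(1) by auto
    fix x assume "x \<in> ?X"
    then obtain p where p: "p \<in> ?P" "x = X (hi p)" by auto
    show "nn x \<in> X ` I - ?X"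
    proof
      show "nn x \<in> X ` I" using P(2)[OF p(1)] unfolding p(2) nn[OF p(1)] by (rule imageI)
      show "nn x \<notin> ?X"
      proof
        assume "nn x \<in> ?X"
        then obtain q where q: "q \<in> ?P" "X (lo p) = X (hi q)" unfolding p(2) nn[OF p(1)] by auto
        have "lo p = hi q" by (rule idx[OF q(1) P(2)[OF p(1)] q(2)])
        moreover from this have "q = p" using eqI[OF q(1) p(1)] by simp
        ultimately show False using P(3)[OF p(1)] by simp
      qed
    qed
    show "f (nn x) \<le> f x" unfolding p(2) nn[OF p(1)] by (rule P(5)[OF p(1)])
    fix z assume z: "z \<in> X ` I" "z \<noteq> x"
    then obtain k where k: "k \<in> I" "z = X k" by auto
    show "dist x (nn x) \<le> dist x z"
    proof (cases "k = lo p")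
      case False
      moreover have "k \<noteq> hi p" using z(2) p(2) k(2) by auto
      ultimately have "dist (X (hi p)) (X (lo p)) < dist (X (hi p)) (X k)"
        using P(4)[OF p(1)] k(1) by (simp add: mutual_def)
      then show ?thesis unfolding p(2) nn[OF p(1)] k(2) by simp
    qed (simp add: p(2) nn[OF p(1)] k(2))
  qed
  finally show ?thesis .
qed

section \<open>Measurability\<close>

text \<open>
  A function of finitely many measurable yes-no questions is a simple function.
\<close>

lemma measurable_finitely_many_types:
  fixes g :: "'w \<Rightarrow> real"
  assumes A: "finite A" and R: "\<And>q. q \<in> A \<Longrightarrow> {\<omega> \<in> space \<Omega>. R q \<omega>} \<in> sets \<Omega>"
    and g: "\<And>\<omega> \<omega>'. \<omega> \<in> space \<Omega> \<Longrightarrow> \<omega>' \<in> space \<Omega> \<Longrightarrow> (\<And>q. q \<in> A \<Longrightarrow> R q \<omega> = R q \<omega>') \<Longrightarrow> g \<omega> = g \<omega>'"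
  shows "g \<in> borel_measurable \<Omega>"
proof -
  define \<tau> where "\<tau> = (\<lambda>\<omega>. {q \<in> A. R q \<omega>})"
  define h where "h = (\<lambda>T. g (SOME \<omega>. \<omega> \<in> space \<Omega> \<and> \<tau> \<omega> = T))"
  have gh: "g \<omega> = h (\<tau> \<omega>)" if "\<omega> \<in> space \<Omega>" for \<omega>
  proof -
    let ?w = "SOME \<omega>'. \<omega>' \<in> space \<Omega> \<and> \<tau> \<omega>' = \<tau> \<omega>"
    have w: "?w \<in> space \<Omega> \<and> \<tau> ?w = \<tau> \<omega>" by (rule someI[of _ \<omega>]) (simp add: that)
    have "g \<omega> = g ?w"
    proof (rule g[OF that conjunct1[OF w]])
      fix q assume "q \<in> A"
      then show "R q \<omega> = R q ?w" using conjunct2[OF w] unfolding \<tau>_def by blast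
    qed
    then show ?thesis by (simp add: h_def)
  qed
  have "\<tau> \<in> \<Omega> \<rightarrow>\<^sub>M count_space (Pow A)"
  proof (subst measurable_count_space_eq2)
    show "finite (Pow A)" using A by simp
    show "\<tau> \<in> space \<Omega> \<rightarrow> Pow A \<and> (\<forall>T\<in>Pow A. \<tau> -` {T} \<inter> space \<Omega> \<in> sets \<Omega>)"
    proof (intro conjI ballI)
      show "\<tau> \<in> space \<Omega> \<rightarrow> Pow A" by (auto simp: \<tau>_def)
      fix T assume T: "T \<in> Pow A"
      have "\<tau> -` {T} \<inter> space \<Omega> = {\<omega> \<in> space \<Omega>. \<forall>q\<in>A. R q \<omega> \<longleftrightarrow> q \<in> T}"
        using T by (auto simp: \<tau>_def)
      also have "\<dots> \<in> sets \<Omega>"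
      proof (rule sets.sets_Collect_finite_All[OF _ A])
        fix q assume q: "q \<in> A"
        have "{\<omega> \<in> space \<Omega>. R q \<omega> \<longleftrightarrow> q \<in> T} =
            (if q \<in> T then {\<omega> \<in> space \<Omega>. R q \<omega>} else space \<Omega> - {\<omega> \<in> space \<Omega>. R q \<omega>})" by auto
        then show "{\<omega> \<in> space \<Omega>. R q \<omega> \<longleftrightarrow> q \<in> T} \<in> sets \<Omega>" using R[OF q] by auto
      qed
      finally show "\<tau> -` {T} \<inter> space \<Omega> \<in> sets \<Omega>" .
    qed
  qed
  moreover have "h \<in> count_space (Pow A) \<rightarrow>\<^sub>M borel" by simp
  ultimately have "(\<lambda>\<omega>. h (\<tau> \<omega>)) \<in> borel_measurable \<Omega>" by (rule measurable_compose)
  moreover have "g \<in> borel_measurable \<Omega> \<longleftrightarrow> (\<lambda>\<omega>. h (\<tau> \<omega>)) \<in> borel_measurable \<Omega>"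
    by (rule measurable_cong) (rule gh)
  ultimately show ?thesis by simp
qed

lemma num_eq_if_same_type:
  fixes X X' :: "'i \<Rightarrow> 'a::metric_space" and f :: "'a \<Rightarrow> real"
  assumes I: "finite I"
    and d: "\<And>i j k l. i \<in> I \<Longrightarrow> j \<in> I \<Longrightarrow> k \<in> I \<Longrightarrow> l \<in> I \<Longrightarrow>
      dist (X i) (X j) \<le> dist (X k) (X l) \<longleftrightarrow> dist (X' i) (X' j) \<le> dist (X' k) (X' l)"
    and f: "\<And>i j. i \<in> I \<Longrightarrow> j \<in> I \<Longrightarrow> f (X i) \<le> f (X j) \<longleftrightarrow> f (X' i) \<le> f (X' j)"
  defines "P \<equiv> \<lambda>X. density_rips_poset (X ` I) dist f"
    and "L \<equiv> \<lambda>X. linearization (density_rips (X ` I) dist f) :: (real \<times> real, 'a set \<Rightarrow> 'k::field) diagram"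
  shows "num_summands (pointwise (*)) (P X) (L X) = num_summands (pointwise (*)) (P X') (L X')"
    and "num_intervals (pointwise (*)) (P X) (L X) = num_intervals (pointwise (*)) (P X') (L X')"
proof -
  define b where "b = (\<lambda>x. X' (inv_into I X x))"
  have b: "b (X i) = X' i" if i: "i \<in> I" for i
  proof -
    have k: "inv_into I X (X i) \<in> I" "X (inv_into I X (X i)) = X i"
      using i by (auto intro: inv_into_into f_inv_into_f)
    have "dist (X (inv_into I X (X i))) (X i) \<le> dist (X i) (X i)" using k(2) by simp
    then have "dist (X' (inv_into I X (X i))) (X' i) \<le> dist (X' i) (X' i)"
      using d[OF k(1) i i i] by simp
    then show ?thesis by (simp add: b_def)
  qed
  have im: "b ` X ` I = X' ` I" using b by (auto simp: image_iff)
  have D: "dist x y \<le> dist z w \<longleftrightarrow> dist (b x) (b y) \<le> dist (b z) (b w)"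
    if xyzw: "x \<in> X ` I" "y \<in> X ` I" "z \<in> X ` I" "w \<in> X ` I" for x y z w
  proof -
    obtain i j k l where "i \<in> I" "j \<in> I" "k \<in> I" "l \<in> I" "x = X i" "y = X j" "z = X k" "w = X l"
      using xyzw by (elim imageE)
    then show ?thesis using d b by simp
  qed
  have F: "f x \<le> f y \<longleftrightarrow> f (b x) \<le> f (b y)" if xy: "x \<in> X ` I" "y \<in> X ` I" for x y
  proof -
    obtain i j where "i \<in> I" "j \<in> I" "x = X i" "y = X j" using xy by (elim imageE)
    then show ?thesis using f b by simp
  qed
  have fin: "finite (X ` I)" using I by simp
  from num_relabel[where M = "X ` I" and b = b and f = f and f' = f and ?'k = 'k, OF fin D F]
  show "num_summands (pointwise (*)) (P X) (L X) = num_summands (pointwise (*)) (P X') (L X')"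
    "num_intervals (pointwise (*)) (P X) (L X) = num_intervals (pointwise (*)) (P X') (L X')"
    unfolding P_def L_def im by simp_all
qed

section \<open>The probability of being mutual nearest neighbours\<close>

context density_on_Rn
begin

text \<open>
  Integrate out the coordinates \<open>i\<close> and \<open>j\<close> last: given their values \<open>x \<noteq> y\<close>, the conditions on the other
  coordinates are independent and each has probability \<^term>\<open>void_prob x y\<close>.
\<close>

lemma emeasure_PiM_mutual:
  assumes I: "finite I" and ij: "i \<in> I" "j \<in> I" "i \<noteq> j"
  shows "{z \<in> space (\<Pi>\<^sub>M k\<in>I. \<mu>). mutual I z i j} \<in> sets (\<Pi>\<^sub>M k\<in>I. \<mu>)"
    and "emeasure (\<Pi>\<^sub>M k\<in>I. \<mu>) {z \<in> space (\<Pi>\<^sub>M k\<in>I. \<mu>). mutual I z i j} = mutual_prob (card I)"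
proof -
  interpret PS: product_sigma_finite "\<lambda>_. \<mu>" by standard
  define J where "J = I - {i, j}"
  have Ieq: "I = insert i (insert j J)" and J: "finite J" "j \<notin> J" "i \<notin> insert j J"
    using ij I by (auto simp: J_def)
  have cJ: "card J = card I - 2" using J ij I unfolding Ieq by simp
  let ?M = "\<Pi>\<^sub>M k\<in>I. \<mu>" and ?N = "\<Pi>\<^sub>M k\<in>insert j J. \<mu>"
  have comp [measurable]: "(\<lambda>z. z k) \<in> borel_measurable ?M" if "k \<in> I" for k
    using measurable_component_singleton[OF that, of "\<lambda>_. \<mu>"] measurable_cong_sets[of ?M ?M \<mu> borel] by simp
  let ?A = "{z \<in> space ?M. mutual I z i j}"
  have "?A = {z \<in> space ?M. z i \<noteq> z j} \<inter> {z \<in> space ?M. \<forall>k\<in>J. dist (z i) (z j) < dist (z i) (z k) \<and> dist (z i) (z j) < dist (z j) (z k)}"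
    by (auto simp: mutual_def J_def)
  also have "\<dots> \<in> sets ?M"
  proof (intro sets.Int sets.sets_Collect_finite_All J(1))
    note [measurable] = comp[OF ij(1)] comp[OF ij(2)]
    have "{z \<in> space ?M. 0 < dist (z i) (z j)} \<in> sets ?M" by measurable
    then show "{z \<in> space ?M. z i \<noteq> z j} \<in> sets ?M" by simp
    fix k assume "k \<in> J"
    then have k: "k \<in> I" by (simp add: J_def)
    note [measurable] = comp[OF k]
    show "{z \<in> space ?M. dist (z i) (z j) < dist (z i) (z k) \<and> dist (z i) (z j) < dist (z j) (z k)} \<in> sets ?M"
      by measurable
  qed
  finally show A: "?A \<in> sets ?M" .
  have ind: "(indicator ?A :: _ \<Rightarrow> ennreal) \<in> borel_measurable (\<Pi>\<^sub>M k\<in>insert i (insert j J). \<mu>)"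
    using A unfolding Ieq[symmetric] by (rule borel_measurable_indicator)
  have "emeasure ?M ?A = (\<integral>\<^sup>+z. indicator ?A z \<partial>(\<Pi>\<^sub>M k\<in>insert i (insert j J). \<mu>))"
    using nn_integral_indicator[OF A] unfolding Ieq[symmetric] by simp
  also have "\<dots> = (\<integral>\<^sup>+x. \<integral>\<^sup>+z. indicator ?A (z(i := x)) \<partial>?N \<partial>\<mu>)"
    by (rule PS.product_nn_integral_insert_rev[OF _ J(3) ind]) (use J in simp)
  also have "\<dots> = (\<integral>\<^sup>+x. \<integral>\<^sup>+y. \<integral>\<^sup>+z. indicator ?A (z(j := y, i := x)) \<partial>(\<Pi>\<^sub>M k\<in>J. \<mu>) \<partial>\<mu> \<partial>\<mu>)"
  proof (rule nn_integral_cong)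
    fix x :: "real ^ 'n"
    have "(\<lambda>z. z(i := x)) \<in> ?N \<rightarrow>\<^sub>M (\<Pi>\<^sub>M k\<in>insert i (insert j J). \<mu>)"
      by (rule measurable_fun_upd[where J = "insert j J"]) auto
    from measurable_compose[OF this ind]
    show "(\<integral>\<^sup>+z. indicator ?A (z(i := x)) \<partial>?N) = (\<integral>\<^sup>+y. \<integral>\<^sup>+z. indicator ?A (z(j := y, i := x)) \<partial>(\<Pi>\<^sub>M k\<in>J. \<mu>) \<partial>\<mu>)"
      by (rule PS.product_nn_integral_insert_rev[OF J(1,2)])
  qed
  also have "\<dots> = (\<integral>\<^sup>+x. \<integral>\<^sup>+y. (if x \<noteq> y then void_prob x y ^ card J else 0) \<partial>\<mu> \<partial>\<mu>)"
  proof (intro nn_integral_cong)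
    fix x y :: "real ^ 'n"
    let ?S = "UNIV - (cball x (dist x y) \<union> cball y (dist x y))"
    have "(\<integral>\<^sup>+z. indicator ?A (z(j := y, i := x)) \<partial>(\<Pi>\<^sub>M k\<in>J. \<mu>)) =
        (\<integral>\<^sup>+z. (if x \<noteq> y then 1 else 0) * indicator (\<Pi>\<^sub>E k\<in>J. ?S) z \<partial>(\<Pi>\<^sub>M k\<in>J. \<mu>))"
    proof (rule nn_integral_cong)
      fix z assume z: "z \<in> space (\<Pi>\<^sub>M k\<in>J. \<mu>)"
      let ?z = "z(j := y, i := x)"
      have zE: "z \<in> extensional J" using z by (simp add: space_PiM PiE_def)
      have sp: "?z \<in> space ?M" unfolding Ieq using zE by (auto simp: space_PiM PiE_def extensional_def)
      have zk: "?z k = z k" if "k \<in> J" for k using that by (auto simp: J_def)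
      have zij: "?z i = x" "?z j = y" using ij(3) by simp_all
      have "mutual I ?z i j \<longleftrightarrow> x \<noteq> y \<and> (\<forall>k\<in>J. dist x y < dist x (z k) \<and> dist x y < dist y (z k))"
        unfolding mutual_def J_def[symmetric] zij using zk by simp
      also have "\<dots> \<longleftrightarrow> x \<noteq> y \<and> z \<in> (\<Pi>\<^sub>E k\<in>J. ?S)"
        using zE by (auto simp: PiE_iff not_le)
      finally show "indicator ?A ?z = ((if x \<noteq> y then 1 else 0) * indicator (\<Pi>\<^sub>E k\<in>J. ?S) z :: ennreal)"
        using sp by (simp add: indicator_def)
    qed
    also have "\<dots> = (if x \<noteq> y then 1 else 0) * emeasure (\<Pi>\<^sub>M k\<in>J. \<mu>) (\<Pi>\<^sub>E k\<in>J. ?S)"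
      by (rule nn_integral_cmult_indicator) (rule sets_PiM_I_finite[OF J(1)], simp)
    also have "emeasure (\<Pi>\<^sub>M k\<in>J. \<mu>) (\<Pi>\<^sub>E k\<in>J. ?S) = (\<Prod>k\<in>J. emeasure \<mu> ?S)"
      by (rule PS.emeasure_PiM[OF J(1)]) simp
    also have "\<dots> = void_prob x y ^ card J" by (simp add: void_prob_eq)
    also have "(if x \<noteq> y then 1 else 0) * void_prob x y ^ card J = (if x \<noteq> y then void_prob x y ^ card J else 0)" by simp
    finally show "(\<integral>\<^sup>+z. indicator ?A (z(j := y, i := x)) \<partial>(\<Pi>\<^sub>M k\<in>J. \<mu>)) = (if x \<noteq> y then void_prob x y ^ card J else 0)" .
  qed
  finally show "emeasure ?M ?A = mutual_prob (card I)" unfolding mutual_prob_def cJ .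
qed

lemma prob_mutual:
  fixes X :: "nat \<Rightarrow> 'w \<Rightarrow> real ^ 'n"
  assumes \<Omega>: "prob_space \<Omega>" and ind: "prob_space.indep_vars \<Omega> (\<lambda>_. borel) X {1..}"
    and dist: "\<And>i. i \<ge> 1 \<Longrightarrow> distributed \<Omega> lborel (X i) (\<lambda>x. ennreal (f x))"
    and ij: "i \<in> {1..n}" "j \<in> {1..n}" "i \<noteq> j"
  shows "{\<omega> \<in> space \<Omega>. mutual {1..n} (\<lambda>k. X k \<omega>) i j} \<in> sets \<Omega>"
    and "emeasure \<Omega> {\<omega> \<in> space \<Omega>. mutual {1..n} (\<lambda>k. X k \<omega>) i j} = mutual_prob n"
proof -
  interpret \<Omega>: prob_space \<Omega> by (rule \<Omega>)
  let ?I = "{1..n}"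
  have rv: "X k \<in> \<Omega> \<rightarrow>\<^sub>M borel" if "k \<in> ?I" for k
    using distributed_measurable[OF dist[of k]] that by simp
  have law: "distr \<Omega> borel (X k) = \<mu>" if "k \<in> ?I" for k
  proof -
    have "distr \<Omega> borel (X k) = distr \<Omega> lborel (X k)" by (rule distr_cong) simp_all
    also have "\<dots> = density lborel (\<lambda>x. ennreal (f x))"
      by (rule distributed_distr_eq_density[OF dist]) (use that in simp)
    finally show ?thesis by (simp add: \<mu>_def)
  qed
  have ne: "?I \<noteq> {}" using ij by auto
  have "\<Omega>.indep_vars (\<lambda>_. borel) X ?I" by (rule \<Omega>.indep_vars_subset[OF ind]) auto
  then have "distr \<Omega> (\<Pi>\<^sub>M k\<in>?I. borel) (\<lambda>\<omega>. \<lambda>k\<in>?I. X k \<omega>) = (\<Pi>\<^sub>M k\<in>?I. distr \<Omega> borel (X k))"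
    using \<Omega>.indep_vars_iff_distr_eq_PiM'[OF ne, of X "\<lambda>_. borel"] rv by blast
  also have "\<dots> = (\<Pi>\<^sub>M k\<in>?I. \<mu>)" by (rule PiM_cong) (use law in simp_all)
  finally have joint: "distr \<Omega> (\<Pi>\<^sub>M k\<in>?I. borel) (\<lambda>\<omega>. \<lambda>k\<in>?I. X k \<omega>) = (\<Pi>\<^sub>M k\<in>?I. \<mu>)" .
  have m: "(\<lambda>\<omega>. \<lambda>k\<in>?I. X k \<omega>) \<in> \<Omega> \<rightarrow>\<^sub>M (\<Pi>\<^sub>M k\<in>?I. borel)"
    by (rule measurable_restrict) (rule rv)
  let ?A = "{z \<in> space (\<Pi>\<^sub>M k\<in>?I. \<mu>). mutual ?I z i j}"
  have fin: "finite ?I" by simp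
  note A = emeasure_PiM_mutual[OF fin ij]
  have sets_eq: "sets (\<Pi>\<^sub>M k\<in>?I. \<mu>) = sets (\<Pi>\<^sub>M k\<in>?I. borel :: (real ^ 'n) measure)"
    by (rule sets_PiM_cong) simp_all
  have A': "?A \<in> sets (\<Pi>\<^sub>M k\<in>?I. borel :: (real ^ 'n) measure)" using A(1) unfolding sets_eq .
  have pre: "(\<lambda>\<omega>. \<lambda>k\<in>?I. X k \<omega>) -` ?A \<inter> space \<Omega> = {\<omega> \<in> space \<Omega>. mutual ?I (\<lambda>k. X k \<omega>) i j}"
    using ij by (auto simp: mutual_def space_PiM)
  show "{\<omega> \<in> space \<Omega>. mutual ?I (\<lambda>k. X k \<omega>) i j} \<in> sets \<Omega>"
    using measurable_sets[OF m A'] unfolding pre .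
  show "emeasure \<Omega> {\<omega> \<in> space \<Omega>. mutual ?I (\<lambda>k. X k \<omega>) i j} = mutual_prob n"
    using emeasure_distr[OF m A'] A(2) unfolding pre joint by simp
qed

end

section \<open>The expected proportion of intervals\<close>

theorem theorem5p1:
  fixes \<Omega> :: "'w measure"
    and X :: "nat \<Rightarrow> 'w \<Rightarrow> real ^ 'n"
    and f :: "real ^ 'n \<Rightarrow> real"
  defines "M \<equiv> \<lambda>n \<omega>. (\<lambda>i. X i \<omega>) ` {1..n}"
  defines "P \<equiv> \<lambda>n \<omega>. density_rips_poset (M n \<omega>) dist f"
  defines "LS \<equiv> \<lambda>n \<omega>. (linearization (density_rips (M n \<omega>) dist f)
      :: (real \<times> real, (real ^ 'n) set \<Rightarrow> 'k::field) diagram)"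
  defines "\<II> \<equiv> \<lambda>n \<omega>. num_intervals (pointwise (*)) (P n \<omega>) (LS n \<omega>)"
  defines "\<SS> \<equiv> \<lambda>n \<omega>. num_summands (pointwise (*)) (P n \<omega>) (LS n \<omega>)"
  assumes "prob_space \<Omega>"
    and "prob_space.indep_vars \<Omega> (\<lambda>_. borel) X {1..}"
    and "\<And>i. i \<ge> 1 \<Longrightarrow> distributed \<Omega> lborel (X i) (\<lambda>x. ennreal (f x))"
    and "\<And>x. f x \<ge> 0"
    and "AE x in lborel. isCont f x"
  shows "liminf (\<lambda>n. ereal (prob_space.expectation \<Omega> (\<lambda>\<omega>. real (\<II> n \<omega>) / real (\<SS> n \<omega>))))
           \<ge> ereal (c_const CARD('n))
         \<and> c_const 1 = 1 / 3
         \<and> \<bar>c_const 2 - 0.31\<bar> \<le> 0.005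
         \<and> decseq (\<lambda>d. c_const (Suc d)) \<and> c_const \<longlonglongrightarrow> 1 / 4"
proof (intro conjI c_const_1 c_const_2 decseq_c_const c_const_limit)
  interpret \<Omega>: prob_space \<Omega> by (rule assms(6))
  note ind = assms(7) and dist = assms(8) and nonneg = assms(9) and cont = assms(10)
  have f_meas: "f \<in> borel_measurable borel"
  proof -
    have "(\<lambda>x. ennreal (f x)) \<in> borel_measurable lborel"
      by (rule distributed_borel_measurable[OF dist[of 1]]) simp
    then have "(\<lambda>x. enn2real (ennreal (f x))) \<in> borel_measurable lborel" by measurable
    then show ?thesis using nonneg by simp
  qed
  have rv: "X i \<in> \<Omega> \<rightarrow>\<^sub>M borel" if "i \<ge> 1" for i
    using distributed_measurable[OF dist[OF that]] by simp
  interpret density_on_Rn f "density lborel (\<lambda>x. ennreal (f x))"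
  proof (rule density_on_Rn.intro)
    have "prob_space (distr \<Omega> lborel (X 1))"
      by (rule \<Omega>.prob_space_distr) (rule distributed_measurable[OF dist], simp)
    then show "prob_space (density lborel (\<lambda>x. ennreal (f x)))"
      using distributed_distr_eq_density[OF dist[of 1]] by simp
  qed (use f_meas nonneg cont in auto)
  let ?r = "\<lambda>n \<omega>. real (\<II> n \<omega>) / real (\<SS> n \<omega>)"
  have le1: "?r n \<omega> \<le> 1" for n \<omega>
    unfolding \<II>_def \<SS>_def num_intervals_def num_summands_def by (simp add: divide_le_eq)
  have meas: "?r n \<in> borel_measurable \<Omega>" for n
  proof -
    (* one family of questions covers both kinds of comparisons: for i = k and j = l the comparison of
       distances is trivially true, so that such a question asks for the comparison of function values *)
    let ?R = "\<lambda>(i, j, k, l) \<omega>. dist (X i \<omega>) (X j \<omega>) \<le> dist (X k \<omega>) (X l \<omega>) \<and> (i = k \<and> j = l \<longrightarrow> f (X i \<omega>) \<le> f (X j \<omega>))"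
    let ?I = "{1..n}"
    show ?thesis
    proof (rule measurable_finitely_many_types[where A = "?I \<times> ?I \<times> ?I \<times> ?I" and R = ?R])
      fix q assume "q \<in> ?I \<times> ?I \<times> ?I \<times> ?I"
      then obtain i j k l where q: "q = (i, j, k, l)" "i \<ge> 1" "j \<ge> 1" "k \<ge> 1" "l \<ge> 1" by auto
      note [measurable] = rv[OF q(2)] rv[OF q(3)] rv[OF q(4)] rv[OF q(5)] f_meas
      show "{\<omega> \<in> space \<Omega>. ?R q \<omega>} \<in> sets \<Omega>" unfolding q(1) by simp
    next
      fix \<omega> \<omega>' assume R: "\<And>q. q \<in> ?I \<times> ?I \<times> ?I \<times> ?I \<Longrightarrow> ?R q \<omega> = ?R q \<omega>'"
      have f: "f (X i \<omega>) \<le> f (X j \<omega>) \<longleftrightarrow> f (X i \<omega>') \<le> f (X j \<omega>')" if "i \<in> ?I" "j \<in> ?I" for i j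
        using R[of "(i, j, i, j)"] that by simp
      have d: "dist (X i \<omega>) (X j \<omega>) \<le> dist (X k \<omega>) (X l \<omega>) \<longleftrightarrow> dist (X i \<omega>') (X j \<omega>') \<le> dist (X k \<omega>') (X l \<omega>')"
        if "i \<in> ?I" "j \<in> ?I" "k \<in> ?I" "l \<in> ?I" for i j k l
        using R[of "(i, j, k, l)"] that by (cases "i = k \<and> j = l") auto
      have fin: "finite ?I" by simp
      have "\<SS> n \<omega> = \<SS> n \<omega>'" "\<II> n \<omega> = \<II> n \<omega>'"
        unfolding \<SS>_def \<II>_def P_def LS_def M_def
        by (rule num_eq_if_same_type[OF fin]; use d f in simp)+
      then show "?r n \<omega> = ?r n \<omega>'" by simp
    qed simp
  qed
  have int_r: "integrable \<Omega> (?r n)" for n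
    by (rule \<Omega>.integrable_const_bound[of _ 1]) (use meas[of n] le1[of n] in auto)
  have lower: "(real n - 1) / 2 * enn2real (mutual_prob n) \<le> \<Omega>.expectation (?r n)" if n: "n \<ge> 1" for n
  proof -
    let ?I = "{1..n}"
    let ?T = "{(i, j). i \<in> ?I \<and> j \<in> ?I \<and> i < j}"
    let ?E = "\<lambda>p. {\<omega> \<in> space \<Omega>. mutual ?I (\<lambda>k. X k \<omega>) (fst p) (snd p)}"
    have finT: "finite ?T" by (rule finite_subset[of _ "?I \<times> ?I"]) auto
    have E: "?E p \<in> sets \<Omega>" "emeasure \<Omega> (?E p) = mutual_prob n" if "p \<in> ?T" for p
      using prob_mutual[OF assms(6) ind dist, of "fst p" n "snd p"] that by auto
    have K: "real (card (mutual_pairs ?I (\<lambda>k. X k \<omega>))) = (\<Sum>p\<in>?T. indicator (?E p) \<omega>)"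
      if "\<omega> \<in> space \<Omega>" for \<omega>
    proof -
      have "mutual_pairs ?I (\<lambda>k. X k \<omega>) = ?T \<inter> {p. \<omega> \<in> ?E p}"
        using that by (auto simp: mutual_pairs_def)
      then have "real (card (mutual_pairs ?I (\<lambda>k. X k \<omega>))) = (\<Sum>p\<in>?T \<inter> {p. \<omega> \<in> ?E p}. 1)" by simp
      also have "\<dots> = (\<Sum>p\<in>?T. if \<omega> \<in> ?E p then 1 else 0)" by (subst sum.inter_restrict[OF finT]) simp
      also have "\<dots> = (\<Sum>p\<in>?T. indicator (?E p) \<omega>)" by (simp add: indicator_def of_bool_def)
      finally show ?thesis .
    qed
    have ineq: "(\<Sum>p\<in>?T. indicator (?E p) \<omega>) / real n \<le> ?r n \<omega>" if "\<omega> \<in> space \<Omega>" for \<omega>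
    proof -
      have fin: "finite ?I" by simp
      have kI: "card (mutual_pairs ?I (\<lambda>k. X k \<omega>)) \<le> \<II> n \<omega>"
        unfolding \<II>_def P_def LS_def M_def by (rule card_mutual_pairs_le_num_intervals[OF fin])
      interpret A: augmented_metric_space "M n \<omega>" f by unfold_locales (simp add: M_def)
      have "\<SS> n \<omega> \<le> card (M n \<omega>)" unfolding \<SS>_def P_def LS_def by (rule A.num_summands_le_card)
      also have "\<dots> \<le> n" unfolding M_def using card_image_le[OF fin, of "\<lambda>i. X i \<omega>"] by simp
      finally have S: "\<SS> n \<omega> \<le> n" .
      have IS: "\<II> n \<omega> \<le> \<SS> n \<omega>" unfolding \<II>_def \<SS>_def num_intervals_def num_summands_def by simp
      show ?thesis
      proof (cases "\<SS> n \<omega> = 0")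
        case True
        then have "card (mutual_pairs ?I (\<lambda>k. X k \<omega>)) = 0" using kI IS by simp
        then show ?thesis using K[OF that] by simp
      next
        case False
        have "real (card (mutual_pairs ?I (\<lambda>k. X k \<omega>))) / real n \<le> ?r n \<omega>"
          using kI S False by (intro frac_le) auto
        then show ?thesis using K[OF that] by simp
      qed
    qed
    have cT: "real (card ?T) = real n * (real n - 1) / 2"
    proof -
      have "?T = (\<Union>j\<in>?I. (\<lambda>i. (i, j)) ` {1..<j})" by force
      then have "card ?T = (\<Sum>j\<in>?I. card ((\<lambda>i. (i, j)) ` {1..<j}))"
        by (simp only:) (rule card_UN_disjoint, auto)
      also have "\<dots> = (\<Sum>j=1..n. j - 1)" by (intro sum.cong) (auto simp: card_image inj_on_def)
      finally have "real (card ?T) = (\<Sum>j=1..n. real (j - 1))" by simp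
      also have "\<dots> = real n * (real n - 1) / 2" by (induction n) (auto simp: field_simps)
      finally show ?thesis .
    qed
    have "(real n - 1) / 2 * enn2real (mutual_prob n) = real (card ?T) * enn2real (mutual_prob n) / real n"
      unfolding cT using n by (simp add: field_simps)
    also have "\<dots> = (\<Sum>p\<in>?T. measure \<Omega> (?E p)) / real n"
      using E(2) by (simp add: measure_def)
    also have "\<dots> = (\<integral>\<omega>. (\<Sum>p\<in>?T. indicator (?E p) \<omega>) / real n \<partial>\<Omega>)"
    proof -
      have "(\<integral>\<omega>. (\<Sum>p\<in>?T. indicator (?E p) \<omega>) \<partial>\<Omega>) = (\<Sum>p\<in>?T. measure \<Omega> (?E p))"
        using E(1) by (subst Bochner_Integration.integral_sum) (auto simp: less_top[symmetric] Int_absorb1 sets.sets_into_space)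
      then show ?thesis by simp
    qed
    also have "\<dots> \<le> \<Omega>.expectation (?r n)"
    proof (rule integral_mono_AE)
      show "integrable \<Omega> (\<lambda>\<omega>. (\<Sum>p\<in>?T. indicator (?E p) \<omega>) / real n)"
        using E(1) by (intro integrable_divide_zero Bochner_Integration.integrable_sum) (auto simp: less_top[symmetric])
      show "AE \<omega> in \<Omega>. (\<Sum>p\<in>?T. indicator (?E p) \<omega>) / real n \<le> ?r n \<omega>"
        by (rule AE_I2) (rule ineq)
    qed (rule int_r)
    finally show ?thesis .
  qed
  have Qfin: "mutual_prob n \<noteq> \<infinity>" if "n \<ge> 2" for n
  proof -
    have "emeasure \<Omega> {\<omega> \<in> space \<Omega>. mutual {1..n} (\<lambda>k. X k \<omega>) 1 2} = mutual_prob n"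
      using that by (intro prob_mutual(2)[OF assms(6) ind dist]) auto
    then show ?thesis using \<Omega>.emeasure_finite[of "{\<omega> \<in> space \<Omega>. mutual {1..n} (\<lambda>k. X k \<omega>) 1 2}"] by simp
  qed
  show "ereal (c_const CARD('n)) \<le> liminf (\<lambda>n. ereal (\<Omega>.expectation (?r n)))"
    unfolding le_Liminf_iff
  proof (intro allI impI)
    fix y :: ereal assume y: "y < ereal (c_const CARD('n))"
    show "\<forall>\<^sub>F n in sequentially. y < ereal (\<Omega>.expectation (?r n))"
    proof (cases "y < 0")
      case True
      have "0 \<le> \<Omega>.expectation (?r n)" for n by (rule integral_nonneg_AE) simp
      then have "y < ereal (\<Omega>.expectation (?r n))" for n
        using True by (metis ereal_less_eq(5) less_le_trans)
      then show ?thesis by simp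
    next
      case False
      then obtain t where t: "y = ereal t" "0 \<le> t" "t < c_const CARD('n)"
        using y by (cases y) auto
      have b: "c_const CARD('n) = b_const CARD('n) / 2" by (simp add: c_const_def)
      have "ennreal (2 * t) < ennreal (b_const CARD('n))"
        using t b by (intro ennreal_lessI) auto
      then have "\<forall>\<^sub>F n in sequentially. ennreal (2 * t) < ennreal (real n - 1) * mutual_prob n"
        using liminf_mutual_prob unfolding le_Liminf_iff by blast
      then show ?thesis
        using eventually_ge_at_top[of 2]
      proof eventually_elim
        case (elim n)
        obtain q where q: "mutual_prob n = ennreal q" "q \<ge> 0" using Qfin[OF elim(2)] by (cases "mutual_prob n") auto
        have "ennreal (2 * t) < ennreal ((real n - 1) * q)"
          using elim q by (simp add: ennreal_mult)
        then have "2 * t < (real n - 1) * q" using t(2) by (simp add: ennreal_less_iff)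
        then have "t < (real n - 1) / 2 * enn2real (mutual_prob n)" using q by simp
        also have "\<dots> \<le> \<Omega>.expectation (?r n)" by (rule lower) (use elim in simp)
        finally show ?case by (simp add: t(1))
      qed
    qed
  qed
qed

end
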